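(* Let $q\in H^{-1}_0$ and $-1/2\le s\le0$, $2\le p<\infty$. If the sequence of gap lengths $(\gamma_n(q))_{n\ge1}$ is in $\ell^{s,p}(\mathbb N)$, then $q\in\mathcal{FL}^{s,p}_0$.
   Context: $\langle n\rangle=1+|n|$. $\ell^{s,p}(\mathbb N)$: real sequences $(a_n)_{n\ge1}$ with $(\sum_{n\ge1}\langle n\rangle^{sp}|a_n|^p)^{1/p}<\infty$. $\mathcal{FL}^{s,p}_0$: real 1-periodic distributions $u$ with $u_0=0$ and $\sum_{n\in\mathbb Z}\langle n\rangle^{sp}|u_n|^p<\infty$, where $u_n=\int_0^1u\,e^{-2\pi inx}dx$. $H^{s}_0=\mathcal{FL}^{s,2}_0$. For $q\in H^{-1}_0$, $L(q)=-\partial_x^2+q$ is considered as an operator on $H^{-1}(\mathbb R/2\mathbb Z,\mathbb C)$ with domain $H^1(\mathbb R/2\mathbb Z,\mathbb C)$ (multiplication by $q$ is given by convolution of the Fourier coefficients of the 1-periodic distribution $q$, viewed as 2-periodic, with those of the function). Its spectrum is discrete and real; its eigenvalues counted with multiplicities are $\lambda_0^+<\lambda_1^-\le\lambda_1^+<\lambda_2^-\le\lambda_2^+<\cdots$. The gap lengths are $\gamma_n(q)=\lambda_n^+(q)-\lambda_n^-(q)$, $n\ge1$. *)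

theory Defs
  imports "HOL-Analysis.Analysis" "HOL-Library.Function_Algebras"
begin

definition japanese :: "real \<Rightarrow> real" (\<open>\<langle>_\<rangle>\<close>) where
  "\<langle>x\<rangle> = 1 + \<bar>x\<bar>"

definition weighted_lp :: "real \<Rightarrow> real \<Rightarrow> (nat \<Rightarrow> real) set" where
  \<comment> \<open>sequences indexed by \<open>n \<ge> 1\<close>; the value at \<open>0\<close> is irrelevant\<close>
  "weighted_lp s p = {a. (\<lambda>n. \<langle>real n\<rangle> powr (s * p) * \<bar>a n\<bar> powr p) summable_on {1..}}"

definition iter_deriv :: "nat \<Rightarrow> (real \<Rightarrow> complex) \<Rightarrow> real \<Rightarrow> complex" where
  "iter_deriv k = (\<lambda>\<phi> x. vector_derivative \<phi> (at x)) ^^ k"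

definition test_functions :: "real \<Rightarrow> (real \<Rightarrow> complex) set" where
  "test_functions T =
     {\<phi>. (\<forall>x. \<phi> (x + T) = \<phi> x) \<and> (\<forall>k x. iter_deriv k \<phi> differentiable (at x))}"

type_synonym distribution = "(real \<Rightarrow> complex) \<Rightarrow> complex"

text \<open>
  Complex \<open>T\<close>-periodic distributions: continuous linear functionals on the smooth \<open>T\<close>-periodic
  functions, the pairing extending \<open>\<integral>\<^sub>0\<^sup>T u \<phi> dx\<close>. The value outside the test functions is
  normalised to 0, so that equality of functionals is equality of distributions and the
  distributions form a subspace of the pointwise vector space.
\<close>

definition periodic_distributions :: "real \<Rightarrow> distribution set" where
  "periodic_distributions T =
     {u. (\<forall>\<phi>\<in>test_functions T. \<forall>\<psi>\<in>test_functions T. u (\<lambda>x. \<phi> x + \<psi> x) = u \<phi> + u \<psi>) \<and>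
         (\<forall>c. \<forall>\<phi>\<in>test_functions T. u (\<lambda>x. c * \<phi> x) = c * u \<phi>) \<and>
         (\<exists>C N. \<forall>\<phi>\<in>test_functions T.
            norm (u \<phi>) \<le> C * (\<Sum>k\<le>N. SUP x\<in>{0..T}. norm (iter_deriv k \<phi> x))) \<and>
         (\<forall>\<phi>. \<phi> \<notin> test_functions T \<longrightarrow> u \<phi> = 0)}"

definition real_distribution :: "distribution \<Rightarrow> bool" where
  "real_distribution u \<longleftrightarrow> (\<forall>\<phi>. u (\<lambda>x. cnj (\<phi> x)) = cnj (u \<phi>))"

definition fourier_mode :: "real \<Rightarrow> int \<Rightarrow> real \<Rightarrow> complex" where
  "fourier_mode T n x = cis (2 * pi * of_int n * x / T)"

definition fourier_coeff :: "real \<Rightarrow> distribution \<Rightarrow> int \<Rightarrow> complex" where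
  "fourier_coeff T u n = u (fourier_mode T (- n)) / of_real T"

definition fourier_lebesgue :: "real \<Rightarrow> real \<Rightarrow> real \<Rightarrow> distribution set" where
  "fourier_lebesgue T s p = {u \<in> periodic_distributions T.
     (\<lambda>n. \<langle>of_int n\<rangle> powr (s * p) * norm (fourier_coeff T u n) powr p) summable_on UNIV}"

definition sobolev :: "real \<Rightarrow> real \<Rightarrow> distribution set" where
  "sobolev T s = fourier_lebesgue T s 2"

definition fourier_lebesgue0 :: "real \<Rightarrow> real \<Rightarrow> distribution set" where
  "fourier_lebesgue0 s p =
     {u \<in> fourier_lebesgue 1 s p. real_distribution u \<and> fourier_coeff 1 u 0 = 0}"

definition sobolev0 :: "real \<Rightarrow> distribution set" where
  "sobolev0 s = fourier_lebesgue0 s 2"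

definition distr_deriv :: "real \<Rightarrow> distribution \<Rightarrow> distribution" where
  "distr_deriv T u = (\<lambda>\<phi>. if \<phi> \<in> test_functions T then - u (iter_deriv 1 \<phi>) else 0)"

text \<open>
  A 1-periodic distribution viewed as a 2-periodic one, from
  \<open>\<integral>\<^sub>0\<^sup>2 u \<phi> dx = \<integral>\<^sub>0\<^sup>1 u(x) (\<phi>(x) + \<phi>(x+1)) dx\<close>. Its 2-periodic Fourier coefficients are those of
  \<open>u\<close> at the even indices and 0 at the odd ones.
\<close>

definition as_2_periodic :: "distribution \<Rightarrow> distribution" where
  "as_2_periodic u =
     (\<lambda>\<phi>. if \<phi> \<in> test_functions 2 then u (\<lambda>x. \<phi> x + \<phi> (x + 1)) else 0)"

text \<open>The distribution \<open>\<Sum>\<^sub>n a\<^sub>n e\<^sub>n\<close>, where \<open>e\<^sub>n\<close> is \<^const>\<open>fourier_mode\<close>.\<close>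

definition of_fourier_coeffs :: "real \<Rightarrow> (int \<Rightarrow> complex) \<Rightarrow> distribution" where
  "of_fourier_coeffs T a =
     (\<lambda>\<phi>. if \<phi> \<in> test_functions T
          then \<Sum>\<^sub>\<infinity>n. a n * integral {0..T} (\<lambda>x. fourier_mode T n x * \<phi> x) else 0)"

definition distr_mult :: "real \<Rightarrow> distribution \<Rightarrow> distribution \<Rightarrow> distribution" where
  "distr_mult T u v =
     of_fourier_coeffs T (\<lambda>n. \<Sum>\<^sub>\<infinity>m. fourier_coeff T u (n - m) * fourier_coeff T v m)"

definition schroedinger :: "distribution \<Rightarrow> distribution \<Rightarrow> distribution" where
  "schroedinger q f =
     (\<lambda>\<phi>. - distr_deriv 2 (distr_deriv 2 f) \<phi> + distr_mult 2 (as_2_periodic q) f \<phi>)"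

definition eigenspace :: "distribution \<Rightarrow> complex \<Rightarrow> distribution set" where
  "eigenspace q \<mu> = {f \<in> sobolev 2 1. schroedinger q f = (\<lambda>\<phi>. \<mu> * f \<phi>)}"

interpretation distr: vector_space "\<lambda>(c::complex) (u::distribution) \<phi>. c * u \<phi>"
  by unfold_locales (auto simp: fun_eq_iff algebra_simps)

definition multiplicity :: "distribution \<Rightarrow> complex \<Rightarrow> nat" where
  "multiplicity q \<mu> = distr.dim (eigenspace q \<mu>)"

text \<open>
  The eigenvalues in increasing order, each repeated according to its multiplicity. The
  quantifier over complex \<open>\<mu>\<close> makes the list exhaust all eigenvalues.
\<close>

definition eigenvalue_list :: "distribution \<Rightarrow> (nat \<Rightarrow> real) \<Rightarrow> bool" where
  "eigenvalue_list q l \<longleftrightarrow> mono l \<and>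
     (\<forall>\<mu>::complex. finite {k. complex_of_real (l k) = \<mu>} \<and>
                   card {k. complex_of_real (l k) = \<mu>} = multiplicity q \<mu>)"

definition eigenvalues :: "distribution \<Rightarrow> nat \<Rightarrow> real" where
  "eigenvalues q = (THE l. eigenvalue_list q l)"

text \<open>In the ordering \<open>\<lambda>\<^sub>0\<^sup>+ < \<lambda>\<^sub>1\<^sup>- \<le> \<lambda>\<^sub>1\<^sup>+ < \<lambda>\<^sub>2\<^sup>- \<le> \<dots>\<close>:\<close>

definition lambda_plus :: "distribution \<Rightarrow> nat \<Rightarrow> real" where
  "lambda_plus q n = eigenvalues q (2 * n)"

definition lambda_minus :: "distribution \<Rightarrow> nat \<Rightarrow> real" where
  \<comment> \<open>for \<open>n \<ge> 1\<close>\<close>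
  "lambda_minus q n = eigenvalues q (2 * n - 1)"

definition gap_length :: "distribution \<Rightarrow> nat \<Rightarrow> real" where
  "gap_length q n = lambda_plus q n - lambda_minus q n"

end

theory Submission imports Defs "HOL-Complex_Analysis.Great_Picard"
begin

text \<open>
  On the Fourier side \<open>L(q)\<close> is the operator \<open>\<pi>\<^sup>2k\<^sup>2\<close> plus convolution with \<open>Q\<close>, where
  \<open>Q\<^sub>2\<^sub>j = q\<^sub>j\<close> and \<open>Q\<^sub>j = 0\<close> for odd \<open>j\<close>. Its form is bounded below with compact embedding, so the
  eigenvalues are min-max values. On sequences vanishing at \<open>\<plusminus>n\<close> the form of \<open>Q\<close> is dominated by
  the weight \<open>|k\<^sup>2 - n\<^sup>2|\<close> for large \<open>n\<close>, since the corresponding Hilbert-Schmidt norm tends to 0 for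
  \<open>q \<in> H\<^sup>-\<^sup>1\<close>. Trial spaces spanned by the modes with \<open>|k| < n\<close>, respectively \<open>|k| > n\<close>, and one
  vector \<open>e\<^sub>n + \<tau> e\<^sub>-\<^sub>n\<close> whose phase \<open>\<tau>\<close> makes \<open>\<tau> q\<^sub>n = \<mp>|q\<^sub>n|\<close> then bound \<open>\<lambda>\<^sub>n\<^sup>-\<close> from above and
  \<open>\<lambda>\<^sub>n\<^sup>+\<close> from below, and give, without any perturbation expansion,
  \<open>|q\<^sub>n| \<le> \<gamma>\<^sub>n / 2 + (\<Sum>\<^sub>i |q\<^sub>i|\<^sup>2 / (|i| |n - i|)) / 2\<close>.

  In terms of the square summable \<open>a\<^sub>n = |q\<^sub>n| / n\<close>, the terms of this error with \<open>|i - n| \<le> n/2\<close> form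
  a linear operator in \<open>a\<close> with small norm in every weighted \<open>\<ell>\<^sup>P\<close> with \<open>P \<ge> 2\<close>, and are absorbed;
  the remaining terms are \<open>O(n\<^sup>-\<^sup>2\<^sup>\<delta>)\<close> as soon as \<open>n\<^sup>\<delta> a\<^sub>n\<close> is square summable. One first gains such a
  \<open>\<delta> > 0\<close> in the \<open>\<ell>\<^sup>2\<close> scale, and then the weight \<open>n\<^sup>1\<^sup>+\<^sup>s\<close> in \<open>\<ell>\<^sup>p\<close>.
\<close>

section \<open>Sums over the integers\<close>

text \<open>The eigenvalues are given only as the ordered list determined by the dimensions of the
  distributional eigenspaces. Identifying its m-th entry with a min-max value takes a complete
  eigensystem, and passing from distributions to sequences takes the Fourier expansion of an
  arbitrary periodic distribution. Beyond that only one inequality for each gap edge is used. The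
  indices fit because the modes |k| < n and one further vector span dimension 2n, while vanishing
  for |k| < n and one relation between the values at n and -n are 2n linear conditions. The ranges
  of \<open>s\<close> and \<open>p\<close> place t = s + 1/p between -1/2 (excluded) and 1/2
  (included). The first gain \<delta> must satisfy \<delta> < 1/2 + t, so that the gap lengths enter
  the l^2 estimate, \<delta> < 1/2, so that a merely bounded far part does, and 2 \<delta> > t, so
  that the improved far part lies in the final space. The lower bound on t leaves room for \<delta>
  > 0, the upper bound makes the last two conditions compatible.\<close>

lemma nonneg_sum_bounded:
  fixes f :: "'a \<Rightarrow> real"
  assumes "\<And>x. x \<in> A \<Longrightarrow> 0 \<le> f x"
    and "\<And>F. finite F \<Longrightarrow> F \<subseteq> A \<Longrightarrow> sum f F \<le> B"
  shows "f summable_on A" and "infsum f A \<le> B"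
proof -
  show s: "f summable_on A"
    by (rule nonneg_bdd_above_summable_on) (use assms in \<open>auto intro!: bdd_aboveI2\<close>)
  show "infsum f A \<le> B"
    using s assms(2) by (rule infsum_le_finite_sums)
qed

lemma infsum_Cauchy_Schwarz:
  fixes a b :: "'a \<Rightarrow> real"
  assumes "(\<lambda>i. (a i)\<^sup>2) summable_on A" and "(\<lambda>i. (b i)\<^sup>2) summable_on A"
  shows "(\<lambda>i. \<bar>a i * b i\<bar>) summable_on A"
    and "(\<Sum>\<^sub>\<infinity>i\<in>A. \<bar>a i * b i\<bar>) \<le> sqrt (\<Sum>\<^sub>\<infinity>i\<in>A. (a i)\<^sup>2) * sqrt (\<Sum>\<^sub>\<infinity>i\<in>A. (b i)\<^sup>2)"
proof -
  have *: "(\<Sum>i\<in>F. \<bar>a i * b i\<bar>) \<le> sqrt (\<Sum>\<^sub>\<infinity>i\<in>A. (a i)\<^sup>2) * sqrt (\<Sum>\<^sub>\<infinity>i\<in>A. (b i)\<^sup>2)"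
    if F: "finite F" "F \<subseteq> A" for F
  proof -
    have "(\<Sum>i\<in>F. \<bar>a i * b i\<bar>) \<le> L2_set a F * L2_set b F"
      using L2_set_mult_ineq[of a b F] by (simp add: abs_mult)
    also have "\<dots> \<le> sqrt (\<Sum>\<^sub>\<infinity>i\<in>A. (a i)\<^sup>2) * sqrt (\<Sum>\<^sub>\<infinity>i\<in>A. (b i)\<^sup>2)"
      unfolding L2_set_def
      by (intro mult_mono real_sqrt_le_mono finite_sum_le_infsum assms F)
        (auto intro!: infsum_nonneg sum_nonneg)
    finally show ?thesis .
  qed
  show "(\<lambda>i. \<bar>a i * b i\<bar>) summable_on A"
    and "(\<Sum>\<^sub>\<infinity>i\<in>A. \<bar>a i * b i\<bar>) \<le> sqrt (\<Sum>\<^sub>\<infinity>i\<in>A. (a i)\<^sup>2) * sqrt (\<Sum>\<^sub>\<infinity>i\<in>A. (b i)\<^sup>2)"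
    using nonneg_sum_bounded[of A "\<lambda>i. \<bar>a i * b i\<bar>", OF _ *] by auto
qed

lemma summable_on_int_even:
  fixes f :: "int \<Rightarrow> real"
  assumes "\<And>k. f (- k) = f k" and "(\<lambda>n. f (int n)) summable_on {1..}"
  shows "f summable_on UNIV"
proof -
  have 1: "f summable_on int ` {1..}"
    using assms(2) by (subst summable_on_reindex) (auto simp: o_def)
  have 2: "f summable_on (\<lambda>n. - int n) ` {1..}"
    using assms by (subst summable_on_reindex) (auto simp: o_def inj_on_def)
  have "f summable_on (int ` {1..} \<union> (\<lambda>n. - int n) ` {1..}) \<union> {0}"
    by (intro summable_on_union 1 2) auto
  also have "(int ` {1..} \<union> (\<lambda>n. - int n) ` {1..}) \<union> {0} = (UNIV :: int set)"
  proof -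
    have "k \<in> (int ` {1..} \<union> (\<lambda>n. - int n) ` {1..}) \<union> {0}" for k :: int
    proof (cases "k > 0")
      case True
      then have "k = int (nat k)" "nat k \<in> {1..}" by auto
      then show ?thesis by blast
    next
      case False
      show ?thesis
      proof (cases "k = 0")
        case False
        with \<open>\<not> k > 0\<close> have "k = - int (nat (-k))" "nat (-k) \<in> {1..}" by auto
        then show ?thesis by blast
      qed simp
    qed
    then show ?thesis by blast
  qed
  finally show ?thesis .
qed

text \<open>Twice the Riemann zeta value at 3/2; the term at 0 is 0 because
  \<open>0 powr a = 0\<close>. Of the total decay 2 of the kernel 1/(|x| |d - x|), the exponent 3/2
  pays for summability and 1/2 is left over as decay in d.\<close>

definition zeta32 :: real where
  "zeta32 = (\<Sum>\<^sub>\<infinity>x::int. \<bar>real_of_int x\<bar> powr (-3/2))"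

lemma zeta32_summable: "(\<lambda>x::int. \<bar>real_of_int x\<bar> powr (-3/2)) summable_on UNIV"
proof (rule summable_on_int_even)
  have "summable (\<lambda>n. real n powr (-3/2))"
    by (subst summable_real_powr_iff) auto
  then have "(\<lambda>n. real n powr (-3/2)) summable_on UNIV"
    by (simp add: summable_on_UNIV_nonneg_real_iff)
  then show "(\<lambda>n. \<bar>real_of_int (int n)\<bar> powr (- 3 / 2)) summable_on {1..}"
    using summable_on_subset_banach[of "\<lambda>n. real n powr (-3/2)" UNIV "{1..}"] by simp
qed simp

lemma zeta32_nonneg: "0 \<le> zeta32"
  unfolding zeta32_def by (rule infsum_nonneg) simp

lemma infsum_int_shift:
  fixes f :: "int \<Rightarrow> 'a::{topological_comm_monoid_add,t2_space}"
  shows "(\<Sum>\<^sub>\<infinity>x. f (d - x)) = infsum f UNIV" and "(\<Sum>\<^sub>\<infinity>x. f (x + d)) = infsum f UNIV"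
    and "(\<lambda>x. f (d - x)) summable_on UNIV \<longleftrightarrow> f summable_on UNIV"
    and "(\<lambda>x. f (x + d)) summable_on UNIV \<longleftrightarrow> f summable_on UNIV"
proof -
  have b1: "bij_betw (\<lambda>x. d - x) UNIV UNIV"
    by (rule bij_betw_byWitness[of _ "\<lambda>x. d - x"]) auto
  have b2: "bij_betw (\<lambda>x. x + d) UNIV UNIV"
    by (rule bij_betw_byWitness[of _ "\<lambda>x. x - d"]) auto
  show "(\<Sum>\<^sub>\<infinity>x. f (d - x)) = infsum f UNIV" "(\<Sum>\<^sub>\<infinity>x. f (x + d)) = infsum f UNIV"
    "(\<lambda>x. f (d - x)) summable_on UNIV \<longleftrightarrow> f summable_on UNIV"
    "(\<lambda>x. f (x + d)) summable_on UNIV \<longleftrightarrow> f summable_on UNIV"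
    using infsum_reindex_bij_betw[OF b1, of f] infsum_reindex_bij_betw[OF b2, of f]
      summable_on_reindex_bij_betw[OF b1, of f] summable_on_reindex_bij_betw[OF b2, of f] by auto
qed

text \<open>The terms at \<open>x = 0\<close> and \<open>x = d\<close> vanish, as division by 0 gives 0.\<close>

lemma kernel_pointwise:
  fixes x d :: int
  shows "1 / (\<bar>real_of_int x\<bar> * \<bar>real_of_int (d - x)\<bar>) \<le>
     2 / sqrt (max 1 \<bar>real_of_int d\<bar>) * (\<bar>real_of_int x\<bar> powr (-3/2) + \<bar>real_of_int (d - x)\<bar> powr (-3/2))"
proof -
  \<comment> \<open>The larger factor \<open>b\<close> is at least e/2, so one square root of
    \<open>b\<close> supplies the decay in \<open>e\<close>, while the other dominates the square
    root of \<open>a\<close>.\<close>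
  have main: "1 / (a * b) \<le> 2 / sqrt (max 1 e) * (a powr (-3/2))"
    if ab: "1 \<le> a" "a \<le> b" and e: "e \<le> a + b" for a b e :: real
  proof -
    have "sqrt (max 1 e) \<le> sqrt (4 * b)" using ab e by (intro real_sqrt_le_mono) auto
    then have s: "sqrt (max 1 e) \<le> 2 * sqrt b" by (simp add: real_sqrt_mult)
    have "a powr (3/2) = a * sqrt a"
      using ab powr_add[of a 1 "1/2"] by (simp add: powr_half_sqrt)
    then have a32: "a powr (-3/2) = 1 / (a * sqrt a)"
      using powr_minus_divide[of a "3/2"] by simp
    have sa: "sqrt a \<le> sqrt b" using ab by simp
    have "a * sqrt a * sqrt (max 1 e) \<le> a * sqrt b * (2 * sqrt b)"
      using ab s sa by (intro mult_mono) auto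
    also have "\<dots> = 2 * (a * b)" using ab by simp
    finally show ?thesis
      unfolding a32 using ab by (simp add: field_simps)
  qed
  have nn: "0 \<le> 2 / sqrt (max 1 \<bar>real_of_int d\<bar>) * \<bar>real_of_int y\<bar> powr (-3/2)" for y :: int by simp
  show ?thesis
  proof (cases "x = 0 \<or> d - x = 0")
    case True
    then have "1 / (\<bar>real_of_int x\<bar> * \<bar>real_of_int (d - x)\<bar>) = 0" by auto
    also have "0 \<le> 2 / sqrt (max 1 \<bar>real_of_int d\<bar>) *
        (\<bar>real_of_int x\<bar> powr (-3/2) + \<bar>real_of_int (d - x)\<bar> powr (-3/2))"
      by (intro mult_nonneg_nonneg add_nonneg_nonneg) auto
    finally show ?thesis .
  next
    case False
    then have 1: "1 \<le> \<bar>real_of_int x\<bar>" "1 \<le> \<bar>real_of_int (d - x)\<bar>" by linarith+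
    have d: "\<bar>real_of_int d\<bar> \<le> \<bar>real_of_int x\<bar> + \<bar>real_of_int (d - x)\<bar>" by linarith
    define a b where "a = \<bar>real_of_int x\<bar>" and "b = \<bar>real_of_int (d - x)\<bar>"
    define K where "K = 2 / sqrt (max 1 \<bar>real_of_int d\<bar>)"
    have K: "0 \<le> K * a powr (-3/2)" "0 \<le> K * b powr (-3/2)"
      using nn[of x] nn[of "d - x"] by (simp_all add: K_def a_def b_def)
    have "1 / (a * b) \<le> K * a powr (-3/2) \<or> 1 / (a * b) \<le> K * b powr (-3/2)"
    proof (cases "a \<le> b")
      case True
      then show ?thesis using main[of a b "\<bar>real_of_int d\<bar>"] 1 d unfolding a_def b_def K_def by blast
    next
      case False
      then have "1 / (b * a) \<le> K * b powr (-3/2)"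
        using main[of b a "\<bar>real_of_int d\<bar>"] 1 d unfolding a_def b_def K_def by linarith
      then show ?thesis by (simp add: mult.commute[of a b])
    qed
    then have "1 / (a * b) \<le> K * (a powr (-3/2) + b powr (-3/2))"
      using K unfolding distrib_left by linarith
    then show ?thesis unfolding a_def b_def K_def .
  qed
qed

text \<open>The true order in d is log d / d; any negative power serves the later estimates, which
  only need the sum to tend to 0.\<close>

lemma kernel_sum:
  fixes d :: int
  shows "(\<lambda>x::int. 1 / (\<bar>real_of_int x\<bar> * \<bar>real_of_int (d - x)\<bar>)) summable_on UNIV"
    and "(\<Sum>\<^sub>\<infinity>x::int. 1 / (\<bar>real_of_int x\<bar> * \<bar>real_of_int (d - x)\<bar>)) \<le> 4 * zeta32 / sqrt (max 1 \<bar>real_of_int d\<bar>)"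
proof -
  let ?z = "\<lambda>x::int. \<bar>real_of_int x\<bar> powr (-3/2)"
  have s: "(\<lambda>x. ?z (d - x)) summable_on UNIV"
    using zeta32_summable infsum_int_shift(3)[of ?z d] by simp
  have S: "(\<lambda>x. 2 / sqrt (max 1 \<bar>real_of_int d\<bar>) * (?z x + ?z (d - x))) summable_on UNIV"
    by (intro summable_on_cmult_right summable_on_add zeta32_summable s)
  show S2: "(\<lambda>x::int. 1 / (\<bar>real_of_int x\<bar> * \<bar>real_of_int (d - x)\<bar>)) summable_on UNIV"
    by (rule summable_on_comparison_test[OF S]) (use kernel_pointwise in auto)
  have "(\<Sum>\<^sub>\<infinity>x::int. 1 / (\<bar>real_of_int x\<bar> * \<bar>real_of_int (d - x)\<bar>)) \<le>
      (\<Sum>\<^sub>\<infinity>x. 2 / sqrt (max 1 \<bar>real_of_int d\<bar>) * (?z x + ?z (d - x)))"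
    by (intro infsum_mono S S2 kernel_pointwise)
  also have "\<dots> = 2 / sqrt (max 1 \<bar>real_of_int d\<bar>) * (infsum ?z UNIV + (\<Sum>\<^sub>\<infinity>x. ?z (d - x)))"
    unfolding infsum_cmult_right' using infsum_add[OF zeta32_summable s] by simp
  also have "\<dots> = 2 / sqrt (max 1 \<bar>real_of_int d\<bar>) * (zeta32 + zeta32)"
    using infsum_int_shift(1)[of ?z d] by (simp add: zeta32_def)
  finally show "(\<Sum>\<^sub>\<infinity>x::int. 1 / (\<bar>real_of_int x\<bar> * \<bar>real_of_int (d - x)\<bar>)) \<le> 4 * zeta32 / sqrt (max 1 \<bar>real_of_int d\<bar>)"
    by simp
qed

section \<open>The spectral theorem for a pair of Hermitian forms\<close>

text \<open>Gaussian elimination by induction on the number of equations: a pivot in the last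
  equation eliminates one unknown from the others, and its value is restored at the end. This is the
  dimension count behind both halves of the min-max principle.\<close>

lemma homogeneous_system:
  fixes M :: "nat \<Rightarrow> 'i \<Rightarrow> complex"
  assumes "finite I" and "m < card I"
  shows "\<exists>c. (\<exists>i\<in>I. c i \<noteq> 0) \<and> (\<forall>j<m. (\<Sum>i\<in>I. c i * M j i) = 0)"
  using assms
proof (induction m arbitrary: I M)
  case 0
  then obtain i where "i \<in> I" by fastforce
  then show ?case by (intro exI[of _ "\<lambda>_. 1"]) auto
next
  case (Suc m)
  show ?case
  proof (cases "\<forall>i\<in>I. M m i = 0")
    case True
    obtain c where "\<exists>i\<in>I. c i \<noteq> 0" "\<forall>j<m. (\<Sum>i\<in>I. c i * M j i) = 0"
      using Suc.IH[of I M] Suc.prems by auto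
    then show ?thesis using True by (intro exI[of _ c]) (auto simp: less_Suc_eq)
  next
    case False
    then obtain p where p: "p \<in> I" "M m p \<noteq> 0" by blast
    define J where "J = I - {p}"
    have J: "finite J" "m < card J" "p \<notin> J" and I: "I = insert p J"
      using Suc.prems p by (auto simp: J_def)
    define M' where "M' = (\<lambda>j i. M j i - M j p * M m i / M m p)"
    obtain c where c: "\<exists>i\<in>J. c i \<noteq> 0" "\<And>j. j < m \<Longrightarrow> (\<Sum>i\<in>J. c i * M' j i) = 0"
      using Suc.IH[of J M'] J by auto
    define s where "s = (\<Sum>i\<in>J. c i * M m i)"
    define c' where "c' = c(p := - s / M m p)"
    have sJ: "(\<Sum>i\<in>J. c' i * M j i) = (\<Sum>i\<in>J. c i * M j i)" for j
      by (rule sum.cong) (use J in \<open>auto simp: c'_def\<close>)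
    have "(\<Sum>i\<in>I. c' i * M j i) = 0" if "j < Suc m" for j
    proof (cases "j = m")
      case True
      then show ?thesis using J p by (simp add: I sJ) (simp add: c'_def s_def)
    next
      case False
      then have "0 = (\<Sum>i\<in>J. c i * M' j i)" using c(2) that by auto
      also have "\<dots> = (\<Sum>i\<in>J. c i * M j i) - (M j p / M m p) * s"
        by (simp add: M'_def algebra_simps sum_subtractf s_def sum_distrib_left sum_divide_distrib)
      finally show ?thesis using J by (simp add: I sJ) (simp add: c'_def mult.commute)
    qed
    moreover have "\<exists>i\<in>I. c' i \<noteq> 0" using c(1) J by (auto simp: I c'_def)
    ultimately show ?thesis by blast
  qed
qed

text \<open>Linear in the first argument; conjugate linearity in the second follows from
  \<open>hermitian\<close>. The carrier is a set of functions because inner product, potential and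
  energy are all forms on the same space of finite-energy sequences, and combinations such as A - l
  S are interpreted locally as one more form.\<close>

locale hermitian_form =
  fixes X :: "('i \<Rightarrow> complex) set" and B :: "('i \<Rightarrow> complex) \<Rightarrow> ('i \<Rightarrow> complex) \<Rightarrow> complex"
  assumes zero_mem: "(\<lambda>_. 0) \<in> X"
    and add_mem: "f \<in> X \<Longrightarrow> g \<in> X \<Longrightarrow> (\<lambda>k. f k + g k) \<in> X"
    and scale_mem: "f \<in> X \<Longrightarrow> (\<lambda>k. c * f k) \<in> X"
    and add_left: "f \<in> X \<Longrightarrow> g \<in> X \<Longrightarrow> h \<in> X \<Longrightarrow> B (\<lambda>k. f k + g k) h = B f h + B g h"
    and scale_left: "f \<in> X \<Longrightarrow> h \<in> X \<Longrightarrow> B (\<lambda>k. c * f k) h = c * B f h"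
    and hermitian: "f \<in> X \<Longrightarrow> g \<in> X \<Longrightarrow> B g f = cnj (B f g)"
begin

lemma add_right: "f \<in> X \<Longrightarrow> g \<in> X \<Longrightarrow> h \<in> X \<Longrightarrow> B h (\<lambda>k. f k + g k) = B h f + B h g"
  using hermitian[of "\<lambda>k. f k + g k" h] hermitian[of f h] hermitian[of g h]
  by (simp add: add_left add_mem)

lemma scale_right: "f \<in> X \<Longrightarrow> h \<in> X \<Longrightarrow> B h (\<lambda>k. c * f k) = cnj c * B h f"
  using hermitian[of "\<lambda>k. c * f k" h] hermitian[of f h]
  by (simp add: scale_left scale_mem)

lemma zero_left: "h \<in> X \<Longrightarrow> B (\<lambda>_. 0) h = 0"
  using scale_left[of h h 0] by simp

lemma zero_right: "h \<in> X \<Longrightarrow> B h (\<lambda>_. 0) = 0"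
  using scale_right[of h h 0] by simp

lemma sum_mem: "finite I \<Longrightarrow> (\<And>i. i \<in> I \<Longrightarrow> v i \<in> X) \<Longrightarrow> (\<lambda>k. \<Sum>i\<in>I. c i * v i k) \<in> X"
  by (induction I rule: finite_induct) (auto simp: zero_mem intro!: add_mem scale_mem)

lemma sum_left:
  "finite I \<Longrightarrow> (\<And>i. i \<in> I \<Longrightarrow> v i \<in> X) \<Longrightarrow> h \<in> X \<Longrightarrow>
    B (\<lambda>k. \<Sum>i\<in>I. c i * v i k) h = (\<Sum>i\<in>I. c i * B (v i) h)"
proof (induction I rule: finite_induct)
  case (insert i I)
  then have "B (\<lambda>k. c i * v i k + (\<Sum>i\<in>I. c i * v i k)) h = c i * B (v i) h + (\<Sum>i\<in>I. c i * B (v i) h)"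
    by (subst add_left) (auto intro!: scale_mem sum_mem scale_left)
  then show ?case using insert by simp
qed (auto simp: zero_left)

lemma sum_right:
  "finite I \<Longrightarrow> (\<And>i. i \<in> I \<Longrightarrow> v i \<in> X) \<Longrightarrow> h \<in> X \<Longrightarrow>
    B h (\<lambda>k. \<Sum>i\<in>I. c i * v i k) = (\<Sum>i\<in>I. cnj (c i) * B h (v i))"
proof (induction I rule: finite_induct)
  case (insert i I)
  then have "B h (\<lambda>k. c i * v i k + (\<Sum>i\<in>I. c i * v i k)) = cnj (c i) * B h (v i) + (\<Sum>i\<in>I. cnj (c i) * B h (v i))"
    by (subst add_right) (auto intro!: scale_mem sum_mem scale_right)
  then show ?case using insert by simp
qed (auto simp: zero_right)

lemma diff_mem: "f \<in> X \<Longrightarrow> g \<in> X \<Longrightarrow> (\<lambda>k. f k - g k) \<in> X"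
  using add_mem[OF _ scale_mem[of g "-1"], of f] by simp

lemma diff_left: "f \<in> X \<Longrightarrow> g \<in> X \<Longrightarrow> h \<in> X \<Longrightarrow> B (\<lambda>k. f k - g k) h = B f h - B g h"
  using add_left[OF _ scale_mem[of g "-1"], of f h] scale_left[of g h "-1"] by simp

lemma real_diagonal: "f \<in> X \<Longrightarrow> B f f = of_real (Re (B f f))"
  by (metis Reals_cnj_iff hermitian of_real_Re)

lemma diagonal_add:
  assumes "f \<in> X" "g \<in> X"
  shows "Re (B (\<lambda>k. f k + g k) (\<lambda>k. f k + g k)) = Re (B f f) + 2 * Re (B f g) + Re (B g g)"
  using assms hermitian[of f g] by (simp add: add_left add_right add_mem)

lemma diagonal_scale:
  assumes "f \<in> X"
  shows "Re (B (\<lambda>k. c * f k) (\<lambda>k. c * f k)) = (cmod c)\<^sup>2 * Re (B f f)"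
proof -
  have "B (\<lambda>k. c * f k) (\<lambda>k. c * f k) = (c * cnj c) * B f f"
    using assms by (simp add: scale_left scale_right scale_mem)
  then show ?thesis by (simp flip: complex_norm_square)
qed

text \<open>If \<open>B f h\<close> were nonzero, a suitable multiple of \<open>f\<close> would make
  the linear term outweigh \<open>B h h\<close>, the quadratic term in \<open>f\<close> being
  absent. Nonnegativity is demanded only on the translates of \<open>h\<close> by multiples of
  \<open>f\<close>, because A - l S will be nonnegative only on an orthogonal complement.\<close>

lemma null_vector_orthogonal:
  assumes "f \<in> X" "h \<in> X" and null: "Re (B f f) = 0"
    and nonneg: "\<And>t. 0 \<le> Re (B (\<lambda>k. t * f k + h k) (\<lambda>k. t * f k + h k))"
  shows "B f h = 0"
proof (rule ccontr)
  assume nz: "B f h \<noteq> 0"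
  define r where "r = (Re (B h h) + 1) / (cmod (B f h))\<^sup>2"
  define t where "t = - of_real r * cnj (B f h)"
  have "Re (B (\<lambda>k. t * f k + h k) (\<lambda>k. t * f k + h k)) = 2 * Re (t * B f h) + Re (B h h)"
    using assms diagonal_scale[OF assms(1), of t]
    by (subst diagonal_add) (auto simp: scale_mem scale_left)
  moreover have "t * B f h = of_real (- r * (cmod (B f h))\<^sup>2)"
    unfolding t_def using complex_norm_square[of "B f h"] by (simp add: mult_ac)
  then have "Re (t * B f h) = - (Re (B h h) + 1)"
    using nz by (simp add: r_def)
  moreover have "0 \<le> Re (B h h)" using nonneg[of 0] by simp
  ultimately show False using nonneg[of t] by linarith
qed

lemma Cauchy_Schwarz:
  assumes "f \<in> X" "g \<in> X" and nonneg: "\<And>h. h \<in> X \<Longrightarrow> 0 \<le> Re (B h h)"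
  shows "(cmod (B f g))\<^sup>2 \<le> Re (B f f) * Re (B g g)"
proof (cases "Re (B g g) = 0")
  case True
  then have "B g f = 0"
    by (intro null_vector_orthogonal nonneg add_mem scale_mem assms)
  then show ?thesis using True assms hermitian[of g f] by simp
next
  case False
  with nonneg[OF assms(2)] have b: "Re (B g g) > 0" by linarith
  define t where "t = - B f g / of_real (Re (B g g))"
  have ct: "cnj t = - cnj (B f g) / of_real (Re (B g g))" by (simp add: t_def)
  have "0 \<le> Re (B (\<lambda>k. f k + t * g k) (\<lambda>k. f k + t * g k))"
    by (intro nonneg add_mem scale_mem assms)
  also have "\<dots> = Re (B f f) + 2 * Re (cnj t * B f g) + (cmod t)\<^sup>2 * Re (B g g)"
    using assms diagonal_scale[OF assms(2), of t]
    by (subst diagonal_add) (auto simp: scale_mem scale_right)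
  also have "cnj t * B f g = of_real (- (cmod (B f g))\<^sup>2 / Re (B g g))"
    unfolding ct using complex_norm_square[of "B f g"] by (simp add: mult_ac)
  also have "(cmod t)\<^sup>2 * Re (B g g) = (cmod (B f g))\<^sup>2 / Re (B g g)"
    using b by (simp add: t_def norm_divide power2_eq_square)
  finally show ?thesis using b by (simp add: field_simps)
qed

end

text \<open>The abstract setting of an operator with compact resolvent: \<open>A\<close> is its
  energy form, \<open>S\<close> the inner product. No completeness is assumed; limits are supplied
  by \<open>compact\<close>, which asks for strong convergence in \<open>S\<close> and, for
  \<open>A\<close>, only for convergence tested against the limit itself. That is exactly what lower
  semicontinuity of the energy requires.\<close>

locale spectral_pair = A: hermitian_form X A + S: hermitian_form X S
  for X :: "('i \<Rightarrow> complex) set" and A S +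
  assumes A_nonneg: "f \<in> X \<Longrightarrow> 0 \<le> Re (A f f)"
    and S_nonneg: "f \<in> X \<Longrightarrow> 0 \<le> Re (S f f)"
    and S_definite: "f \<in> X \<Longrightarrow> S f f = 0 \<Longrightarrow> f = (\<lambda>_. 0)"
    and compact: "\<And>f M. (\<And>i::nat. f i \<in> X) \<Longrightarrow> (\<And>i. Re (A (f i) (f i)) \<le> M) \<Longrightarrow>
      \<exists>g\<in>X. \<exists>r. strict_mono r \<and>
        (\<lambda>i. Re (S (\<lambda>k. f (r i) k - g k) (\<lambda>k. f (r i) k - g k))) \<longlonglongrightarrow> 0 \<and>
        (\<lambda>i. Re (A g (\<lambda>k. f (r i) k - g k))) \<longlonglongrightarrow> 0"
    and infinite_dim: "\<And>m::nat. \<exists>I (b :: nat \<Rightarrow> 'i \<Rightarrow> complex). finite I \<and> card I > m \<and> (\<forall>i\<in>I. b i \<in> X) \<and>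
        (\<forall>c. (\<forall>k. (\<Sum>i\<in>I. c i * b i k) = 0) \<longrightarrow> (\<forall>i\<in>I. c i = (0::complex)))"
begin

lemma S_pos: "f \<in> X \<Longrightarrow> f \<noteq> (\<lambda>_. 0) \<Longrightarrow> 0 < Re (S f f)"
  using S_nonneg[of f] S_definite[of f] S.real_diagonal[of f] by (cases "Re (S f f) = 0") auto

lemma S_tendsto:
  assumes u: "\<And>i. u i \<in> X" and g: "g \<in> X" and lim: "(\<lambda>i. Re (S (u i) (u i))) \<longlonglongrightarrow> 0"
  shows "(\<lambda>i::nat. S (u i) g) \<longlonglongrightarrow> 0"
proof (rule tendsto_norm_zero_cancel)
  have "(\<lambda>i. sqrt (Re (S (u i) (u i)) * Re (S g g))) \<longlonglongrightarrow> sqrt (0 * Re (S g g))"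
    by (intro tendsto_intros lim)
  then have l: "(\<lambda>i. sqrt (Re (S (u i) (u i)) * Re (S g g))) \<longlonglongrightarrow> 0" by simp
  show "(\<lambda>i. cmod (S (u i) g)) \<longlonglongrightarrow> 0"
  proof (rule tendsto_sandwich[OF _ _ tendsto_const l])
    show "\<forall>\<^sub>F i in sequentially. cmod (S (u i) g) \<le> sqrt (Re (S (u i) (u i)) * Re (S g g))"
      using S.Cauchy_Schwarz[OF u g S_nonneg] by (intro always_eventually allI real_le_rsqrt) auto
  qed auto
qed

text \<open>The dimension count in the form needed twice: the constraint set of a minimisation is
  not trivial, and a trial space meets the complement of the lower eigenvectors.\<close>

lemma combination_zero:
  assumes "finite I" "m < card I" "\<And>i. i \<in> I \<Longrightarrow> b i \<in> X" "\<And>j. j < m \<Longrightarrow> e j \<in> X"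
    and indep: "\<forall>c. (\<forall>k. (\<Sum>i\<in>I. c i * b i k) = 0) \<longrightarrow> (\<forall>i\<in>I. c i = (0::complex))"
  obtains c where "(\<lambda>k. \<Sum>i\<in>I. c i * b i k) \<in> X" "(\<lambda>k. \<Sum>i\<in>I. c i * b i k) \<noteq> (\<lambda>_. 0)"
    "\<And>j. j < m \<Longrightarrow> S (\<lambda>k. \<Sum>i\<in>I. c i * b i k) (e j) = 0"
proof -
  obtain c where c: "\<exists>i\<in>I. c i \<noteq> 0" "\<forall>j<m. (\<Sum>i\<in>I. c i * S (b i) (e j)) = 0"
    using homogeneous_system[OF assms(1,2), of "\<lambda>j i. S (b i) (e j)"] by blast
  show ?thesis
  proof (rule that[of c])
    show "(\<lambda>k. \<Sum>i\<in>I. c i * b i k) \<in> X" by (intro S.sum_mem assms)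
    show "(\<lambda>k. \<Sum>i\<in>I. c i * b i k) \<noteq> (\<lambda>_. 0)"
    proof
      assume "(\<lambda>k. \<Sum>i\<in>I. c i * b i k) = (\<lambda>_. 0)"
      then have "\<forall>k. (\<Sum>i\<in>I. c i * b i k) = 0" by (simp add: fun_eq_iff)
      then show False using spec[OF indep, of c] c(1) by auto
    qed
    show "S (\<lambda>k. \<Sum>i\<in>I. c i * b i k) (e j) = 0" if "j < m" for j
      using c that assms by (simp add: S.sum_left)
  qed
qed

text \<open>Direct method for the Rayleigh quotient under linear constraints. Strong convergence in
  \<open>S\<close> keeps the normalisation and the constraints in the limit; the energy of the limit
  is at most the infimum by lower semicontinuity.\<close>

lemma minimizer_exists:
  fixes e :: "nat \<Rightarrow> 'i \<Rightarrow> complex"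
  assumes e: "\<And>i. i < m \<Longrightarrow> e i \<in> X"
  shows "\<exists>g\<in>X. S g g = 1 \<and> (\<forall>i<m. S g (e i) = 0) \<and>
    (\<forall>h\<in>X. (\<forall>i<m. S h (e i) = 0) \<longrightarrow> Re (A g g) * Re (S h h) \<le> Re (A h h))"
proof -
  define Y where "Y = {f\<in>X. \<forall>i<m. S f (e i) = 0}"
  define R where "R = (\<lambda>f. Re (A f f)) ` {f\<in>Y. Re (S f f) = 1}"
  have normalize: "(\<lambda>k. of_real (1 / sqrt (Re (S f f))) * f k) \<in> {f\<in>Y. Re (S f f) = 1} \<and>
     Re (A (\<lambda>k. of_real (1 / sqrt (Re (S f f))) * f k) (\<lambda>k. of_real (1 / sqrt (Re (S f f))) * f k))
       = Re (A f f) / Re (S f f)"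
    if "f \<in> Y" "f \<noteq> (\<lambda>_. 0)" for f
  proof -
    have f: "f \<in> X" and p: "0 < Re (S f f)" using that S_pos by (auto simp: Y_def)
    have n: "(cmod (of_real (1 / sqrt (Re (S f f)))))\<^sup>2 = 1 / Re (S f f)"
      using p by (simp add: norm_divide power_divide)
    show ?thesis
      using that f p S.diagonal_scale[OF f, of "of_real (1 / sqrt (Re (S f f)))"]
        A.diagonal_scale[OF f, of "of_real (1 / sqrt (Re (S f f)))"] n
      by (auto simp: Y_def S.scale_left S.scale_mem e simp del: of_real_divide norm_of_real)
  qed
  obtain I and b :: "nat \<Rightarrow> 'i \<Rightarrow> complex" where Ib: "finite I" "m < card I" "\<forall>i\<in>I. b i \<in> X"
    "\<forall>c. (\<forall>k. (\<Sum>i\<in>I. c i * b i k) = 0) \<longrightarrow> (\<forall>i\<in>I. c i = (0::complex))"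
    using infinite_dim[of m] by (elim exE conjE)
  obtain f0 where f0: "f0 \<in> Y" "f0 \<noteq> (\<lambda>_. 0)"
    by (rule combination_zero[of I m b e, OF Ib(1,2) bspec[OF Ib(3)] e Ib(4)]) (auto simp: Y_def)
  have ne: "R \<noteq> {}" using normalize[OF f0] by (auto simp: R_def)
  have bdd: "bdd_below R" using A_nonneg by (auto simp: R_def Y_def intro!: bdd_belowI2[of _ 0])
  have "\<exists>f. f \<in> Y \<and> Re (S f f) = 1 \<and> Re (A f f) < Inf R + 1 / Suc i" for i
    using cInf_lessD[OF ne, of "Inf R + 1 / Suc i"] by (auto simp: R_def)
  then obtain f where f: "\<And>i. f i \<in> Y" "\<And>i. Re (S (f i) (f i)) = 1"
    "\<And>i. Re (A (f i) (f i)) < Inf R + 1 / Suc i"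
    by metis
  have fX: "f i \<in> X" for i using f(1) by (auto simp: Y_def)
  have "Re (A (f i) (f i)) \<le> Inf R + 1" for i
  proof -
    have "1 / real (Suc i) \<le> 1" by simp
    then show ?thesis using f(3)[of i] by linarith
  qed
  then obtain g r where g: "g \<in> X" and r: "strict_mono r"
    and limS: "(\<lambda>i. Re (S (\<lambda>k. f (r i) k - g k) (\<lambda>k. f (r i) k - g k))) \<longlonglongrightarrow> 0"
    and limA: "(\<lambda>i. Re (A g (\<lambda>k. f (r i) k - g k))) \<longlonglongrightarrow> 0"
    using compact[of f "Inf R + 1", OF fX] by blast
  define u where "u = (\<lambda>i k. f (r i) k - g k)"
  have u: "u i \<in> X" for i unfolding u_def by (intro S.diff_mem fX g)
  have lim0: "(\<lambda>i. S (u i) h) \<longlonglongrightarrow> 0" if "h \<in> X" for h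
    by (rule S_tendsto[OF u that]) (use limS in \<open>simp add: u_def\<close>)
  have fu: "f (r i) = (\<lambda>k. g k + u i k)" for i by (simp add: u_def)
  have ge: "S g (e j) = 0" if j: "j < m" for j
  proof -
    have "S (u i) (e j) = - S g (e j)" for i
      using f(1)[of "r i"] fX g e[OF j] j by (simp add: u_def S.diff_left Y_def)
    with lim0[OF e[OF j]] have "(\<lambda>i::nat. - S g (e j)) \<longlonglongrightarrow> 0" by simp
    then show ?thesis by (simp add: LIMSEQ_const_iff)
  qed
  have Sg: "Re (S g g) = 1"
  proof -
    have "1 = Re (S g g) + 2 * Re (S (u i) g) + Re (S (u i) (u i))" for i
      using S.diagonal_add[OF g u, of i] f(2)[of "r i"] S.hermitian[OF u g, of i] by (simp add: fu)
    moreover have "(\<lambda>i. Re (S g g) + 2 * Re (S (u i) g) + Re (S (u i) (u i))) \<longlonglongrightarrow> Re (S g g) + 2 * Re 0 + 0"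
      by (intro tendsto_intros lim0 g) (use limS in \<open>simp add: u_def\<close>)
    ultimately have "(\<lambda>i::nat. 1) \<longlonglongrightarrow> Re (S g g) + 2 * Re 0 + 0" by simp
    then show ?thesis by (simp add: LIMSEQ_const_iff)
  qed
  \<comment> \<open>Energy of g + u expands to \<open>A g g\<close>, a cross term that tends to 0,
    and the nonnegative \<open>A (u i) (u i)\<close>, which is dropped.\<close>
  have Ag: "Re (A g g) \<le> Inf R"
  proof (rule LIMSEQ_le)
    show "(\<lambda>i. Re (A g g) + 2 * Re (A g (u i))) \<longlonglongrightarrow> Re (A g g)"
      using tendsto_add[OF tendsto_const tendsto_mult[OF tendsto_const limA], of "Re (A g g)" 2]
      by (simp add: u_def)
    have "(\<lambda>i. Inf R + 1 / real (Suc i)) \<longlonglongrightarrow> Inf R + 0"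
      by (intro tendsto_add tendsto_const LIMSEQ_Suc lim_inverse_n' )
    then show "(\<lambda>i. Inf R + 1 / real (Suc (r i))) \<longlonglongrightarrow> Inf R"
      using LIMSEQ_subseq_LIMSEQ[OF _ r, of "\<lambda>i. Inf R + 1 / real (Suc i)"] by (simp add: o_def)
    have "Re (A g g) + 2 * Re (A g (u i)) \<le> Inf R + 1 / real (Suc (r i))" for i
      using A.diagonal_add[OF g u, of i] f(3)[of "r i"] A_nonneg[OF u, of i] by (simp add: fu)
    then show "\<exists>N. \<forall>n\<ge>N. Re (A g g) + 2 * Re (A g (u n)) \<le> Inf R + 1 / real (Suc (r n))" by blast
  qed
  have "Re (A g g) * Re (S h h) \<le> Re (A h h)" if h: "h \<in> X" "\<forall>i<m. S h (e i) = 0" for h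
  proof (cases "h = (\<lambda>_. 0)")
    case True
    then show ?thesis using A_nonneg[OF h(1)] S.zero_left[OF S.zero_mem] by simp
  next
    case False
    have hY: "h \<in> Y" using h by (simp add: Y_def)
    have "Inf R \<le> Re (A h h) / Re (S h h)"
      by (rule cInf_lower[OF _ bdd]) (use normalize[OF hY False] in \<open>auto simp: R_def intro!: image_eqI[rotated]\<close>)
    with Ag have "Re (A g g) \<le> Re (A h h) / Re (S h h)" by linarith
    then show ?thesis using S_pos[OF h(1) False] by (simp add: field_simps)
  qed
  moreover have "S g g = 1" using Sg S.real_diagonal[OF g] by simp
  ultimately show ?thesis using g ge by blast
qed

text \<open>Each vector minimises the Rayleigh quotient on the complement of its predecessors. The
  eigenvalue equation is derived from this, while the minimality itself is what the min-max
  estimates use.\<close>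

definition is_eigensystem :: "(nat \<Rightarrow> 'i \<Rightarrow> complex) \<Rightarrow> bool" where
  "is_eigensystem e \<longleftrightarrow> (\<forall>m. e m \<in> X \<and> S (e m) (e m) = 1 \<and> (\<forall>i<m. S (e m) (e i) = 0) \<and>
    (\<forall>h\<in>X. (\<forall>i<m. S h (e i) = 0) \<longrightarrow> Re (A (e m) (e m)) * Re (S h h) \<le> Re (A h h)))"

lemma eigensystem_exists: "\<exists>e. is_eigensystem e"
  unfolding is_eigensystem_def
proof (rule dependent_wf_choice[OF wf_less_than])
  fix f g :: "nat \<Rightarrow> 'i \<Rightarrow> complex" and x r
  assume "\<And>z. (z, x) \<in> less_than \<Longrightarrow> f z = g z"
  then have fg: "\<And>z. z < x \<Longrightarrow> f z = g z" by simp
  show "(r \<in> X \<and> S r r = 1 \<and> (\<forall>i<x. S r (f i) = 0) \<and>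
     (\<forall>h\<in>X. (\<forall>i<x. S h (f i) = 0) \<longrightarrow> Re (A r r) * Re (S h h) \<le> Re (A h h))) =
    (r \<in> X \<and> S r r = 1 \<and> (\<forall>i<x. S r (g i) = 0) \<and>
     (\<forall>h\<in>X. (\<forall>i<x. S h (g i) = 0) \<longrightarrow> Re (A r r) * Re (S h h) \<le> Re (A h h)))"
    using fg by simp
next
  fix x and f :: "nat \<Rightarrow> 'i \<Rightarrow> complex"
  assume "\<And>y. (y, x) \<in> less_than \<Longrightarrow> f y \<in> X \<and> S (f y) (f y) = 1 \<and> (\<forall>i<y. S (f y) (f i) = 0) \<and>
    (\<forall>h\<in>X. (\<forall>i<y. S h (f i) = 0) \<longrightarrow> Re (A (f y) (f y)) * Re (S h h) \<le> Re (A h h))"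
  then have "\<And>y. y < x \<Longrightarrow> f y \<in> X" by simp
  from minimizer_exists[OF this] show "\<exists>r. r \<in> X \<and> S r r = 1 \<and> (\<forall>i<x. S r (f i) = 0) \<and>
     (\<forall>h\<in>X. (\<forall>i<x. S h (f i) = 0) \<longrightarrow> Re (A r r) * Re (S h h) \<le> Re (A h h))"
    unfolding Bex_def .
qed

end

section \<open>Eigenvalue equation, completeness and min-max principle for an eigensystem\<close>

context spectral_pair
begin

context
  fixes e :: "nat \<Rightarrow> 'i \<Rightarrow> complex" and l :: "nat \<Rightarrow> real"
  assumes e: "is_eigensystem e" and l_def: "l = (\<lambda>m. Re (A (e m) (e m)))"
begin

lemma e_mem: "e m \<in> X"
  and e_unit: "S (e m) (e m) = 1"
  and e_less: "i < m \<Longrightarrow> S (e m) (e i) = 0"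
  and e_min: "h \<in> X \<Longrightarrow> (\<And>i. i < m \<Longrightarrow> S h (e i) = 0) \<Longrightarrow> l m * Re (S h h) \<le> Re (A h h)"
  using e by (auto simp: is_eigensystem_def l_def)

lemma e_orthonormal: "S (e i) (e j) = (if i = j then 1 else 0)"
proof -
  consider "i < j" | "j < i" | "i = j" by linarith
  then show ?thesis
    using e_less[of i j] e_less[of j i] e_unit S.hermitian[OF e_mem e_mem, of i j]
    by cases auto
qed

lemma l_mono: "mono l"
proof (rule monoI)
  fix i j :: nat assume ij: "i \<le> j"
  have "l i * Re (S (e j) (e j)) \<le> Re (A (e j) (e j))"
    using ij by (intro e_min e_mem e_less) auto
  then show "l i \<le> l j" using e_unit[of j] by (simp add: l_def)
qed

lemma projection_orthogonal:
  assumes "h \<in> X" "finite J" "j \<in> J"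
  shows "S (\<lambda>k. h k - (\<Sum>i\<in>J. S h (e i) * e i k)) (e j) = 0"
proof -
  have "S (\<lambda>k. h k - (\<Sum>i\<in>J. S h (e i) * e i k)) (e j) = S h (e j) - (\<Sum>i\<in>J. S h (e i) * S (e i) (e j))"
    using assms by (simp add: S.diff_left S.sum_mem e_mem S.sum_left)
  also have "(\<Sum>i\<in>J. S h (e i) * S (e i) (e j)) = (\<Sum>i\<in>J. if i = j then S h (e i) else 0)"
    by (intro sum.cong) (auto simp: e_orthonormal)
  also have "\<dots> = S h (e j)" using assms by simp
  finally show ?thesis by simp
qed

text \<open>On the complement of the first m eigenvectors the form A - l_m S is nonnegative by
  minimality, and \<open>e m\<close> is a null vector of it; a null vector is orthogonal to
  everything there.\<close>

lemma eigen_complement: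
  assumes h: "h \<in> X" and orth: "\<And>i. i < m \<Longrightarrow> S h (e i) = 0"
  shows "A (e m) h = of_real (l m) * S (e m) h"
proof -
  interpret B: hermitian_form X "\<lambda>f g. A f g - of_real (l m) * S f g"
  proof
    show "(\<lambda>_. 0) \<in> X" by (rule S.zero_mem)
  next
    fix f g h assume "f \<in> X" "g \<in> X" "h \<in> X"
    then show "A (\<lambda>k. f k + g k) h - of_real (l m) * S (\<lambda>k. f k + g k) h =
        A f h - of_real (l m) * S f h + (A g h - of_real (l m) * S g h)"
      by (simp add: A.add_left S.add_left algebra_simps)
  next
    fix f h c assume "f \<in> X" "h \<in> X"
    then show "A (\<lambda>k. c * f k) h - of_real (l m) * S (\<lambda>k. c * f k) h = c * (A f h - of_real (l m) * S f h)"
      by (simp add: A.scale_left S.scale_left algebra_simps)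
  next
    fix f g assume "f \<in> X" "g \<in> X"
    then show "A g f - of_real (l m) * S g f = cnj (A f g - of_real (l m) * S f g)"
      using A.hermitian[of f g] S.hermitian[of f g] by (simp only: complex_cnj_diff complex_cnj_mult complex_cnj_complex_of_real)
  qed (auto intro: S.add_mem S.scale_mem)
  have "A (e m) h - of_real (l m) * S (e m) h = 0"
  proof (rule B.null_vector_orthogonal[OF e_mem h])
    show "Re (A (e m) (e m) - of_real (l m) * S (e m) (e m)) = 0"
      by (simp add: e_unit l_def)
    fix t
    have X: "(\<lambda>k. t * e m k + h k) \<in> X" by (intro S.add_mem S.scale_mem e_mem h)
    have "l m * Re (S (\<lambda>k. t * e m k + h k) (\<lambda>k. t * e m k + h k))
        \<le> Re (A (\<lambda>k. t * e m k + h k) (\<lambda>k. t * e m k + h k))"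
      by (rule e_min[OF X])
        (use orth e_less in \<open>simp add: S.add_left S.scale_mem e_mem h S.scale_left\<close>)
    then show "0 \<le> Re (A (\<lambda>k. t * e m k + h k) (\<lambda>k. t * e m k + h k)
        - of_real (l m) * S (\<lambda>k. t * e m k + h k) (\<lambda>k. t * e m k + h k))"
      by simp
  qed
  then show ?thesis by simp
qed

text \<open>Splits \<open>h\<close> into its projection to the earlier eigenvectors and a remainder.
  On the projection both sides vanish: by induction \<open>A (e i) (e m)\<close> is a multiple of
  \<open>S (e i) (e m)\<close>, which is 0.\<close>

lemma eigen:
  assumes h: "h \<in> X"
  shows "A (e m) h = of_real (l m) * S (e m) h"
  using h
proof (induction m arbitrary: h rule: less_induct)
  case (less m)
  define p where "p = (\<lambda>k. \<Sum>i<m. S h (e i) * e i k)"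
  define h' where "h' = (\<lambda>k. h k - p k)"
  have p: "p \<in> X" unfolding p_def by (intro S.sum_mem e_mem) auto
  have h': "h' \<in> X" unfolding h'_def by (intro S.diff_mem p less.prems)
  have orth: "S h' (e i) = 0" if "i < m" for i
    unfolding h'_def p_def using that less.prems by (intro projection_orthogonal) auto
  have h: "h = (\<lambda>k. p k + h' k)" by (simp add: h'_def)
  have "A (e m) (e i) = 0" "S (e m) (e i) = 0" if "i < m" for i
    using less.IH[OF that e_mem[of m]] A.hermitian[OF e_mem e_mem, of i m]
      e_less[OF that] S.hermitian[OF e_mem e_mem, of m i]
    by auto
  then have "A (e m) p = 0" "S (e m) p = 0"
    unfolding p_def by (auto simp: A.sum_right S.sum_right e_mem)
  then show ?case
    using eigen_complement[OF h' orth] p h' e_mem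
    by (subst (1 2) h) (simp add: A.add_right S.add_right)
qed

text \<open>Bounded energies would give an S-convergent subsequence of an orthonormal sequence. Its
  limit is orthogonal to every \<open>e m\<close>, hence to itself, hence 0, while the distance of
  the terms to 0 is 1.\<close>

lemma l_unbounded: "\<exists>m. M < l m"
proof (rule ccontr)
  assume "\<not> (\<exists>m. M < l m)"
  then have "\<And>m. Re (A (e m) (e m)) \<le> M" by (auto simp: l_def not_less)
  from compact[of e M, OF e_mem this] obtain g r where g: "g \<in> X" and r: "strict_mono r"
    and lim: "(\<lambda>i. Re (S (\<lambda>k. e (r i) k - g k) (\<lambda>k. e (r i) k - g k))) \<longlonglongrightarrow> 0" by blast
  define u where "u = (\<lambda>i k. e (r i) k - g k)"
  have u: "u i \<in> X" for i unfolding u_def by (intro S.diff_mem e_mem g)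
  have lim0: "(\<lambda>i. S (u i) h) \<longlonglongrightarrow> 0" if "h \<in> X" for h
    by (rule S_tendsto[OF u that]) (use lim in \<open>simp add: u_def\<close>)
  have zero: "S (e m) g = 0" for m
  proof -
    have "\<forall>\<^sub>F i in sequentially. S (u i) (e m) = - S g (e m)"
    proof (rule eventually_sequentiallyI[of "Suc m"])
      fix i assume "Suc m \<le> i"
      then have "m < r i" using seq_suble[OF r, of i] by linarith
      then show "S (u i) (e m) = - S g (e m)"
        by (simp add: u_def S.diff_left e_mem g e_less)
    qed
    from tendsto_cong[OF this] lim0[OF e_mem[of m]] have "(\<lambda>i::nat. - S g (e m)) \<longlonglongrightarrow> 0" by simp
    then have "S g (e m) = 0" by (simp add: LIMSEQ_const_iff)
    then show ?thesis using S.hermitian[OF g e_mem, of m] by simp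
  qed
  have "(\<lambda>i. S (u i) g) \<longlonglongrightarrow> 0" by (rule lim0[OF g])
  moreover have "S (u i) g = - S g g" for i
    by (simp add: u_def S.diff_left e_mem g zero)
  ultimately have "(\<lambda>i::nat. - S g g) \<longlonglongrightarrow> 0" by simp
  then have gg: "S g g = 0" by (simp add: LIMSEQ_const_iff)
  then have "g = (\<lambda>_. 0)" by (rule S_definite[OF g])
  then have "S (\<lambda>k. e (r i) k - g k) (\<lambda>k. e (r i) k - g k) = 1" for i by (simp add: e_unit)
  with lim have "(\<lambda>i::nat. 1::real) \<longlonglongrightarrow> 0" by simp
  then show False by (simp add: LIMSEQ_const_iff)
qed

lemma finite_l_le: "finite {m. l m \<le> M}"
proof -
  obtain m where m: "M < l m" using l_unbounded by blast
  have "{m. l m \<le> M} \<subseteq> {..m}"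
  proof
    fix i assume "i \<in> {m. l m \<le> M}"
    then show "i \<in> {..m}" using monoD[OF l_mono, of m i] m by (cases "i \<le> m") auto
  qed
  then show ?thesis by (rule finite_subset) simp
qed

lemma finite_l_eq: "finite {m. complex_of_real (l m) = \<mu>}"
  by (rule finite_subset[OF _ finite_l_le[of "Re \<mu>"]]) auto

text \<open>Components along eigenvectors of other eigenvalues vanish by symmetry. What remains
  after subtracting the finitely many others is orthogonal to the whole system, so its Rayleigh
  quotient would exceed every \<open>l m\<close>, which is impossible for a nonzero vector as
  \<open>l\<close> is unbounded.\<close>

lemma eigenvector_expansion:
  assumes f: "f \<in> X" and eig: "\<And>h. h \<in> X \<Longrightarrow> A f h = \<mu> * S f h"
  shows "f = (\<lambda>k. \<Sum>m\<in>{m. complex_of_real (l m) = \<mu>}. S f (e m) * e m k)"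
proof -
  let ?J = "{m. complex_of_real (l m) = \<mu>}"
  have zero: "S f (e m) = 0" if "complex_of_real (l m) \<noteq> \<mu>" for m
  proof -
    have "\<mu> * S f (e m) = A f (e m)" using eig e_mem by simp
    also have "\<dots> = cnj (of_real (l m) * S (e m) f)" using A.hermitian[OF e_mem f] eigen[OF f] by simp
    also have "\<dots> = of_real (l m) * S f (e m)" using S.hermitian[OF e_mem f] by simp
    finally show ?thesis using that by auto
  qed
  define f' where "f' = (\<lambda>k. f k - (\<Sum>m\<in>?J. S f (e m) * e m k))"
  have f': "f' \<in> X" unfolding f'_def by (intro S.diff_mem S.sum_mem f e_mem finite_l_eq)
  have orth: "S f' (e m) = 0" for m
  proof (cases "m \<in> ?J")
    case True
    then show ?thesis unfolding f'_def by (intro projection_orthogonal f finite_l_eq)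
  next
    case False
    then have "\<And>i. i \<in> ?J \<Longrightarrow> S (e i) (e m) = 0" by (auto simp: e_orthonormal)
    then have "(\<Sum>i\<in>?J. S f (e i) * S (e i) (e m)) = 0" by (intro sum.neutral) auto
    with False show ?thesis
      unfolding f'_def by (simp add: S.diff_left S.sum_mem S.sum_left f e_mem finite_l_eq zero)
  qed
  have "f' = (\<lambda>_. 0)"
  proof (rule ccontr)
    assume nz: "f' \<noteq> (\<lambda>_. 0)"
    obtain m where m: "Re (A f' f') / Re (S f' f') < l m" using l_unbounded by blast
    have "l m * Re (S f' f') \<le> Re (A f' f')" by (intro e_min f' orth)
    then show False using m S_pos[OF f' nz] by (simp add: field_simps)
  qed
  then show ?thesis unfolding f'_def by (simp add: fun_eq_iff)
qed

text \<open>Upper half of min-max: a trial space of dimension greater than m contains a nonzero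
  vector orthogonal to the first m eigenvectors, whose Rayleigh quotient is at least
  \<open>l m\<close>.\<close>

lemma eigenvalue_le:
  assumes "finite I" "m < card I" "\<And>i. i \<in> I \<Longrightarrow> b i \<in> X"
    and indep: "\<forall>c. (\<forall>k. (\<Sum>i\<in>I. c i * b i k) = 0) \<longrightarrow> (\<forall>i\<in>I. c i = (0::complex))"
    and le: "\<And>c. Re (A (\<lambda>k. \<Sum>i\<in>I. c i * b i k) (\<lambda>k. \<Sum>i\<in>I. c i * b i k)) \<le>
      \<mu> * Re (S (\<lambda>k. \<Sum>i\<in>I. c i * b i k) (\<lambda>k. \<Sum>i\<in>I. c i * b i k))"
  shows "l m \<le> \<mu>"
proof -
  obtain c where c: "(\<lambda>k. \<Sum>i\<in>I. c i * b i k) \<in> X" "(\<lambda>k. \<Sum>i\<in>I. c i * b i k) \<noteq> (\<lambda>_. 0)"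
    "\<And>j. j < m \<Longrightarrow> S (\<lambda>k. \<Sum>i\<in>I. c i * b i k) (e j) = 0"
    using combination_zero[where e = e, OF assms(1-3) e_mem indep] by blast
  let ?f = "\<lambda>k. \<Sum>i\<in>I. c i * b i k"
  have "l m * Re (S ?f ?f) \<le> \<mu> * Re (S ?f ?f)"
    using e_min[OF c(1), of m] c(3) le[of c] by (meson order_trans)
  then show ?thesis using S_pos[OF c(1,2)] by simp
qed

text \<open>Lower half of min-max: m linear conditions have a nonzero common zero in the span of the
  first m + 1 eigenvectors, where the Rayleigh quotient is at most \<open>l m\<close>. The
  conditions need to be linear on that span only, so they may be coordinate evaluations of a
  sequence.\<close>

lemma eigenvalue_ge:
  fixes M :: "nat \<Rightarrow> ('i \<Rightarrow> complex) \<Rightarrow> complex"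
  assumes M: "\<And>j c. j < m \<Longrightarrow> M j (\<lambda>k. \<Sum>i\<le>m. c i * e i k) = (\<Sum>i\<le>m. c i * M j (e i))"
    and ge: "\<And>f. f \<in> X \<Longrightarrow> (\<And>j. j < m \<Longrightarrow> M j f = 0) \<Longrightarrow> \<mu> * Re (S f f) \<le> Re (A f f)"
  shows "\<mu> \<le> l m"
proof -
  obtain c where c: "\<exists>i\<in>{..m}. c i \<noteq> 0" "\<forall>j<m. (\<Sum>i\<in>{..m}. c i * M j (e i)) = 0"
    using homogeneous_system[of "{..m}" m "\<lambda>j i. M j (e i)"] by auto
  define f where "f = (\<lambda>k. \<Sum>i\<le>m. c i * e i k)"
  have f: "f \<in> X" unfolding f_def by (intro S.sum_mem e_mem) auto
  have Sfe: "S f (e j) = c j" if "j \<le> m" for j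
  proof -
    have "S f (e j) = (\<Sum>i\<le>m. c i * S (e i) (e j))"
      unfolding f_def by (intro S.sum_left e_mem) auto
    also have "\<dots> = (\<Sum>i\<le>m. if i = j then c i else 0)" by (intro sum.cong) (auto simp: e_orthonormal)
    finally show ?thesis using that by simp
  qed
  have "S f f = (\<Sum>i\<le>m. c i * S (e i) f)" "A f f = (\<Sum>i\<le>m. c i * A (e i) f)"
    using f unfolding f_def by (auto intro!: S.sum_left A.sum_left e_mem)
  then have Sff: "S f f = (\<Sum>i\<le>m. of_real ((cmod (c i))\<^sup>2))" and Aff: "A f f = (\<Sum>i\<le>m. of_real (l i * (cmod (c i))\<^sup>2))"
    using S.hermitian[OF f e_mem] Sfe
    by (auto simp: eigen[OF f] complex_norm_square mult_ac intro!: sum.cong simp del: of_real_power)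
  have "Re (A f f) \<le> l m * Re (S f f)"
    unfolding Sff Aff Re_sum sum_distrib_left
    by (intro sum_mono) (auto intro!: mult_right_mono monoD[OF l_mono])
  moreover have "\<mu> * Re (S f f) \<le> Re (A f f)"
    using c(2) by (intro ge f) (simp add: f_def M)
  moreover have "0 < Re (S f f)"
  proof -
    obtain i where i: "i \<le> m" "c i \<noteq> 0" using c(1) by auto
    have "(cmod (c i))\<^sup>2 \<le> Re (S f f)"
      unfolding Sff Re_sum Re_complex_of_real using i by (intro member_le_sum) auto
    moreover have "0 < (cmod (c i))\<^sup>2" using i by simp
    ultimately show ?thesis by linarith
  qed
  ultimately show ?thesis by (meson mult_le_cancel_right_pos order_trans)
qed

end
end

section \<open>The quadratic form of a potential\<close>

lemma nonneg_double_sum: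
  fixes h :: "'a \<Rightarrow> 'b \<Rightarrow> real"
  assumes "\<And>j k. 0 \<le> h j k" and "\<And>j. (\<lambda>k. h j k) summable_on UNIV"
    and "\<And>j. (\<Sum>\<^sub>\<infinity>k. h j k) \<le> b j" and "b summable_on UNIV"
  shows "(\<lambda>(j, k). h j k) summable_on UNIV" and "(\<Sum>\<^sub>\<infinity>(j, k). h j k) \<le> infsum b UNIV"
proof -
  have s: "(\<lambda>j. \<Sum>\<^sub>\<infinity>k. h j k) summable_on UNIV"
    by (rule summable_on_comparison_test[OF assms(4)]) (auto simp: assms intro!: infsum_nonneg)
  show S: "(\<lambda>(j, k). h j k) summable_on UNIV"
    using summable_on_SigmaI[OF _ s, where B = "\<lambda>_. UNIV" and f = "\<lambda>(j, k). h j k"] assms(1,2) by simp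
  have "(\<Sum>\<^sub>\<infinity>(j, k). h j k) = (\<Sum>\<^sub>\<infinity>j. \<Sum>\<^sub>\<infinity>k. h j k)"
    using infsum_Sigma_banach[of "\<lambda>(j, k). h j k" UNIV "\<lambda>_. UNIV"] S by simp
  also have "\<dots> \<le> infsum b UNIV" by (intro infsum_mono s assms)
  finally show "(\<Sum>\<^sub>\<infinity>(j, k). h j k) \<le> infsum b UNIV" .
qed

text \<open>Passes from matrix entries to (difference of indices, row), so that a factor
  \<open>Q (k - m)\<close> depends on the first index alone and can be taken out of the inner
  sum.\<close>

lemma reparametrize_pairs:
  fixes h :: "int \<Rightarrow> int \<Rightarrow> 'a::{topological_comm_monoid_add,t2_space}"
  shows "(\<lambda>(k, m). h (k - m) k) summable_on UNIV \<longleftrightarrow> (\<lambda>(j, k). h j k) summable_on UNIV"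
    and "(\<Sum>\<^sub>\<infinity>(k, m). h (k - m) k) = (\<Sum>\<^sub>\<infinity>(j, k). h j k)"
proof -
  have b: "bij_betw (\<lambda>(k, m). (k - m, k)) UNIV (UNIV :: (int \<times> int) set)"
    by (rule bij_betw_byWitness[of _ "\<lambda>(j, k). (k, k - j)"]) auto
  have [simp]: "(\<lambda>x. (\<lambda>(j, k). h j k) ((\<lambda>(k, m). (k - m, k)) x)) = (\<lambda>(k, m). h (k - m) k)"
    by auto
  show "(\<lambda>(k, m). h (k - m) k) summable_on UNIV \<longleftrightarrow> (\<lambda>(j, k). h j k) summable_on UNIV"
    using summable_on_reindex_bij_betw[OF b, of "\<lambda>(j, k). h j k"] by simp
  show "(\<Sum>\<^sub>\<infinity>(k, m). h (k - m) k) = (\<Sum>\<^sub>\<infinity>(j, k). h j k)"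
    using infsum_reindex_bij_betw[OF b, of "\<lambda>(j, k). h j k"] by simp
qed

lemma int_tail_tendsto_0:
  fixes f :: "int \<Rightarrow> real"
  assumes f: "f summable_on UNIV" and "\<And>k. 0 \<le> f k" and "0 < \<epsilon>"
  shows "\<exists>K. \<forall>n\<ge>K. infsum f {k. \<bar>k\<bar> > int n} \<le> \<epsilon>"
proof -
  obtain F where F: "finite F" "dist (sum f F) (infsum f UNIV) \<le> \<epsilon>"
    using infsum_finite_approximation[OF f \<open>0 < \<epsilon>\<close>] by auto
  define K where "K = nat (Max (insert 0 (abs ` F)))"
  have K: "\<bar>k\<bar> \<le> int K" if "k \<in> F" for k
    using F(1) that by (auto simp: K_def intro!: Max_ge)
  have "infsum f {k. \<bar>k\<bar> > int n} \<le> \<epsilon>" if n: "K \<le> n" for n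
  proof -
    have sub: "f summable_on A" for A by (rule summable_on_subset_banach[OF f]) auto
    have "F \<inter> {k. \<bar>k\<bar> > int n} = {}" using K n by force
    then have "sum f F + infsum f {k. \<bar>k\<bar> > int n} = infsum f (F \<union> {k. \<bar>k\<bar> > int n})"
      using F(1) by (subst infsum_Un_disjoint) (auto intro: sub)
    also have "\<dots> \<le> infsum f UNIV" by (intro infsum_mono2 sub) (use assms in auto)
    finally show ?thesis using F(2) by (simp add: dist_real_def)
  qed
  then show ?thesis by blast
qed

text \<open>Weighted Hilbert-Schmidt bound: Cauchy-Schwarz over pairs between Q(k - m) / sqrt(D k D
  m) and the product of the weighted vectors. Where \<open>D\<close> vanishes the vectors vanish
  too, and the quotient is 0 by the convention for division; this lets the same lemma serve for a
  strictly positive weight and for one with two zeros.\<close>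

lemma kernel_form_bound:
  fixes Q f g :: "int \<Rightarrow> complex" and D :: "int \<Rightarrow> real"
  assumes D: "\<And>k. 0 \<le> D k"
    and HS: "(\<lambda>(k, m). (cmod (Q (k - m)))\<^sup>2 / (D k * D m)) summable_on UNIV"
    and H: "(\<Sum>\<^sub>\<infinity>(k, m). (cmod (Q (k - m)))\<^sup>2 / (D k * D m)) \<le> H"
    and f: "(\<lambda>k. D k * (cmod (f k))\<^sup>2) summable_on UNIV" "\<And>k. D k = 0 \<Longrightarrow> f k = 0"
    and g: "(\<lambda>k. D k * (cmod (g k))\<^sup>2) summable_on UNIV" "\<And>k. D k = 0 \<Longrightarrow> g k = 0"
  shows "(\<lambda>(k, m). cmod (Q (k - m) * f m * cnj (g k))) summable_on UNIV"
    and "(\<Sum>\<^sub>\<infinity>(k, m). cmod (Q (k - m) * f m * cnj (g k))) \<le>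
      sqrt H * (sqrt (\<Sum>\<^sub>\<infinity>k. D k * (cmod (f k))\<^sup>2) * sqrt (\<Sum>\<^sub>\<infinity>k. D k * (cmod (g k))\<^sup>2))"
proof -
  define u where "u = (\<lambda>(k, m). cmod (Q (k - m)) / sqrt (D k * D m))"
  define v where "v = (\<lambda>(k, m). (sqrt (D k) * cmod (g k)) * (sqrt (D m) * cmod (f m)))"
  have u2: "(u x)\<^sup>2 = (case x of (k, m) \<Rightarrow> (cmod (Q (k - m)))\<^sup>2 / (D k * D m))" for x
    by (auto simp: u_def power_divide D split: prod.splits)
  have v2: "(v x)\<^sup>2 = (case x of (k, m) \<Rightarrow> (D k * (cmod (g k))\<^sup>2) * (D m * (cmod (f m))\<^sup>2))" for x
    by (auto simp: v_def power_mult_distrib D split: prod.splits)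
  have uv: "\<bar>u x * v x\<bar> = (case x of (k, m) \<Rightarrow> cmod (Q (k - m) * f m * cnj (g k)))" for x
  proof -
    obtain k m where x: "x = (k, m)" by (cases x)
    show ?thesis
    proof (cases "D k = 0 \<or> D m = 0")
      case True
      then show ?thesis using f(2) g(2) by (auto simp: x u_def v_def)
    next
      case False
      then have "0 < D k" "0 < D m" using D[of k] D[of m] by auto
      then show ?thesis by (simp add: x u_def v_def real_sqrt_mult norm_mult abs_mult)
    qed
  qed
  have nn: "0 \<le> D k * (cmod (h k))\<^sup>2" for h k using D by simp
  have v: "(\<lambda>(k, m). (D k * (cmod (g k))\<^sup>2) * (D m * (cmod (f m))\<^sup>2)) summable_on UNIV"
    "(\<Sum>\<^sub>\<infinity>(k, m). (D k * (cmod (g k))\<^sup>2) * (D m * (cmod (f m))\<^sup>2)) \<le>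
       (\<Sum>\<^sub>\<infinity>k. (D k * (cmod (g k))\<^sup>2) * (\<Sum>\<^sub>\<infinity>m. D m * (cmod (f m))\<^sup>2))"
    using nonneg_double_sum[of "\<lambda>k m. (D k * (cmod (g k))\<^sup>2) * (D m * (cmod (f m))\<^sup>2)"
          "\<lambda>k. (D k * (cmod (g k))\<^sup>2) * (\<Sum>\<^sub>\<infinity>m. D m * (cmod (f m))\<^sup>2)"]
        mult_nonneg_nonneg[OF nn nn] summable_on_cmult_right[OF f(1)] summable_on_cmult_left[OF g(1)]
    by (simp_all add: infsum_cmult_right')
  have us: "(\<lambda>x. (u x)\<^sup>2) summable_on UNIV" and vs: "(\<lambda>x. (v x)\<^sup>2) summable_on UNIV"
    unfolding u2 v2 using HS v(1) by simp_all
  have H0: "0 \<le> H"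
    using D by (intro order_trans[OF infsum_nonneg H]) (auto split: prod.splits)
  note CS = infsum_Cauchy_Schwarz[OF us vs]
  show "(\<lambda>(k, m). cmod (Q (k - m) * f m * cnj (g k))) summable_on UNIV"
    using CS(1) unfolding uv .
  have "(\<Sum>\<^sub>\<infinity>(k, m). cmod (Q (k - m) * f m * cnj (g k))) \<le>
      sqrt (\<Sum>\<^sub>\<infinity>x. (u x)\<^sup>2) * sqrt (\<Sum>\<^sub>\<infinity>x. (v x)\<^sup>2)"
    using CS(2) unfolding uv .
  also have "\<dots> \<le> sqrt H * sqrt ((\<Sum>\<^sub>\<infinity>k. D k * (cmod (g k))\<^sup>2) * (\<Sum>\<^sub>\<infinity>m. D m * (cmod (f m))\<^sup>2))"
    unfolding u2 v2 using H v(2) H0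
    by (intro mult_mono real_sqrt_le_mono)
      (auto simp: infsum_cmult_left' infsum_nonneg case_prod_unfold D intro!: infsum_nonneg mult_nonneg_nonneg)
  finally show "(\<Sum>\<^sub>\<infinity>(k, m). cmod (Q (k - m) * f m * cnj (g k))) \<le>
      sqrt H * (sqrt (\<Sum>\<^sub>\<infinity>k. D k * (cmod (f k))\<^sup>2) * sqrt (\<Sum>\<^sub>\<infinity>k. D k * (cmod (g k))\<^sup>2))"
    by (simp add: real_sqrt_mult mult.commute)
qed

text \<open>The coefficient sequence of a real mean-zero potential in H^-1. The summability
  condition does not see index 0, where the quotient is 0 by convention; \<open>Q_zero\<close>
  closes this and makes \<open>norm_Q\<close> valid at every index.\<close>

locale potential =
  fixes Q :: "int \<Rightarrow> complex"
  assumes Q_hermitian: "Q (- j) = cnj (Q j)"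
    and Q_zero: "Q 0 = 0"
    and Q_summable: "(\<lambda>j. (cmod (Q j) / \<bar>real_of_int j\<bar>)\<^sup>2) summable_on UNIV"
begin

definition \<alpha> :: "int \<Rightarrow> real" where
  "\<alpha> j = cmod (Q j) / \<bar>real_of_int j\<bar>"

definition \<alpha>2 :: real where
  "\<alpha>2 = (\<Sum>\<^sub>\<infinity>j. (\<alpha> j)\<^sup>2)"

lemma \<alpha>_summable: "(\<lambda>j. (\<alpha> j)\<^sup>2) summable_on UNIV"
  using Q_summable by (simp add: \<alpha>_def)

lemma \<alpha>2_nonneg: "0 \<le> \<alpha>2"
  unfolding \<alpha>2_def by (rule infsum_nonneg) simp

lemma norm_Q: "(cmod (Q j))\<^sup>2 = (real_of_int j)\<^sup>2 * (\<alpha> j)\<^sup>2"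
  using Q_zero by (cases "j = 0") (auto simp: \<alpha>_def power_divide)

text \<open>Interpolation: for k \<noteq> 0 the denominator is at least max(k^2, c), and splitting
  this maximum as a 3/4 power times a 1/4 power leaves a summable factor in k and a negative power
  of c. The index 0 contributes 1/c.\<close>

lemma kinetic_weight_sum:
  assumes c: "1 \<le> (c::real)"
  shows "(\<lambda>k::int. 1 / (pi\<^sup>2 * (real_of_int k)\<^sup>2 + c)) summable_on UNIV"
    and "(\<Sum>\<^sub>\<infinity>k::int. 1 / (pi\<^sup>2 * (real_of_int k)\<^sup>2 + c)) \<le> 1 / c + zeta32 / c powr (1/4)"
proof -
  have pi2: "1 \<le> pi\<^sup>2" using pi_gt3 by (simp add: one_le_power)
  define t where "t = (\<lambda>k::int. (if k = 0 then 1 / c else 0) + \<bar>real_of_int k\<bar> powr (-3/2) / c powr (1/4))"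
  have le: "1 / (pi\<^sup>2 * (real_of_int k)\<^sup>2 + c) \<le> t k" for k
  proof (cases "k = 0")
    case False
    define x where "x = \<bar>real_of_int k\<bar>"
    have x: "1 \<le> x" using False unfolding x_def by linarith
    define y where "y = max (x\<^sup>2) c"
    have y: "1 \<le> y" "x\<^sup>2 \<le> y" "c \<le> y" using c by (auto simp: y_def)
    have "x powr (3/2) * c powr (1/4) = (x\<^sup>2) powr (3/4) * c powr (1/4)"
      using x by (simp add: powr_powr flip: powr_numeral)
    also have "\<dots> \<le> y powr (3/4) * y powr (1/4)"
      using x y c by (intro mult_mono powr_mono2) auto
    also have "\<dots> = y" using y by (simp flip: powr_add)
    also have "y \<le> x\<^sup>2 + c" using c by (simp add: y_def)
    also have "\<dots> \<le> pi\<^sup>2 * x\<^sup>2 + c" using pi2 mult_right_mono[of 1 "pi\<^sup>2" "x\<^sup>2"] by simp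
    finally have "x powr (3/2) * c powr (1/4) \<le> pi\<^sup>2 * x\<^sup>2 + c" .
    then have "1 / (pi\<^sup>2 * x\<^sup>2 + c) \<le> 1 / (x powr (3/2) * c powr (1/4))"
      using x c by (intro divide_left_mono mult_pos_pos add_nonneg_pos) simp_all
    also have "\<dots> = x powr (-3/2) / c powr (1/4)"
      using powr_minus_divide[of x "3/2"] by simp
    finally show ?thesis using False by (simp add: t_def x_def)
  qed (auto simp: t_def)
  have t1: "(\<lambda>k::int. if k = 0 then 1 / c else 0) summable_on UNIV"
    by (rule finite_nonzero_values_imp_summable_on) (auto intro: finite_subset[of _ "{0}"])
  have t2: "(\<lambda>k::int. \<bar>real_of_int k\<bar> powr (-3/2) / c powr (1/4)) summable_on UNIV"
    using summable_on_cmult_left[OF zeta32_summable, of "1 / c powr (1/4)"] by simp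
  have t: "t summable_on UNIV" unfolding t_def by (intro summable_on_add t1 t2)
  show s: "(\<lambda>k::int. 1 / (pi\<^sup>2 * (real_of_int k)\<^sup>2 + c)) summable_on UNIV"
    by (rule summable_on_comparison_test[OF t le]) (use c in auto)
  have "(\<Sum>\<^sub>\<infinity>k::int. 1 / (pi\<^sup>2 * (real_of_int k)\<^sup>2 + c)) \<le> infsum t UNIV"
    by (intro infsum_mono s t le)
  also have "infsum t UNIV = (\<Sum>\<^sub>\<infinity>k::int. if k = 0 then 1 / c else 0) + (\<Sum>\<^sub>\<infinity>k::int. \<bar>real_of_int k\<bar> powr (-3/2) / c powr (1/4))"
    unfolding t_def by (intro infsum_add t1 t2)
  also have "(\<Sum>\<^sub>\<infinity>k::int. if k = 0 then 1 / c else 0) = (\<Sum>\<^sub>\<infinity>k\<in>{0::int}. 1 / c)"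
    by (rule infsum_cong_neutral) auto
  also have "(\<Sum>\<^sub>\<infinity>k::int. \<bar>real_of_int k\<bar> powr (-3/2) / c powr (1/4)) = zeta32 / c powr (1/4)"
    using infsum_cmult_left'[of "\<lambda>k::int. \<bar>real_of_int k\<bar> powr (-3/2)" "1 / c powr (1/4)"]
    by (simp add: zeta32_def)
  finally show "(\<Sum>\<^sub>\<infinity>k::int. 1 / (pi\<^sup>2 * (real_of_int k)\<^sup>2 + c)) \<le> 1 / c + zeta32 / c powr (1/4)"
    by simp
qed

text \<open>With j = k - m one has j^2 \<le> 2 (k^2 + m^2) \<le> 2 (D k + D m), so the squared
  kernel is at most 2 (\<alpha> j)^2 (1/D k + 1/D m). Square summability of \<alpha>, that is q in
  H^-1, is just what the sum over j asks for; the sum over k becomes small as \<open>c\<close>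
  grows.\<close>

lemma HS_kinetic:
  assumes c: "1 \<le> c"
  defines "D \<equiv> \<lambda>k::int. pi\<^sup>2 * (real_of_int k)\<^sup>2 + c"
  shows "(\<lambda>(k, m). (cmod (Q (k - m)))\<^sup>2 / (D k * D m)) summable_on UNIV"
    and "(\<Sum>\<^sub>\<infinity>(k, m). (cmod (Q (k - m)))\<^sup>2 / (D k * D m)) \<le> 4 * \<alpha>2 * (1 / c + zeta32 / c powr (1/4))"
proof -
  define Z where "Z = (\<Sum>\<^sub>\<infinity>k::int. 1 / D k)"
  have Ds: "(\<lambda>k. 1 / D k) summable_on UNIV" and Z: "Z \<le> 1 / c + zeta32 / c powr (1/4)"
    using kinetic_weight_sum[OF c] by (auto simp: D_def Z_def)
  have D: "(real_of_int k)\<^sup>2 \<le> D k" "0 < D k" for k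
  proof -
    have "1 \<le> pi\<^sup>2" using pi_gt3 by (simp add: one_le_power)
    from mult_right_mono[OF this, of "(real_of_int k)\<^sup>2"] show "(real_of_int k)\<^sup>2 \<le> D k"
      using c unfolding D_def by simp
    show "0 < D k" using c by (simp add: D_def add_nonneg_pos)
  qed
  have le: "(cmod (Q j))\<^sup>2 / (D k * D (k - j)) \<le> 2 * (\<alpha> j)\<^sup>2 * (1 / D k + 1 / D (k - j))" for j k
  proof -
    have "0 \<le> (real_of_int k + real_of_int (k - j))\<^sup>2" by simp
    then have "(real_of_int j)\<^sup>2 \<le> 2 * ((real_of_int k)\<^sup>2 + (real_of_int (k - j))\<^sup>2)"
      by (simp add: power2_eq_square algebra_simps)
    also have "\<dots> \<le> 2 * (D k + D (k - j))" using add_mono[OF D(1)[of k] D(1)[of "k - j"]] by (intro mult_left_mono) simp_all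
    finally have "(cmod (Q j))\<^sup>2 \<le> 2 * (D k + D (k - j)) * (\<alpha> j)\<^sup>2"
      unfolding norm_Q by (rule mult_right_mono) simp
    then have "(cmod (Q j))\<^sup>2 / (D k * D (k - j)) \<le> 2 * (D k + D (k - j)) * (\<alpha> j)\<^sup>2 / (D k * D (k - j))"
      using D by (intro divide_right_mono) (auto intro: less_imp_le)
    also have "\<dots> = 2 * (\<alpha> j)\<^sup>2 * (1 / D k + 1 / D (k - j))"
      using D(2)[of k] D(2)[of "k - j"] by (simp add: field_simps)
    finally show ?thesis .
  qed
  have Ds': "(\<lambda>k. 1 / D (k - j)) summable_on UNIV" and Z': "(\<Sum>\<^sub>\<infinity>k. 1 / D (k - j)) = Z" for j
    using infsum_int_shift(2)[of "\<lambda>k. 1 / D k" "- j"] infsum_int_shift(4)[of "\<lambda>k. 1 / D k" "- j"] Ds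
    by (auto simp: Z_def)
  have nn: "0 \<le> (cmod (Q j))\<^sup>2 / (D k * D (k - j))" for j k
    using D(2)[of k] D(2)[of "k - j"] by simp
  have row: "(\<lambda>k. 2 * (\<alpha> j)\<^sup>2 * (1 / D k + 1 / D (k - j))) summable_on UNIV" for j
    by (intro summable_on_cmult_right summable_on_add Ds Ds')
  have row': "(\<lambda>k. (cmod (Q j))\<^sup>2 / (D k * D (k - j))) summable_on UNIV" for j
    by (rule summable_on_comparison_test[OF row le nn])
  have b: "(\<Sum>\<^sub>\<infinity>k. (cmod (Q j))\<^sup>2 / (D k * D (k - j))) \<le> (\<alpha> j)\<^sup>2 * (4 * Z)" for j
  proof -
    have "(\<Sum>\<^sub>\<infinity>k. (cmod (Q j))\<^sup>2 / (D k * D (k - j))) \<le> (\<Sum>\<^sub>\<infinity>k. 2 * (\<alpha> j)\<^sup>2 * (1 / D k + 1 / D (k - j)))"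
      by (intro infsum_mono row row' le)
    also have "\<dots> = 2 * (\<alpha> j)\<^sup>2 * (Z + Z)"
      unfolding infsum_cmult_right' using infsum_add[OF Ds Ds'[of j]] Z'[of j] by (simp add: Z_def)
    finally show ?thesis by simp
  qed
  have bs: "(\<lambda>j. (\<alpha> j)\<^sup>2 * (4 * Z)) summable_on UNIV"
    by (intro summable_on_cmult_left \<alpha>_summable)
  note d = nonneg_double_sum[of "\<lambda>j k. (cmod (Q j))\<^sup>2 / (D k * D (k - j))", OF nn row' b bs]
  note r = reparametrize_pairs[of "\<lambda>j k. (cmod (Q j))\<^sup>2 / (D k * D (k - j))"]
  show "(\<lambda>(k, m). (cmod (Q (k - m)))\<^sup>2 / (D k * D m)) summable_on UNIV"
    using d(1) r(1) by simp
  have "(\<Sum>\<^sub>\<infinity>(k, m). (cmod (Q (k - m)))\<^sup>2 / (D k * D m)) \<le> 4 * \<alpha>2 * Z"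
    using d(2) r(2) infsum_cmult_left'[of "\<lambda>j. (\<alpha> j)\<^sup>2" "4 * Z" UNIV] unfolding \<alpha>2_def by simp
  also have "\<dots> \<le> 4 * \<alpha>2 * (1 / c + zeta32 / c powr (1/4))"
    using Z \<alpha>2_nonneg by (intro mult_left_mono) auto
  finally show "(\<Sum>\<^sub>\<infinity>(k, m). (cmod (Q (k - m)))\<^sup>2 / (D k * D m)) \<le> 4 * \<alpha>2 * (1 / c + zeta32 / c powr (1/4))" .
qed

end

section \<open>The form domain and the energy form of the shifted operator\<close>

lemma infsum_complex_of_real:
  "f summable_on I \<Longrightarrow> (\<Sum>\<^sub>\<infinity>k\<in>I. complex_of_real (f k)) = of_real (infsum f I)"
  by (intro infsumI has_sum_of_real has_sum_infsum)

text \<open>The constant 1/4 bounds the square of a Hilbert-Schmidt norm, so the potential is at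
  most half of the shifted kinetic energy. Hence the energy form stays above \<open>W f / 2\<close>,
  which gives positivity and coercivity.\<close>

locale shifted_potential = potential +
  fixes c :: real
  assumes c_ge_1: "1 \<le> c"
    and c_large: "4 * \<alpha>2 * (1 / c + zeta32 / c powr (1/4)) \<le> 1 / 4"
begin

definition wt :: "int \<Rightarrow> real" where
  "wt k = pi\<^sup>2 * (real_of_int k)\<^sup>2 + c"

text \<open>The Fourier side of H^1(R/2Z), the form domain: for fixed \<open>c\<close> the weight
  \<open>wt k\<close> is comparable to (1 + |k|)^2.\<close>

definition X :: "(int \<Rightarrow> complex) set" where
  "X = {f. (\<lambda>k. wt k * (cmod (f k))\<^sup>2) summable_on UNIV}"

definition W :: "(int \<Rightarrow> complex) \<Rightarrow> real" where
  "W f = (\<Sum>\<^sub>\<infinity>k. wt k * (cmod (f k))\<^sup>2)"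

definition S :: "(int \<Rightarrow> complex) \<Rightarrow> (int \<Rightarrow> complex) \<Rightarrow> complex" where
  "S f g = (\<Sum>\<^sub>\<infinity>k. f k * cnj (g k))"

definition Qop :: "(int \<Rightarrow> complex) \<Rightarrow> int \<Rightarrow> complex" where
  "Qop f k = (\<Sum>\<^sub>\<infinity>m. Q (k - m) * f m)"

definition N :: "(int \<Rightarrow> complex) \<Rightarrow> (int \<Rightarrow> complex) \<Rightarrow> complex" where
  "N f g = (\<Sum>\<^sub>\<infinity>k. Qop f k * cnj (g k))"

text \<open>The form of L(q) + c, grouped as a pairing of one sequence with \<open>g\<close>. So
  grouped, testing with \<open>\<delta> k\<close> reads off the eigenvalue equation at k, and for
  fixed \<open>f\<close> weak convergence applies to the second argument.\<close>

definition A :: "(int \<Rightarrow> complex) \<Rightarrow> (int \<Rightarrow> complex) \<Rightarrow> complex" where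
  "A f g = (\<Sum>\<^sub>\<infinity>k. (of_real (wt k) * f k + Qop f k) * cnj (g k))"

definition \<delta> :: "int \<Rightarrow> int \<Rightarrow> complex" where
  "\<delta> j k = (if k = j then 1 else 0)"

lemma wt_ge_1: "1 \<le> wt k"
  using c_ge_1 by (simp add: wt_def add_nonneg_pos add_increasing)

lemma wt_pos [simp]: "0 < wt k" "0 \<le> wt k" "wt k \<noteq> 0"
  using wt_ge_1[of k] by auto

lemma X_D: "f \<in> X \<Longrightarrow> (\<lambda>k. wt k * (cmod (f k))\<^sup>2) summable_on UNIV"
  by (simp add: X_def)

lemma W_nonneg: "0 \<le> W f"
  unfolding W_def by (rule infsum_nonneg) simp

lemma X_finite: "finite {k. f k \<noteq> 0} \<Longrightarrow> f \<in> X"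
  unfolding X_def by (auto intro!: finite_nonzero_values_imp_summable_on elim: finite_subset[rotated])

lemma \<delta>_mem: "\<delta> j \<in> X"
  by (rule X_finite) (simp add: \<delta>_def)

lemma zero_X: "(\<lambda>_. 0) \<in> X"
  by (rule X_finite) simp

lemma scale_X: "f \<in> X \<Longrightarrow> (\<lambda>k. t * f k) \<in> X"
  using summable_on_cmult_right[of "\<lambda>k. wt k * (cmod (f k))\<^sup>2" UNIV "(cmod t)\<^sup>2"]
  by (simp add: X_def norm_mult power_mult_distrib mult_ac)

lemma wt_norm_add_le:
  "wt k * (cmod (a + b))\<^sup>2 \<le> 2 * (wt k * (cmod a)\<^sup>2) + 2 * (wt k * (cmod b)\<^sup>2)"
proof -
  have "(cmod (a + b))\<^sup>2 \<le> (cmod a + cmod b)\<^sup>2"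
    by (intro power_mono norm_triangle_ineq) simp
  also have "\<dots> \<le> 2 * (cmod a)\<^sup>2 + 2 * (cmod b)\<^sup>2"
    using zero_le_power2[of "cmod a - cmod b"] by (simp add: power2_eq_square algebra_simps)
  finally have "wt k * (cmod (a + b))\<^sup>2 \<le> wt k * (2 * (cmod a)\<^sup>2 + 2 * (cmod b)\<^sup>2)"
    by (rule mult_left_mono) simp
  then show ?thesis by (simp add: algebra_simps)
qed

lemma add_X:
  assumes "f \<in> X" "g \<in> X"
  shows "(\<lambda>k. f k + g k) \<in> X" and "W (\<lambda>k. f k + g k) \<le> 2 * W f + 2 * W g"
proof -
  have s: "(\<lambda>k. 2 * (wt k * (cmod (f k))\<^sup>2) + 2 * (wt k * (cmod (g k))\<^sup>2)) summable_on UNIV"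
    by (intro summable_on_add summable_on_cmult_right X_D assms)
  have s2: "(\<lambda>k. wt k * (cmod (f k + g k))\<^sup>2) summable_on UNIV"
    by (rule summable_on_comparison_test[OF s wt_norm_add_le]) simp
  then show "(\<lambda>k. f k + g k) \<in> X" by (simp add: X_def)
  have "W (\<lambda>k. f k + g k) \<le> (\<Sum>\<^sub>\<infinity>k. 2 * (wt k * (cmod (f k))\<^sup>2) + 2 * (wt k * (cmod (g k))\<^sup>2))"
    unfolding W_def by (intro infsum_mono s s2 wt_norm_add_le)
  also have "\<dots> = (\<Sum>\<^sub>\<infinity>k. 2 * (wt k * (cmod (f k))\<^sup>2)) + (\<Sum>\<^sub>\<infinity>k. 2 * (wt k * (cmod (g k))\<^sup>2))"
    by (intro infsum_add summable_on_cmult_right X_D assms)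
  also have "\<dots> = 2 * W f + 2 * W g" by (simp add: W_def infsum_cmult_right')
  finally show "W (\<lambda>k. f k + g k) \<le> 2 * W f + 2 * W g" .
qed

lemma sq_norm_summable:
  assumes "f \<in> X" shows "(\<lambda>k. (cmod (f k))\<^sup>2) summable_on UNIV"
proof (rule summable_on_comparison_test[OF X_D[OF assms]])
  show "(cmod (f k))\<^sup>2 \<le> wt k * (cmod (f k))\<^sup>2" for k
    using mult_right_mono[OF wt_ge_1, of "(cmod (f k))\<^sup>2"] by simp
qed simp

lemma pairs_summable:
  assumes "f \<in> X" "g \<in> X"
  shows "(\<lambda>(k, m). cmod (Q (k - m) * f m * cnj (g k))) summable_on UNIV"
    and "(\<Sum>\<^sub>\<infinity>(k, m). cmod (Q (k - m) * f m * cnj (g k))) \<le> 1 / 2 * (sqrt (W f) * sqrt (W g))"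
proof -
  note HS = HS_kinetic[OF c_ge_1, folded wt_def]
  note H = order_trans[OF HS(2) c_large]
  have sq: "sqrt (1 / 4) = (1 / 2 :: real)" by (simp add: real_sqrt_divide)
  have D0: "wt k = 0 \<Longrightarrow> f k = 0" "wt k = 0 \<Longrightarrow> g k = 0" for k by simp_all
  note K = kernel_form_bound[of wt Q "1/4" f g, OF wt_pos(2) HS(1) H
      X_D[OF assms(1)] D0(1) X_D[OF assms(2)] D0(2), unfolded sq, folded W_def]
  show "(\<lambda>(k, m). cmod (Q (k - m) * f m * cnj (g k))) summable_on UNIV" by (rule K(1))
  show "(\<Sum>\<^sub>\<infinity>(k, m). cmod (Q (k - m) * f m * cnj (g k))) \<le> 1 / 2 * (sqrt (W f) * sqrt (W g))"
    by (rule K(2))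
qed

lemma pairs_summable':
  assumes "f \<in> X" "g \<in> X"
  shows "(\<lambda>(k, m). Q (k - m) * f m * cnj (g k)) summable_on UNIV"
  using pairs_summable(1)[OF assms]
  by - (rule abs_summable_summable, simp only: case_prod_unfold)

lemma row_summable:
  assumes "f \<in> X"
  shows "(\<lambda>m. cmod (Q (k - m) * f m)) summable_on UNIV" and "(\<lambda>m. Q (k - m) * f m) summable_on UNIV"
proof -
  have "(\<lambda>m. cmod (Q (k - m) * f m * cnj (\<delta> k k))) summable_on UNIV"
    using summable_on_SigmaD1[where A = UNIV and B = "\<lambda>_. UNIV" and x = k and
        f = "\<lambda>i m. cmod (Q (i - m) * f m * cnj (\<delta> k i))"]
      pairs_summable(1)[OF assms \<delta>_mem[of k]] by simp
  then show s: "(\<lambda>m. cmod (Q (k - m) * f m)) summable_on UNIV" by (simp add: \<delta>_def)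
  show "(\<lambda>m. Q (k - m) * f m) summable_on UNIV" using s by (rule abs_summable_summable)
qed

text \<open>Fubini, justified by absolute summability over pairs. As a double sum the form can be
  transposed, which is how its Hermitian symmetry is obtained from that of \<open>Q\<close>.\<close>

lemma N_eq_pairs:
  assumes "f \<in> X" "g \<in> X"
  shows "N f g = (\<Sum>\<^sub>\<infinity>(k, m). Q (k - m) * f m * cnj (g k))"
    and "(\<lambda>k. Qop f k * cnj (g k)) summable_on UNIV"
    and "(\<lambda>k. cmod (Qop f k * cnj (g k))) summable_on UNIV"
proof -
  have row: "(\<Sum>\<^sub>\<infinity>m. Q (k - m) * f m * cnj (g k)) = Qop f k * cnj (g k)" for k
    unfolding Qop_def by (rule infsum_cmult_left')
  show "N f g = (\<Sum>\<^sub>\<infinity>(k, m). Q (k - m) * f m * cnj (g k))"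
    using infsum_Sigma'_banach[where A = UNIV and B = "\<lambda>_. UNIV" and f = "\<lambda>k m. Q (k - m) * f m * cnj (g k)"]
      pairs_summable'[OF assms] by (simp add: N_def row)
  show s: "(\<lambda>k. cmod (Qop f k * cnj (g k))) summable_on UNIV"
  proof (rule summable_on_comparison_test)
    show "(\<lambda>k. \<Sum>\<^sub>\<infinity>m. cmod (Q (k - m) * f m * cnj (g k))) summable_on UNIV"
      using summable_on_Sigma_banach[where A = UNIV and B = "\<lambda>_. UNIV" and f = "\<lambda>k m. cmod (Q (k - m) * f m * cnj (g k))"]
        pairs_summable(1)[OF assms] by simp
    show "cmod (Qop f k * cnj (g k)) \<le> (\<Sum>\<^sub>\<infinity>m. cmod (Q (k - m) * f m * cnj (g k)))" for k
      unfolding row[symmetric]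
    proof (rule norm_infsum_bound)
      show "(\<lambda>m. cmod (Q (k - m) * f m * cnj (g k))) summable_on UNIV"
        using summable_on_cmult_left[OF row_summable(1)[OF assms(1), of k], of "cmod (g k)"]
        by (simp add: norm_mult)
    qed
  qed simp
  then show "(\<lambda>k. Qop f k * cnj (g k)) summable_on UNIV" by (rule abs_summable_summable)
qed

lemma N_bound:
  assumes "f \<in> X" "g \<in> X"
  shows "cmod (N f g) \<le> 1 / 2 * (sqrt (W f) * sqrt (W g))"
proof -
  have "cmod (N f g) \<le> (\<Sum>\<^sub>\<infinity>x. cmod (case x of (k, m) \<Rightarrow> Q (k - m) * f m * cnj (g k)))"
    unfolding N_eq_pairs(1)[OF assms]
  proof (rule norm_infsum_bound)
    show "(\<lambda>x. cmod (case x of (k, m) \<Rightarrow> Q (k - m) * f m * cnj (g k))) summable_on UNIV"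
      using pairs_summable(1)[OF assms] by (simp only: case_prod_unfold)
  qed
  also have "\<dots> = (\<Sum>\<^sub>\<infinity>(k, m). cmod (Q (k - m) * f m * cnj (g k)))"
    by (intro infsum_cong) auto
  finally show ?thesis using pairs_summable(2)[OF assms] by linarith
qed

lemma product_summable:
  assumes "f \<in> X" "g \<in> X"
  shows "(\<lambda>k. cmod (of_real (wt k) * f k * cnj (g k))) summable_on UNIV"
    and "(\<lambda>k. of_real (wt k) * f k * cnj (g k)) summable_on UNIV"
    and "(\<lambda>k. cmod (f k * cnj (g k))) summable_on UNIV"
    and "(\<lambda>k. f k * cnj (g k)) summable_on UNIV"
proof -
  have s: "(\<lambda>k. (sqrt (wt k) * cmod (h k))\<^sup>2) summable_on UNIV" if "h \<in> X" for h
    using X_D[OF that] by (simp add: power_mult_distrib)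
  show 1: "(\<lambda>k. cmod (of_real (wt k) * f k * cnj (g k))) summable_on UNIV"
  proof -
    have eq: "\<bar>sqrt (wt k) * cmod (f k) * (sqrt (wt k) * cmod (g k))\<bar> = cmod (of_real (wt k) * f k * cnj (g k))" for k
    proof -
      have "sqrt (wt k) * cmod (f k) * (sqrt (wt k) * cmod (g k)) = (sqrt (wt k) * sqrt (wt k)) * cmod (f k) * cmod (g k)"
        by (simp only: mult.assoc mult.left_commute)
      then show ?thesis by (simp add: norm_mult abs_mult)
    qed
    show ?thesis using infsum_Cauchy_Schwarz(1)[OF s s, OF assms] unfolding eq .
  qed
  show "(\<lambda>k. of_real (wt k) * f k * cnj (g k)) summable_on UNIV"
    using 1 by (rule abs_summable_summable)
  show 2: "(\<lambda>k. cmod (f k * cnj (g k))) summable_on UNIV"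
    using infsum_Cauchy_Schwarz(1)[OF sq_norm_summable sq_norm_summable, OF assms]
    by (simp add: norm_mult abs_mult)
  show "(\<lambda>k. f k * cnj (g k)) summable_on UNIV"
    using 2 by (rule abs_summable_summable)
qed

lemma A_eq:
  assumes "f \<in> X" "g \<in> X"
  shows "A f g = (\<Sum>\<^sub>\<infinity>k. of_real (wt k) * f k * cnj (g k)) + N f g"
  using infsum_add[OF product_summable(2)[OF assms] N_eq_pairs(2)[OF assms]]
  by (simp add: A_def N_def distrib_right)

lemma Qop_add: "f \<in> X \<Longrightarrow> g \<in> X \<Longrightarrow> Qop (\<lambda>k. f k + g k) k = Qop f k + Qop g k"
  unfolding Qop_def by (simp add: distrib_left infsum_add row_summable)

lemma Qop_scale: "Qop (\<lambda>k. t * f k) k = t * Qop f k"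
  unfolding Qop_def by (simp add: mult.left_commute infsum_cmult_right')

sublocale S: hermitian_form X S
proof
  fix f g h :: "int \<Rightarrow> complex" and t :: complex
  show "(\<lambda>_. 0) \<in> X" by (rule zero_X)
  show "(\<lambda>k. t * f k) \<in> X" if "f \<in> X" using that by (rule scale_X)
  show "(\<lambda>k. f k + g k) \<in> X" if "f \<in> X" "g \<in> X" using that by (rule add_X)
  show "S (\<lambda>k. f k + g k) h = S f h + S g h" if "f \<in> X" "g \<in> X" "h \<in> X"
    using that by (simp add: S_def distrib_right infsum_add product_summable)
  show "S (\<lambda>k. t * f k) h = t * S f h" if "f \<in> X" "h \<in> X"
    by (simp add: S_def mult.assoc infsum_cmult_right')
  show "S g f = cnj (S f g)" if "f \<in> X" "g \<in> X"
    unfolding S_def infsum_cnj[symmetric] by (intro infsum_cong) (simp add: mult.commute)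
qed

sublocale N: hermitian_form X N
proof
  fix f g h :: "int \<Rightarrow> complex" and t :: complex
  show "N (\<lambda>k. f k + g k) h = N f h + N g h" if "f \<in> X" "g \<in> X" "h \<in> X"
    using that by (simp add: N_def Qop_add distrib_right infsum_add N_eq_pairs)
  show "N (\<lambda>k. t * f k) h = t * N f h" if "f \<in> X" "h \<in> X"
    by (simp add: N_def Qop_scale mult.assoc infsum_cmult_right')
  show "N g f = cnj (N f g)" if "f \<in> X" "g \<in> X"
  proof -
    have b: "bij_betw prod.swap UNIV (UNIV :: (int \<times> int) set)"
      by (rule bij_betw_byWitness[of _ prod.swap]) auto
    have "N g f = (\<Sum>\<^sub>\<infinity>(k, m). Q (k - m) * g m * cnj (f k))" using that by (simp add: N_eq_pairs)
    also have "\<dots> = (\<Sum>\<^sub>\<infinity>x. (case prod.swap x of (k, m) \<Rightarrow> Q (k - m) * g m * cnj (f k)))"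
      using infsum_reindex_bij_betw[OF b, of "\<lambda>(k, m). Q (k - m) * g m * cnj (f k)"] by simp
    also have "\<dots> = (\<Sum>\<^sub>\<infinity>x. cnj (case x of (k, m) \<Rightarrow> Q (k - m) * f m * cnj (g k)))"
    proof (intro infsum_cong)
      fix x :: "int \<times> int"
      obtain k m where x: "x = (k, m)" by (cases x)
      show "(case prod.swap x of (k, m) \<Rightarrow> Q (k - m) * g m * cnj (f k)) =
          cnj (case x of (k, m) \<Rightarrow> Q (k - m) * f m * cnj (g k))"
        using Q_hermitian[of "k - m"] by (simp add: x)
    qed
    also have "\<dots> = cnj (N f g)" using that by (simp add: N_eq_pairs)
    finally show ?thesis .
  qed
qed (auto intro: zero_X scale_X add_X)

sublocale A: hermitian_form X A
proof
  fix f g h :: "int \<Rightarrow> complex" and t :: complex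
  show "A (\<lambda>k. f k + g k) h = A f h + A g h" if "f \<in> X" "g \<in> X" "h \<in> X"
    using that by (simp add: A_eq add_X N.add_left distrib_left distrib_right infsum_add product_summable)
  show "A (\<lambda>k. t * f k) h = t * A f h" if "f \<in> X" "h \<in> X"
    using that infsum_cmult_right'[of t "\<lambda>k. of_real (wt k) * f k * cnj (h k)" UNIV]
    by (simp add: A_eq scale_X N.scale_left distrib_left mult_ac)
  show "A g f = cnj (A f g)" if "f \<in> X" "g \<in> X"
  proof -
    have "(\<Sum>\<^sub>\<infinity>k. of_real (wt k) * g k * cnj (f k)) = cnj (\<Sum>\<^sub>\<infinity>k. of_real (wt k) * f k * cnj (g k))"
      unfolding infsum_cnj[symmetric] by (intro infsum_cong) simp
    then show ?thesis using that N.hermitian[OF that] by (simp add: A_eq)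
  qed
qed (auto intro: zero_X scale_X add_X)

lemma S_diag: "f \<in> X \<Longrightarrow> S f f = of_real (\<Sum>\<^sub>\<infinity>k. (cmod (f k))\<^sup>2)"
  using infsum_complex_of_real[OF sq_norm_summable, of f]
  unfolding S_def complex_norm_square[symmetric] of_real_power[symmetric] by simp

lemma A_diag: "f \<in> X \<Longrightarrow> Re (A f f) = W f + Re (N f f)"
proof -
  assume f: "f \<in> X"
  have "(\<Sum>\<^sub>\<infinity>k. of_real (wt k) * f k * cnj (f k)) = (\<Sum>\<^sub>\<infinity>k. of_real (wt k * (cmod (f k))\<^sup>2))"
    by (intro infsum_cong) (simp only: of_real_mult complex_norm_square mult.assoc)
  then show ?thesis
    using f infsum_complex_of_real[OF X_D[OF f]] by (simp add: A_eq W_def del: of_real_mult of_real_power)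
qed

lemma A_lower: "f \<in> X \<Longrightarrow> W f / 2 \<le> Re (A f f)"
  using N_bound[of f f] abs_Re_le_cmod[of "N f f"] W_nonneg[of f] by (simp add: A_diag)

end

text \<open>Uniformly small tails take the place of a dominating sequence.\<close>

lemma infsum_tendsto_0:
  fixes f :: "nat \<Rightarrow> int \<Rightarrow> real"
  assumes s: "\<And>i. f i summable_on UNIV" and nn: "\<And>i k. 0 \<le> f i k"
    and lim: "\<And>k. (\<lambda>i. f i k) \<longlonglongrightarrow> 0"
    and tail: "\<And>\<epsilon>. 0 < \<epsilon> \<Longrightarrow> \<exists>K::nat. \<forall>i. infsum (f i) {k. \<bar>k\<bar> > int K} \<le> \<epsilon>"
  shows "(\<lambda>i. infsum (f i) UNIV) \<longlonglongrightarrow> 0"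
proof (rule LIMSEQ_I)
  fix r :: real assume "0 < r"
  then obtain K :: nat where K: "\<And>i. infsum (f i) {k. \<bar>k\<bar> > int K} \<le> r / 2"
    using tail[of "r / 2"] by auto
  have "(\<lambda>i. \<Sum>k\<in>{- int K..int K}. f i k) \<longlonglongrightarrow> (\<Sum>k\<in>{- int K..int K}. 0)"
    by (intro tendsto_sum lim)
  then have "(\<lambda>i. \<Sum>k\<in>{- int K..int K}. f i k) \<longlonglongrightarrow> 0" by simp
  then obtain n0 where n0: "\<And>i. n0 \<le> i \<Longrightarrow> norm ((\<Sum>k\<in>{- int K..int K}. f i k) - 0) < r / 2"
    using LIMSEQ_D[of _ 0 "r / 2"] \<open>0 < r\<close> by (metis half_gt_zero)
  have "norm (infsum (f i) UNIV - 0) < r" if "n0 \<le> i" for i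
  proof -
    have U: "UNIV = {- int K..int K} \<union> {k. \<bar>k\<bar> > int K}" by auto
    have sub: "f i summable_on B" for B by (rule summable_on_subset_banach[OF s]) auto
    have "infsum (f i) UNIV = (\<Sum>k\<in>{- int K..int K}. f i k) + infsum (f i) {k. \<bar>k\<bar> > int K}"
      by (subst U, subst infsum_Un_disjoint) (auto intro: sub)
    moreover have "0 \<le> infsum (f i) UNIV" by (intro infsum_nonneg nn)
    ultimately show ?thesis using n0[OF that] K[of i] by simp
  qed
  then show "\<exists>no. \<forall>n\<ge>no. norm (infsum (f n) UNIV - 0) < r" by blast
qed

section \<open>Compactness of energy-bounded sequences\<close>

context shifted_potential
begin

text \<open>Multiplication by the potential maps the form domain into its dual H^-1: Cauchy-Schwarz
  in each row, then the Hilbert-Schmidt sum over the rows.\<close>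

lemma Qop_sq_summable:
  assumes f: "f \<in> X"
  shows "(\<lambda>k. (cmod (Qop f k))\<^sup>2 / wt k) summable_on UNIV"
proof -
  note HS = HS_kinetic(1)[OF c_ge_1, folded wt_def]
  define R where "R = (\<lambda>k. \<Sum>\<^sub>\<infinity>m. (cmod (Q (k - m)))\<^sup>2 / (wt k * wt m))"
  have R: "R summable_on UNIV"
    using summable_on_Sigma_banach[where A = UNIV and B = "\<lambda>_. UNIV" and
        f = "\<lambda>k m. (cmod (Q (k - m)))\<^sup>2 / (wt k * wt m)"] HS by (simp add: R_def)
  have le: "(cmod (Qop f k))\<^sup>2 / wt k \<le> W f * R k" for k
  proof -
    have row: "(\<lambda>m. (cmod (Q (k - m)))\<^sup>2 / (wt k * wt m)) summable_on UNIV"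
      using summable_on_SigmaD1[where A = UNIV and B = "\<lambda>_. UNIV" and x = k and
        f = "\<lambda>k m. (cmod (Q (k - m)))\<^sup>2 / (wt k * wt m)"] HS by simp
    have 1: "(\<lambda>m. (cmod (Q (k - m)) / sqrt (wt k * wt m))\<^sup>2) summable_on UNIV"
      using row by (simp add: power_divide)
    have 2: "(\<lambda>m. (sqrt (wt m) * cmod (f m))\<^sup>2) summable_on UNIV"
      using X_D[OF f] by (simp add: power_mult_distrib)
    have eq: "\<bar>cmod (Q (k - m)) / sqrt (wt k * wt m) * (sqrt (wt m) * cmod (f m))\<bar> = cmod (Q (k - m) * f m) / sqrt (wt k)" for m
      by (simp add: norm_mult abs_mult real_sqrt_mult)
    have "cmod (Qop f k) \<le> (\<Sum>\<^sub>\<infinity>m. cmod (Q (k - m) * f m))"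
      unfolding Qop_def by (rule norm_infsum_bound[OF row_summable(1)[OF f]])
    then have "cmod (Qop f k) / sqrt (wt k) \<le> (\<Sum>\<^sub>\<infinity>m. cmod (Q (k - m) * f m)) / sqrt (wt k)"
      by (intro divide_right_mono) auto
    also have "\<dots> = (\<Sum>\<^sub>\<infinity>m. cmod (Q (k - m) * f m) / sqrt (wt k))"
      using infsum_cmult_left'[of "\<lambda>m. cmod (Q (k - m) * f m)" "1 / sqrt (wt k)"] by simp
    also have "\<dots> \<le> sqrt (R k) * sqrt (W f)"
      using infsum_Cauchy_Schwarz(2)[OF 1 2] unfolding eq R_def W_def
      by (simp add: power_divide power_mult_distrib)
    finally have "(cmod (Qop f k) / sqrt (wt k))\<^sup>2 \<le> (sqrt (R k) * sqrt (W f))\<^sup>2"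
      by (rule power_mono) simp
    moreover have "0 \<le> R k" unfolding R_def by (rule infsum_nonneg) simp
    ultimately show ?thesis using W_nonneg[of f] by (simp add: power_divide power_mult_distrib mult.commute)
  qed
  show ?thesis
    by (rule summable_on_comparison_test[OF summable_on_cmult_right[OF R] le]) simp
qed

text \<open>\<open>z\<close> lies in the dual space, so its tail is small in the dual norm,
  uniformly in i by Cauchy-Schwarz with the common bound on \<open>W (u i)\<close>; the finitely
  many remaining terms converge one by one.\<close>

lemma weak_limit:
  assumes z: "(\<lambda>k. (cmod (z k))\<^sup>2 / wt k) summable_on UNIV"
    and u: "\<And>i. u i \<in> X" "\<And>i. W (u i) \<le> M" and lim: "\<And>k. (\<lambda>i. u i k) \<longlonglongrightarrow> 0"
  shows "(\<lambda>i::nat. \<Sum>\<^sub>\<infinity>k. z k * cnj (u i k)) \<longlonglongrightarrow> 0"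
proof -
  define f where "f = (\<lambda>i k. cmod (z k * cnj (u i k)))"
  have sub: "(\<lambda>k. (cmod (z k))\<^sup>2 / wt k) summable_on B" "(\<lambda>k. wt k * (cmod (u i k))\<^sup>2) summable_on B" for B i
    by (rule summable_on_subset_banach[OF z] summable_on_subset_banach[OF X_D[OF u(1)]]; simp)+
  have 1: "(\<lambda>k. (cmod (z k) / sqrt (wt k))\<^sup>2) summable_on B"
    and 2: "(\<lambda>k. (sqrt (wt k) * cmod (u i k))\<^sup>2) summable_on B" for B i
    using sub by (simp_all add: power_divide power_mult_distrib)
  have eq: "\<bar>cmod (z k) / sqrt (wt k) * (sqrt (wt k) * cmod (u i k))\<bar> = f i k" for i k
    by (simp add: f_def norm_mult abs_mult)
  have fs: "f i summable_on UNIV" for i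
    using infsum_Cauchy_Schwarz(1)[OF 1[where B = UNIV] 2[where B = UNIV and i = i]] unfolding eq .
  have lim_f: "(\<lambda>i. infsum (f i) UNIV) \<longlonglongrightarrow> 0"
  proof (rule infsum_tendsto_0)
    show "f i summable_on UNIV" for i by (rule fs)
    show "0 \<le> f i k" for i k by (simp add: f_def)
    show "(\<lambda>i. f i k) \<longlonglongrightarrow> 0" for k
    proof -
      have "(\<lambda>i. cmod (z k * cnj (u i k))) \<longlonglongrightarrow> cmod (z k * cnj 0)"
        by (intro tendsto_intros lim)
      then show ?thesis by (simp add: f_def)
    qed
    fix \<epsilon> :: real assume \<epsilon>: "0 < \<epsilon>"
    define M' where "M' = max M 1"
    obtain K where K: "(\<Sum>\<^sub>\<infinity>k\<in>{k. \<bar>k\<bar> > int K}. (cmod (z k))\<^sup>2 / wt k) \<le> \<epsilon>\<^sup>2 / M'"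
      using int_tail_tendsto_0[OF z, of "\<epsilon>\<^sup>2 / M'"] \<epsilon> by (auto simp: M'_def)
    have "infsum (f i) {k. \<bar>k\<bar> > int K} \<le> \<epsilon>" for i
    proof -
      let ?B = "{k. \<bar>k\<bar> > int K}"
      have "infsum (f i) ?B \<le> sqrt (\<Sum>\<^sub>\<infinity>k\<in>?B. (cmod (z k))\<^sup>2 / wt k) * sqrt (\<Sum>\<^sub>\<infinity>k\<in>?B. wt k * (cmod (u i k))\<^sup>2)"
        using infsum_Cauchy_Schwarz(2)[OF 1[where B = ?B] 2[where B = ?B and i = i]] unfolding eq by (simp add: power_divide power_mult_distrib)
      also have "\<dots> \<le> sqrt (\<epsilon>\<^sup>2 / M') * sqrt M'"
      proof (intro mult_mono real_sqrt_le_mono K)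
        have "(\<Sum>\<^sub>\<infinity>k\<in>?B. wt k * (cmod (u i k))\<^sup>2) \<le> W (u i)"
          unfolding W_def by (intro infsum_mono2 sub) auto
        then show "(\<Sum>\<^sub>\<infinity>k\<in>?B. wt k * (cmod (u i k))\<^sup>2) \<le> M'" using u(2)[of i] by (simp add: M'_def)
      qed (auto intro!: infsum_nonneg simp: M'_def)
      also have "\<dots> = \<epsilon>" using \<epsilon> by (simp add: real_sqrt_divide M'_def)
      finally show ?thesis .
    qed
    then show "\<exists>K::nat. \<forall>i. infsum (f i) {k. \<bar>k\<bar> > int K} \<le> \<epsilon>" by blast
  qed
  have le: "norm (\<Sum>\<^sub>\<infinity>k. z k * cnj (u i k)) \<le> infsum (f i) UNIV" for i
    using norm_infsum_bound[OF fs[of i, unfolded f_def]] by (simp add: f_def)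
  show ?thesis
    by (rule Lim_null_comparison[OF always_eventually[OF allI[OF le]] lim_f])
qed

text \<open>Rellich's theorem on the Fourier side: beyond |k| = K the weight is at least K, so the
  tail of the l^2 norm is at most M / K uniformly in i.\<close>

lemma strong_limit:
  assumes u: "\<And>i. u i \<in> X" "\<And>i. W (u i) \<le> M" and lim: "\<And>k. (\<lambda>i. u i k) \<longlonglongrightarrow> 0"
  shows "(\<lambda>i::nat. \<Sum>\<^sub>\<infinity>k. (cmod (u i k))\<^sup>2) \<longlonglongrightarrow> 0"
proof (rule infsum_tendsto_0)
  show "(\<lambda>k. (cmod (u i k))\<^sup>2) summable_on UNIV" for i by (rule sq_norm_summable[OF u(1)])
  show "0 \<le> (cmod (u i k))\<^sup>2" for i k by simp
  show "(\<lambda>i. (cmod (u i k))\<^sup>2) \<longlonglongrightarrow> 0" for k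
    using tendsto_power[OF tendsto_norm[OF lim[of k]], of 2] by simp
  fix \<epsilon> :: real assume \<epsilon>: "0 < \<epsilon>"
  obtain K :: nat where K: "max M 1 / \<epsilon> < real K" using reals_Archimedean2 by blast
  have K1: "1 \<le> real K" proof -
    have "0 < max M 1 / \<epsilon>" using \<epsilon> by simp
    then have "0 < real K" using K by linarith
    then show ?thesis by simp
  qed
  have le: "real K * (cmod (u i k))\<^sup>2 \<le> wt k * (cmod (u i k))\<^sup>2" if "\<bar>k\<bar> > int K" for i k
  proof (rule mult_right_mono)
    have a: "real K \<le> \<bar>real_of_int k\<bar>" using that by linarith
    have "real K * 1 \<le> \<bar>real_of_int k\<bar> * \<bar>real_of_int k\<bar>" using a K1 by (intro mult_mono) auto
    also have "\<dots> = (real_of_int k)\<^sup>2" by (simp add: power2_eq_square)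
    also have "\<dots> \<le> pi\<^sup>2 * (real_of_int k)\<^sup>2"
      using mult_right_mono[of 1 "pi\<^sup>2" "(real_of_int k)\<^sup>2"] pi_gt3 by (simp add: one_le_power)
    finally show "real K \<le> wt k" using c_ge_1 by (simp add: wt_def)
  qed simp
  have "(\<Sum>\<^sub>\<infinity>k\<in>{k. \<bar>k\<bar> > int K}. (cmod (u i k))\<^sup>2) \<le> \<epsilon>" for i
  proof -
    let ?B = "{k. \<bar>k\<bar> > int K}"
    have s: "(\<lambda>k. wt k * (cmod (u i k))\<^sup>2) summable_on ?B" "(\<lambda>k. (cmod (u i k))\<^sup>2) summable_on ?B"
      by (rule summable_on_subset_banach[OF X_D[OF u(1)]] summable_on_subset_banach[OF sq_norm_summable[OF u(1)]]; simp)+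
    have "real K * (\<Sum>\<^sub>\<infinity>k\<in>?B. (cmod (u i k))\<^sup>2) = (\<Sum>\<^sub>\<infinity>k\<in>?B. real K * (cmod (u i k))\<^sup>2)"
      by (simp add: infsum_cmult_right')
    also have "\<dots> \<le> (\<Sum>\<^sub>\<infinity>k\<in>?B. wt k * (cmod (u i k))\<^sup>2)"
      by (intro infsum_mono summable_on_cmult_right s) (use le in auto)
    also have "\<dots> \<le> W (u i)"
      unfolding W_def by (intro infsum_mono2 s X_D u) auto
    also have "\<dots> \<le> max M 1" using u(2)[of i] by simp
    also have "\<dots> \<le> real K * \<epsilon>" using K \<epsilon> by (simp add: field_simps)
    finally show ?thesis using K1 by simp
  qed
  then show "\<exists>K::nat. \<forall>i. (\<Sum>\<^sub>\<infinity>k\<in>{k. \<bar>k\<bar> > int K}. (cmod (u i k))\<^sup>2) \<le> \<epsilon>" by blast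
qed

text \<open>A diagonal subsequence converges at every index, and bounding finite partial sums puts
  the limit in \<open>X\<close>. The differences are bounded in energy and tend to 0 at each index,
  so they tend to 0 strongly in l^2 but in general only weakly in \<open>X\<close>; the second
  conclusion is that weak limit, tested with the dual element belonging to \<open>g\<close>.\<close>

lemma compactness:
  assumes f: "\<And>i::nat. f i \<in> X" "\<And>i. Re (A (f i) (f i)) \<le> M"
  shows "\<exists>g\<in>X. \<exists>r. strict_mono r \<and>
        (\<lambda>i. Re (S (\<lambda>k. f (r i) k - g k) (\<lambda>k. f (r i) k - g k))) \<longlonglongrightarrow> 0 \<and>
        (\<lambda>i. Re (A g (\<lambda>k. f (r i) k - g k))) \<longlonglongrightarrow> 0"
proof -
  have Wf: "W (f i) \<le> 2 * M" for i using A_lower[OF f(1)[of i]] f(2)[of i] by linarith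
  have fb: "norm (f i k) \<le> sqrt (2 * M)" for i k
  proof (rule real_le_rsqrt)
    have "(cmod (f i k))\<^sup>2 \<le> wt k * (cmod (f i k))\<^sup>2"
      using mult_right_mono[OF wt_ge_1, of "(cmod (f i k))\<^sup>2" k] by simp
    also have "\<dots> \<le> W (f i)"
      unfolding W_def using finite_sum_le_infsum[OF X_D[OF f(1)[of i]], of "{k}"] by simp
    finally show "(norm (f i k))\<^sup>2 \<le> 2 * M" using Wf[of i] by linarith
  qed
  obtain r where r: "strict_mono r" and "\<And>k. \<exists>l. (\<lambda>i. f (r i) k) \<longlonglongrightarrow> l"
    by (rule function_convergent_subsequence[of UNIV f "sqrt (2 * M)"]) (use fb in auto)
  then obtain g where g: "\<And>k. (\<lambda>i. f (r i) k) \<longlonglongrightarrow> g k" by metis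
  have fin: "(\<Sum>k\<in>F. wt k * (cmod (g k))\<^sup>2) \<le> 2 * M" if "finite F" for F
  proof (rule LIMSEQ_le_const2)
    show "(\<lambda>i. \<Sum>k\<in>F. wt k * (cmod (f (r i) k))\<^sup>2) \<longlonglongrightarrow> (\<Sum>k\<in>F. wt k * (cmod (g k))\<^sup>2)"
      by (intro tendsto_intros g)
    have "(\<Sum>k\<in>F. wt k * (cmod (f (r i) k))\<^sup>2) \<le> 2 * M" for i
      using finite_sum_le_infsum[OF X_D[OF f(1)[of "r i"]] that] Wf[of "r i"] by (simp add: W_def)
    then show "\<exists>N. \<forall>n\<ge>N. (\<Sum>k\<in>F. wt k * (cmod (f (r n) k))\<^sup>2) \<le> 2 * M" by blast
  qed
  have gX: "g \<in> X" and Wg: "W g \<le> 2 * M"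
    using nonneg_sum_bounded[of UNIV "\<lambda>k. wt k * (cmod (g k))\<^sup>2" "2 * M"] fin
    by (simp_all add: X_def W_def)
  define u where "u = (\<lambda>i k. f (r i) k - g k)"
  have u: "u i \<in> X" for i unfolding u_def by (intro S.diff_mem f gX)
  have Wu: "W (u i) \<le> 8 * M" for i
  proof -
    have "u i = (\<lambda>k. f (r i) k + (-1) * g k)" by (simp add: u_def)
    then have "W (u i) \<le> 2 * W (f (r i)) + 2 * W (\<lambda>k. (-1) * g k)"
      using add_X(2)[OF f(1) scale_X[OF gX, of "-1"], of "r i"] by simp
    also have "W (\<lambda>k. (-1) * g k) = W g" by (simp add: W_def)
    finally show ?thesis using Wf[of "r i"] Wg by linarith
  qed
  have lim: "(\<lambda>i. u i k) \<longlonglongrightarrow> 0" for k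
    using tendsto_diff[OF g[of k] tendsto_const[of "g k"]] by (simp add: u_def)
  have "(\<lambda>i. Re (S (u i) (u i))) \<longlonglongrightarrow> 0"
    using strong_limit[OF u Wu lim] by (simp add: S_diag[OF u])
  moreover have "(\<lambda>i. A g (u i)) \<longlonglongrightarrow> 0"
    unfolding A_def
  proof (rule weak_limit[OF _ u Wu lim])
    have s: "(\<lambda>k. 2 * (wt k * (cmod (g k))\<^sup>2) + 2 * ((cmod (Qop g k))\<^sup>2 / wt k)) summable_on UNIV"
      by (intro summable_on_add summable_on_cmult_right X_D gX Qop_sq_summable)
    show "(\<lambda>k. (cmod (of_real (wt k) * g k + Qop g k))\<^sup>2 / wt k) summable_on UNIV"
    proof (rule summable_on_comparison_test[OF s])
      fix k
      have "wt k * (cmod (of_real (wt k) * g k + Qop g k))\<^sup>2 \<le>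
          2 * (wt k * (cmod (of_real (wt k) * g k))\<^sup>2) + 2 * (wt k * (cmod (Qop g k))\<^sup>2)"
        by (rule wt_norm_add_le)
      then have "wt k * (cmod (of_real (wt k) * g k + Qop g k))\<^sup>2 \<le>
          wt k * (2 * (wt k)\<^sup>2 * (cmod (g k))\<^sup>2 + 2 * (cmod (Qop g k))\<^sup>2)"
        by (simp add: norm_mult power_mult_distrib algebra_simps)
      then have "(cmod (of_real (wt k) * g k + Qop g k))\<^sup>2 \<le> 2 * (wt k)\<^sup>2 * (cmod (g k))\<^sup>2 + 2 * (cmod (Qop g k))\<^sup>2"
        by simp
      then have "(cmod (of_real (wt k) * g k + Qop g k))\<^sup>2 / wt k \<le>
         (2 * (wt k)\<^sup>2 * (cmod (g k))\<^sup>2 + 2 * (cmod (Qop g k))\<^sup>2) / wt k"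
        by (intro divide_right_mono) auto
      also have "\<dots> = 2 * (wt k * (cmod (g k))\<^sup>2) + 2 * ((cmod (Qop g k))\<^sup>2 / wt k)"
        by (simp add: add_divide_distrib power2_eq_square)
      finally show "(cmod (of_real (wt k) * g k + Qop g k))\<^sup>2 / wt k \<le>
         2 * (wt k * (cmod (g k))\<^sup>2) + 2 * ((cmod (Qop g k))\<^sup>2 / wt k)" .
    qed simp
  qed
  then have "(\<lambda>i. Re (A g (u i))) \<longlonglongrightarrow> 0"
    using tendsto_Re[of "\<lambda>i. A g (u i)" 0] by simp
  ultimately show ?thesis using gX r unfolding u_def by (intro bexI[of _ g] exI[of _ r] conjI)
qed

lemma \<delta>_combination:
  assumes "finite I"
  shows "(\<Sum>i\<in>I. t i * \<delta> i k) = (if k \<in> I then t k else 0)"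
proof -
  have "(\<Sum>i\<in>I. t i * \<delta> i k) = (\<Sum>i\<in>I. if i = k then t i else 0)"
    by (intro sum.cong) (auto simp: \<delta>_def)
  then show ?thesis using assms by simp
qed

sublocale spectral_pair X A S
proof
  fix f :: "int \<Rightarrow> complex"
  show "0 \<le> Re (A f f)" if "f \<in> X"
    using A_lower[OF that] W_nonneg[of f] by linarith
  show "0 \<le> Re (S f f)" if "f \<in> X"
    using that by (simp add: S_diag infsum_nonneg)
  show "f = (\<lambda>_. 0)" if f: "f \<in> X" and 0: "S f f = 0"
  proof
    fix k
    have "(\<Sum>\<^sub>\<infinity>k. (cmod (f k))\<^sup>2) = 0" using 0 S_diag[OF f] by simp
    then have "(cmod (f k))\<^sup>2 = 0"
      using nonneg_infsum_le_0D[of "\<lambda>k. (cmod (f k))\<^sup>2" UNIV k] sq_norm_summable[OF f] by simp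
    then show "f k = 0" by simp
  qed
next
  fix f :: "nat \<Rightarrow> int \<Rightarrow> complex" and M
  assume "\<And>i. f i \<in> X" "\<And>i. Re (A (f i) (f i)) \<le> M"
  then show "\<exists>g\<in>X. \<exists>r. strict_mono r \<and>
        (\<lambda>i. Re (S (\<lambda>k. f (r i) k - g k) (\<lambda>k. f (r i) k - g k))) \<longlonglongrightarrow> 0 \<and>
        (\<lambda>i. Re (A g (\<lambda>k. f (r i) k - g k))) \<longlonglongrightarrow> 0"
    by (rule compactness)
next
  fix m :: nat
  have "t i = 0" if "\<forall>k. (\<Sum>i\<in>{..m}. t i * \<delta> (int i) k) = 0" "i \<le> m" for t :: "nat \<Rightarrow> complex" and i
  proof -
    have "(\<Sum>j\<in>{..m}. t j * \<delta> (int j) (int i)) = (\<Sum>j\<in>{..m}. if j = i then t j else 0)"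
      by (intro sum.cong) (auto simp: \<delta>_def)
    then show ?thesis using that by simp
  qed
  then show "\<exists>I (b :: nat \<Rightarrow> int \<Rightarrow> complex). finite I \<and> card I > m \<and> (\<forall>i\<in>I. b i \<in> X) \<and>
        (\<forall>t. (\<forall>k. (\<Sum>i\<in>I. t i * b i k) = 0) \<longrightarrow> (\<forall>i\<in>I. t i = (0::complex)))"
    by (intro exI[of _ "{..m}"] exI[of _ "\<lambda>i. \<delta> (int i)"]) (auto simp: \<delta>_mem)
qed

end

section \<open>Fourier expansion of periodic distributions\<close>

lemma fourier_mode_mult: "fourier_mode T n x * fourier_mode T m x = fourier_mode T (n + m) x"
  by (simp add: fourier_mode_def cis_mult add_divide_distrib distrib_left distrib_right)

lemma fourier_mode_0 [simp]: "fourier_mode T 0 x = 1"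
  by (simp add: fourier_mode_def)

lemma fourier_mode_cnj: "cnj (fourier_mode T n x) = fourier_mode T (- n) x"
  by (simp add: fourier_mode_def cis_cnj)

lemma norm_fourier_mode [simp]: "cmod (fourier_mode T n x) = 1"
  by (simp add: fourier_mode_def)

lemma fourier_mode_nonzero [simp]: "fourier_mode T n x \<noteq> 0"
  by (simp add: fourier_mode_def)

definition mode_freq :: "real \<Rightarrow> int \<Rightarrow> complex" where
  "mode_freq T n = \<i> * of_real (2 * pi * of_int n / T)"

lemma fourier_mode_deriv:
  "(fourier_mode T n has_vector_derivative mode_freq T n * fourier_mode T n x) (at x within S)"
proof -
  have "((\<lambda>z. exp (mode_freq T n * z)) has_field_derivative mode_freq T n * exp (mode_freq T n * of_real x)) (at (of_real x))"
    by (auto intro!: derivative_eq_intros)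
  from has_vector_derivative_real_field[OF this]
  have "((\<lambda>x. exp (mode_freq T n * of_real x)) has_vector_derivative mode_freq T n * exp (mode_freq T n * of_real x)) (at x within S)" .
  moreover have "exp (mode_freq T n * of_real x) = fourier_mode T n x" for x
    by (simp add: fourier_mode_def cis_conv_exp mode_freq_def mult_ac)
  ultimately show ?thesis by (simp add: fun_eq_iff[symmetric])
qed

lemma fourier_mode_continuous [continuous_intros]: "continuous_on S (fourier_mode T n)"
  using fourier_mode_deriv[of T n] by (auto intro!: continuous_at_imp_continuous_on has_vector_derivative_continuous)

lemma fourier_mode_periodic:
  assumes "T \<noteq> 0" shows "fourier_mode T n (x + T) = fourier_mode T n x"
proof -
  have "2 * pi * of_int n * (x + T) / T = 2 * pi * of_int n * x / T + 2 * pi * of_int n"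
    using assms by (simp add: field_simps)
  then show ?thesis
    unfolding fourier_mode_def by (simp add: cis_mult[symmetric])
qed

lemma iter_deriv_0 [simp]: "iter_deriv 0 \<phi> = \<phi>"
  by (simp add: iter_deriv_def)

lemma iter_deriv_Suc: "iter_deriv (Suc k) \<phi> x = vector_derivative (iter_deriv k \<phi>) (at x)"
  by (simp add: iter_deriv_def)

lemma iter_deriv_iter_deriv: "iter_deriv j (iter_deriv k \<phi>) = iter_deriv (j + k) \<phi>"
  by (simp add: iter_deriv_def funpow_add)

lemma iter_deriv_works:
  assumes "\<phi> \<in> test_functions T"
  shows "(iter_deriv k \<phi> has_vector_derivative iter_deriv (Suc k) \<phi> x) (at x)"
  using assms unfolding iter_deriv_Suc test_functions_def by (simp add: vector_derivative_works[symmetric])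

lemma iter_deriv_periodic:
  assumes "\<phi> \<in> test_functions T"
  shows "iter_deriv k \<phi> (x + T) = iter_deriv k \<phi> x"
proof (induction k arbitrary: x)
  case 0
  then show ?case using assms by (simp add: test_functions_def)
next
  case (Suc k)
  have "((\<lambda>y. y + T) has_vector_derivative 1) (at x)"
    by (auto intro!: derivative_eq_intros)
  from vector_diff_chain_at[OF this iter_deriv_works[OF assms, of k "x + T"]]
  have "((\<lambda>y. iter_deriv k \<phi> (y + T)) has_vector_derivative iter_deriv (Suc k) \<phi> (x + T)) (at x)"
    by (simp add: o_def)
  then have "(iter_deriv k \<phi> has_vector_derivative iter_deriv (Suc k) \<phi> (x + T)) (at x)"
    by (simp add: Suc)
  then show ?case using iter_deriv_works[OF assms, of k x] by (rule vector_derivative_unique_at)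
qed

lemma iter_deriv_mem: "\<phi> \<in> test_functions T \<Longrightarrow> iter_deriv k \<phi> \<in> test_functions T"
  using iter_deriv_periodic[of \<phi> T k] by (auto simp: test_functions_def iter_deriv_iter_deriv)

lemma iter_deriv_continuous:
  assumes "\<phi> \<in> test_functions T" shows "continuous_on S (iter_deriv k \<phi>)"
  using iter_deriv_works[OF assms, of k]
  by (auto intro!: continuous_at_imp_continuous_on has_vector_derivative_continuous)

lemma test_continuous: "\<phi> \<in> test_functions T \<Longrightarrow> continuous_on S \<phi>"
  using iter_deriv_continuous[of \<phi> T S 0] by simp

text \<open>Exhibiting the whole tower of derivatives at once proves smoothness and evaluates
  \<open>iter_deriv\<close>; sums, multiples and modes are all treated this way.\<close>

lemma test_function_intro:
  assumes per: "\<And>x. \<phi> (x + T) = \<phi> x"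
    and d0: "\<And>x. d 0 x = \<phi> x"
    and d: "\<And>k x. (d k has_vector_derivative d (Suc k) x) (at x)"
  shows "iter_deriv k \<phi> = d k" and "\<phi> \<in> test_functions T"
proof -
  show *: "iter_deriv k \<phi> = d k" for k
  proof (induction k)
    case 0
    then show ?case using d0 by (simp add: fun_eq_iff)
  next
    case (Suc k)
    show ?case by (rule ext) (unfold iter_deriv_Suc Suc, rule vector_derivative_at[OF d])
  qed
  show "\<phi> \<in> test_functions T"
    using per differentiableI_vector[OF d] unfolding test_functions_def by (simp add: *)
qed

lemma test_add:
  assumes "\<phi> \<in> test_functions T" "\<psi> \<in> test_functions T"
  shows "iter_deriv k (\<lambda>x. \<phi> x + \<psi> x) = (\<lambda>x. iter_deriv k \<phi> x + iter_deriv k \<psi> x)"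
    and "(\<lambda>x. \<phi> x + \<psi> x) \<in> test_functions T"
proof -
  have d: "((\<lambda>x. iter_deriv k \<phi> x + iter_deriv k \<psi> x) has_vector_derivative
      (iter_deriv (Suc k) \<phi> x + iter_deriv (Suc k) \<psi> x)) (at x)" for k x
    by (intro has_vector_derivative_add iter_deriv_works[OF assms(1)] iter_deriv_works[OF assms(2)])
  have p: "\<phi> (x + T) + \<psi> (x + T) = \<phi> x + \<psi> x" for x using assms by (simp add: test_functions_def)
  show "iter_deriv k (\<lambda>x. \<phi> x + \<psi> x) = (\<lambda>x. iter_deriv k \<phi> x + iter_deriv k \<psi> x)"
    and "(\<lambda>x. \<phi> x + \<psi> x) \<in> test_functions T"
    using test_function_intro[of "\<lambda>x. \<phi> x + \<psi> x" T "\<lambda>k x. iter_deriv k \<phi> x + iter_deriv k \<psi> x", OF p _ d]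
    by simp_all
qed

lemma test_scale:
  assumes "\<phi> \<in> test_functions T"
  shows "iter_deriv k (\<lambda>x. c * \<phi> x) = (\<lambda>x. c * iter_deriv k \<phi> x)"
    and "(\<lambda>x. c * \<phi> x) \<in> test_functions T"
proof -
  have d: "((\<lambda>x. c * iter_deriv k \<phi> x) has_vector_derivative (c * iter_deriv (Suc k) \<phi> x)) (at x)" for k x
    by (intro has_vector_derivative_mult_right iter_deriv_works[OF assms(1)])
  have p: "c * \<phi> (x + T) = c * \<phi> x" for x using assms by (simp add: test_functions_def)
  show "iter_deriv k (\<lambda>x. c * \<phi> x) = (\<lambda>x. c * iter_deriv k \<phi> x)"
    and "(\<lambda>x. c * \<phi> x) \<in> test_functions T"
    using test_function_intro[of "\<lambda>x. c * \<phi> x" T "\<lambda>k x. c * iter_deriv k \<phi> x", OF p _ d]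
    by simp_all
qed

lemma test_mode:
  assumes "T \<noteq> 0"
  shows "iter_deriv k (fourier_mode T n) = (\<lambda>x. mode_freq T n ^ k * fourier_mode T n x)"
    and "fourier_mode T n \<in> test_functions T"
proof -
  have d: "((\<lambda>x. mode_freq T n ^ k * fourier_mode T n x) has_vector_derivative
      (mode_freq T n ^ Suc k * fourier_mode T n x)) (at x)" for k x
    using has_vector_derivative_mult_right[OF fourier_mode_deriv[of T n x UNIV], of "mode_freq T n ^ k"]
    by (simp add: mult_ac)
  show "iter_deriv k (fourier_mode T n) = (\<lambda>x. mode_freq T n ^ k * fourier_mode T n x)"
    and "fourier_mode T n \<in> test_functions T"
    using test_function_intro[of "fourier_mode T n" T "\<lambda>k x. mode_freq T n ^ k * fourier_mode T n x",
        OF fourier_mode_periodic[OF assms] _ d] by simp_all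
qed

lemma test_zero: "(\<lambda>_. 0) \<in> test_functions T" "iter_deriv k (\<lambda>_. 0) = (\<lambda>_. 0)"
  using test_function_intro[of "\<lambda>_. 0" T "\<lambda>_ _. 0"] by auto

lemma test_sum:
  assumes "finite F" "\<And>n. n \<in> F \<Longrightarrow> \<phi> n \<in> test_functions T"
  shows "(\<lambda>x. \<Sum>n\<in>F. c n * \<phi> n x) \<in> test_functions T \<and>
    iter_deriv k (\<lambda>x. \<Sum>n\<in>F. c n * \<phi> n x) = (\<lambda>x. \<Sum>n\<in>F. c n * iter_deriv k (\<phi> n) x)"
  using assms
proof (induction F rule: finite_induct)
  case (insert n F)
  then have IH: "(\<lambda>x. \<Sum>n\<in>F. c n * \<phi> n x) \<in> test_functions T"
    "iter_deriv k (\<lambda>x. \<Sum>n\<in>F. c n * \<phi> n x) = (\<lambda>x. \<Sum>n\<in>F. c n * iter_deriv k (\<phi> n) x)" by auto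
  have n: "\<phi> n \<in> test_functions T" using insert by simp
  show ?case
    using insert.hyps test_add(1)[OF test_scale(2)[OF n, of "c n"] IH(1), of k]
      test_add(2)[OF test_scale(2)[OF n, of "c n"] IH(1)] IH(2) test_scale(1)[OF n, of k "c n"]
    by simp
qed (simp add: test_zero)

text \<open>Bilinear pairing with the n-th mode, hence T times the Fourier coefficient of
  \<open>\<phi>\<close> at -n. The sign is the one with which a series of modes acts on a test
  function.\<close>

definition pairing :: "real \<Rightarrow> (real \<Rightarrow> complex) \<Rightarrow> int \<Rightarrow> complex" where
  "pairing T \<phi> n = integral {0..T} (\<lambda>x. fourier_mode T n x * \<phi> x)"

lemma mode_mult_integrable:
  "continuous_on {0..T} \<phi> \<Longrightarrow> (\<lambda>x. fourier_mode T n x * \<phi> x) integrable_on {0..T}"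
  by (intro integrable_continuous_real continuous_intros)

lemma pairing_mode:
  assumes "0 < T"
  shows "integral {0..T} (fourier_mode T n) = (if n = 0 then of_real T else 0)"
proof (cases "n = 0")
  case True
  then have "fourier_mode T n = (\<lambda>_. 1)" by (simp add: fun_eq_iff)
  then show ?thesis using assms True by (simp add: scaleR_conv_of_real)
next
  case False
  then have f: "mode_freq T n \<noteq> 0" using assms by (simp add: mode_freq_def)
  have "((\<lambda>x. fourier_mode T n x / mode_freq T n) has_vector_derivative fourier_mode T n x) (at x within {0..T})" for x
    using has_vector_derivative_divide[OF fourier_mode_deriv[of T n x "{0..T}"], of "mode_freq T n"] f by simp
  then have "(fourier_mode T n has_integral (fourier_mode T n T / mode_freq T n - fourier_mode T n 0 / mode_freq T n)) {0..T}"
    using assms by (intro fundamental_theorem_of_calculus) auto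
  then have "integral {0..T} (fourier_mode T n) = fourier_mode T n T / mode_freq T n - fourier_mode T n 0 / mode_freq T n"
    by (rule integral_unique)
  also have "\<dots> = 0" using fourier_mode_periodic[of T n 0] assms by simp
  finally show ?thesis using False by simp
qed

lemma pairing_bound:
  assumes "0 < T" "continuous_on {0..T} \<phi>" "\<And>x. x \<in> {0..T} \<Longrightarrow> cmod (\<phi> x) \<le> B"
  shows "cmod (pairing T \<phi> n) \<le> B * T"
  unfolding pairing_def using assms
  by (intro order_trans[OF integral_bound[where B = B]])
    (auto intro!: continuous_intros simp: norm_mult)

text \<open>Integration by parts; the boundary terms cancel by periodicity.\<close>

lemma pairing_deriv:
  assumes T: "0 < T" and \<phi>: "\<phi> \<in> test_functions T"
  shows "pairing T (iter_deriv (Suc k) \<phi>) n = - mode_freq T n * pairing T (iter_deriv k \<phi>) n"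
proof -
  define \<psi> where "\<psi> = iter_deriv k \<phi>"
  define \<psi>' where "\<psi>' = iter_deriv (Suc k) \<phi>"
  have d: "(\<psi> has_vector_derivative \<psi>' x) (at x within S)" for x S
    unfolding \<psi>_def \<psi>'_def using iter_deriv_works[OF \<phi>] by (rule has_vector_derivative_at_within)
  have "((\<lambda>x. fourier_mode T n x * \<psi> x) has_vector_derivative
      (fourier_mode T n x * \<psi>' x + mode_freq T n * (fourier_mode T n x * \<psi> x))) (at x within {0..T})" for x
    using has_vector_derivative_mult[OF fourier_mode_deriv d, of T n x "{0..T}"] by (simp add: mult.assoc)
  then have "((\<lambda>x. fourier_mode T n x * \<psi>' x + mode_freq T n * (fourier_mode T n x * \<psi> x)) has_integral
      (fourier_mode T n T * \<psi> T - fourier_mode T n 0 * \<psi> 0)) {0..T}"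
    using T by (intro fundamental_theorem_of_calculus) auto
  moreover have "fourier_mode T n T * \<psi> T - fourier_mode T n 0 * \<psi> 0 = 0"
    using fourier_mode_periodic[of T n 0] iter_deriv_periodic[OF \<phi>, of k 0] T by (simp add: \<psi>_def)
  ultimately have "integral {0..T} (\<lambda>x. fourier_mode T n x * \<psi>' x + mode_freq T n * (fourier_mode T n x * \<psi> x)) = 0"
    using integral_unique by metis
  moreover have "integral {0..T} (\<lambda>x. fourier_mode T n x * \<psi>' x + mode_freq T n * (fourier_mode T n x * \<psi> x))
      = pairing T \<psi>' n + mode_freq T n * pairing T \<psi> n"
    unfolding pairing_def
    by (subst integral_add)
      (auto intro!: integrable_continuous_real continuous_intros iter_deriv_continuous[OF \<phi>] simp: \<psi>_def \<psi>'_def)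
  ultimately show ?thesis by (simp add: \<psi>_def \<psi>'_def eq_neg_iff_add_eq_0)
qed

lemma pairing_iter_deriv:
  assumes T: "0 < T" and \<phi>: "\<phi> \<in> test_functions T"
  shows "pairing T (iter_deriv k \<phi>) n = (- mode_freq T n) ^ k * pairing T \<phi> n"
  by (induction k) (simp_all add: pairing_deriv[OF T \<phi>])

lemma iter_deriv_bounded:
  assumes "\<phi> \<in> test_functions T"
  obtains B where "0 \<le> B" "\<And>x. x \<in> {0..T} \<Longrightarrow> cmod (iter_deriv k \<phi> x) \<le> B"
proof -
  have "compact (iter_deriv k \<phi> ` {0..T})"
    by (intro compact_continuous_image iter_deriv_continuous[OF assms]) auto
  then have "bounded (iter_deriv k \<phi> ` {0..T})" by (rule compact_imp_bounded)
  then obtain B where "\<forall>x\<in>{0..T}. cmod (iter_deriv k \<phi> x) \<le> B"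
    unfolding bounded_iff by auto
  then show ?thesis using that[of "max B 0"] by fastforce
qed

lemma pairing_decay:
  assumes T: "0 < T" and \<phi>: "\<phi> \<in> test_functions T"
  obtains C where "0 \<le> C" "\<And>n. \<bar>real_of_int n\<bar> ^ k * cmod (pairing T \<phi> n) \<le> C"
proof -
  obtain B where B: "0 \<le> B" "\<And>x. x \<in> {0..T} \<Longrightarrow> cmod (iter_deriv k \<phi> x) \<le> B"
    using iter_deriv_bounded[OF \<phi>] by blast
  have "\<bar>real_of_int n\<bar> ^ k * cmod (pairing T \<phi> n) \<le> B * T / (2 * pi / T) ^ k" for n
  proof -
    have "cmod (mode_freq T n) = 2 * pi / T * \<bar>real_of_int n\<bar>"
      unfolding mode_freq_def norm_mult norm_ii norm_of_real using T by (simp add: abs_mult)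
    then have "(2 * pi / T * \<bar>real_of_int n\<bar>) ^ k * cmod (pairing T \<phi> n) = cmod (pairing T (iter_deriv k \<phi>) n)"
      by (simp add: pairing_iter_deriv[OF T \<phi>] norm_mult norm_power)
    also have "\<dots> \<le> B * T" by (intro pairing_bound T iter_deriv_continuous[OF \<phi>] B)
    finally show ?thesis using T by (simp add: field_simps power_mult_distrib)
  qed
  then show ?thesis using that[of "B * T / (2 * pi / T) ^ k"] B T by simp
qed

lemma pairing_summable:
  assumes T: "0 < T" and \<phi>: "\<phi> \<in> test_functions T"
  shows "(\<lambda>n. \<bar>real_of_int n\<bar> ^ k * cmod (pairing T \<phi> n)) summable_on UNIV"
proof -
  \<comment> \<open>Two powers more than requested leave a decay of order n^-2, which the 3/2 series
    dominates away from 0.\<close>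
  obtain C where C: "0 \<le> C" "\<And>n. \<bar>real_of_int n\<bar> ^ (k + 2) * cmod (pairing T \<phi> n) \<le> C"
    using pairing_decay[OF T \<phi>] by blast
  define t where "t = (\<lambda>n::int. (if n = 0 then \<bar>real_of_int n\<bar> ^ k * cmod (pairing T \<phi> n) else 0) + C * \<bar>real_of_int n\<bar> powr (-3/2))"
  have t1: "(\<lambda>n::int. if n = 0 then \<bar>real_of_int n\<bar> ^ k * cmod (pairing T \<phi> n) else 0) summable_on UNIV"
    by (rule finite_nonzero_values_imp_summable_on) (auto intro: finite_subset[of _ "{0}"])
  have "t summable_on UNIV"
    unfolding t_def by (intro summable_on_add t1 summable_on_cmult_right zeta32_summable)
  then show ?thesis
  proof (rule summable_on_comparison_test)
    fix n :: int
    show "\<bar>real_of_int n\<bar> ^ k * cmod (pairing T \<phi> n) \<le> t n"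
    proof (cases "n = 0")
      case False
      define x where "x = \<bar>real_of_int n\<bar>"
      have x: "1 \<le> x" unfolding x_def using False by linarith
      have "x ^ k * cmod (pairing T \<phi> n) \<le> C / x\<^sup>2"
        using C(2)[of n] x unfolding x_def[symmetric] by (simp add: power_add power2_eq_square field_simps)
      also have "\<dots> = C * x powr (-2)" using x by (simp add: powr_minus_divide)
      also have "\<dots> \<le> C * x powr (-3/2)" using x C by (intro mult_left_mono powr_mono) auto
      finally show ?thesis using False by (simp add: t_def x_def)
    qed (auto simp: t_def)
  qed simp
qed

text \<open>Integrates |h - s|^2 \<ge> 0 for a finite Fourier sum \<open>s\<close> of
  \<open>h\<close>; by orthogonality the integral is that of |h|^2 minus T times the sum of |a n|^2.
  Continuity is the right generality, since the function it is applied to is a quotient extended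
  across the zeros of its denominator.\<close>

lemma Bessel:
  assumes T: "0 < T" and h: "continuous_on {0..T} h"
  shows "(\<lambda>n. (cmod (pairing T h n))\<^sup>2) summable_on UNIV"
proof -
  define H where "H = integral {0..T} (\<lambda>x. h x * cnj (h x))"
  have "(\<Sum>n\<in>F. (cmod (pairing T h n))\<^sup>2) \<le> T * Re H" if F: "finite F" for F :: "int set"
  proof -
    define a where "a = (\<lambda>n. pairing T h n / of_real T)"
    define s where "s = (\<lambda>x. \<Sum>n\<in>F. a n * fourier_mode T (- n) x)"
    define Z where "Z = (\<Sum>n\<in>F. a n * cnj (a n))"
    have P: "((\<lambda>x. fourier_mode T n x * h x) has_integral of_real T * a n) {0..T}" for n
      using mode_mult_integrable[OF h, of n] T by (simp add: a_def pairing_def has_integral_integral)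
    have P': "((\<lambda>x. fourier_mode T (- n) x * cnj (h x)) has_integral of_real T * cnj (a n)) {0..T}" for n
      using has_integral_cnj[THEN iffD2, OF P[of n]] by (simp add: o_def fourier_mode_cnj)
    have E: "(fourier_mode T (n - m) has_integral (if n = m then of_real T else 0)) {0..T}" for n m
      using pairing_mode[OF T, of "n - m"]
        integrable_integral[OF integrable_continuous_real[OF fourier_mode_continuous[of "{0..T}" T "n - m"]]]
      by (simp split: if_splits)
    have H: "((\<lambda>x. h x * cnj (h x)) has_integral H) {0..T}"
      unfolding H_def by (intro integrable_integral integrable_continuous_real continuous_intros h)
    have "((\<lambda>x. h x * cnj (h x) - (\<Sum>n\<in>F. cnj (a n) * (fourier_mode T n x * h x))
        - (\<Sum>n\<in>F. a n * (fourier_mode T (- n) x * cnj (h x)))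
        + (\<Sum>n\<in>F. \<Sum>m\<in>F. (a m * cnj (a n)) * fourier_mode T (n - m) x)) has_integral
        (H - (\<Sum>n\<in>F. cnj (a n) * (of_real T * a n)) - (\<Sum>n\<in>F. a n * (of_real T * cnj (a n)))
        + (\<Sum>n\<in>F. \<Sum>m\<in>F. (a m * cnj (a n)) * (if n = m then of_real T else 0)))) {0..T}"
      by (intro has_integral_add has_integral_diff has_integral_sum has_integral_mult_right F H P P' E)
    moreover have "(\<Sum>n\<in>F. \<Sum>m\<in>F. (a m * cnj (a n)) * (if n = m then of_real T else 0)) = of_real T * Z"
      unfolding Z_def sum_distrib_left
    proof (rule sum.cong[OF refl])
      fix n assume "n \<in> F"
      have "(\<Sum>m\<in>F. (a m * cnj (a n)) * (if n = m then of_real T else 0)) =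
          (\<Sum>m\<in>F. if m = n then a m * cnj (a n) * of_real T else 0)"
        by (intro sum.cong) auto
      then show "(\<Sum>m\<in>F. (a m * cnj (a n)) * (if n = m then of_real T else 0)) = of_real T * (a n * cnj (a n))"
        using F \<open>n \<in> F\<close> by simp
    qed
    moreover have "(\<Sum>n\<in>F. cnj (a n) * (of_real T * a n)) = of_real T * Z"
      "(\<Sum>n\<in>F. a n * (of_real T * cnj (a n))) = of_real T * Z"
      unfolding Z_def sum_distrib_left by (simp_all add: mult_ac)
    moreover have "(\<lambda>x. h x * cnj (h x) - (\<Sum>n\<in>F. cnj (a n) * (fourier_mode T n x * h x))
        - (\<Sum>n\<in>F. a n * (fourier_mode T (- n) x * cnj (h x)))
        + (\<Sum>n\<in>F. \<Sum>m\<in>F. (a m * cnj (a n)) * fourier_mode T (n - m) x)) = (\<lambda>x. (h x - s x) * cnj (h x - s x))"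
    proof
      fix x
      have cs: "cnj (s x) = (\<Sum>n\<in>F. cnj (a n) * fourier_mode T n x)"
        by (simp add: s_def fourier_mode_cnj)
      have "(\<Sum>n\<in>F. \<Sum>m\<in>F. (a m * cnj (a n)) * fourier_mode T (n - m) x) = cnj (s x) * s x"
      proof -
        have "cnj (s x) * s x = (\<Sum>n\<in>F. \<Sum>m\<in>F. (cnj (a n) * fourier_mode T n x) * (a m * fourier_mode T (- m) x))"
          unfolding cs by (simp add: s_def sum_product)
        also have "\<dots> = (\<Sum>n\<in>F. \<Sum>m\<in>F. (a m * cnj (a n)) * fourier_mode T (n - m) x)"
        proof (intro sum.cong refl)
          fix n m
          have "fourier_mode T (n - m) x = fourier_mode T n x * fourier_mode T (- m) x"
            by (simp add: fourier_mode_mult)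
          then show "(cnj (a n) * fourier_mode T n x) * (a m * fourier_mode T (- m) x) =
              (a m * cnj (a n)) * fourier_mode T (n - m) x" by (simp only: mult_ac)
        qed
        finally show ?thesis by simp
      qed
      moreover have "(\<Sum>n\<in>F. cnj (a n) * (fourier_mode T n x * h x)) = cnj (s x) * h x"
        "(\<Sum>n\<in>F. a n * (fourier_mode T (- n) x * cnj (h x))) = s x * cnj (h x)"
        unfolding cs by (simp_all add: s_def sum_distrib_right mult.assoc)
      ultimately show "h x * cnj (h x) - (\<Sum>n\<in>F. cnj (a n) * (fourier_mode T n x * h x))
        - (\<Sum>n\<in>F. a n * (fourier_mode T (- n) x * cnj (h x)))
        + (\<Sum>n\<in>F. \<Sum>m\<in>F. (a m * cnj (a n)) * fourier_mode T (n - m) x) = (h x - s x) * cnj (h x - s x)"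
        by (simp add: algebra_simps)
    qed
    ultimately have "((\<lambda>x. (h x - s x) * cnj (h x - s x)) has_integral (H - of_real T * Z)) {0..T}"
      by (simp add: mult.commute[of Z])
    from has_integral_linear[OF this bounded_linear_Re]
    have I: "((\<lambda>x. Re ((h x - s x) * cnj (h x - s x))) has_integral Re (H - of_real T * Z)) {0..T}"
      by (simp add: o_def)
    have "0 \<le> Re (H - of_real T * Z)"
      by (rule has_integral_nonneg[OF I]) (simp only: complex_norm_square[symmetric] Re_complex_of_real zero_le_power2)
    moreover have "Re Z = (\<Sum>n\<in>F. (cmod (pairing T h n))\<^sup>2) / T\<^sup>2"
      using T by (simp add: Z_def complex_norm_square[symmetric] a_def norm_divide power_divide sum_divide_distrib power2_eq_square[of T] del: of_real_power)
    ultimately show ?thesis using T by (simp add: field_simps power2_eq_square)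
  qed
  then show ?thesis
    using nonneg_sum_bounded(1)[of UNIV "\<lambda>n. (cmod (pairing T h n))\<^sup>2" "T * Re H"] by simp
qed

lemma Riemann_Lebesgue:
  assumes T: "0 < T" and h: "continuous_on {0..T} h" and inj: "inj (f :: nat \<Rightarrow> int)"
  shows "(\<lambda>K. pairing T h (f K)) \<longlonglongrightarrow> 0"
proof -
  have "(\<lambda>n. (cmod (pairing T h n))\<^sup>2) summable_on range f"
    by (rule summable_on_subset_banach[OF Bessel[OF T h]]) simp
  then have "(\<lambda>K. (cmod (pairing T h (f K)))\<^sup>2) summable_on UNIV"
    by (subst (asm) summable_on_reindex) (auto simp: inj o_def)
  then have "(\<lambda>K. (cmod (pairing T h (f K)))\<^sup>2) \<longlonglongrightarrow> 0"
    by (intro summable_LIMSEQ_zero summable_on_imp_summable)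
  then have "(\<lambda>K. sqrt ((cmod (pairing T h (f K)))\<^sup>2)) \<longlonglongrightarrow> sqrt 0"
    by (rule tendsto_real_sqrt)
  then show ?thesis by (simp add: tendsto_norm_zero_iff)
qed

text \<open>Puts the derivative into quotient form, so that a quotient of two functions with a
  common zero tends to the quotient of their derivatives.\<close>

lemma vector_derivative_quotient:
  fixes f :: "real \<Rightarrow> complex"
  assumes "(f has_vector_derivative D) (at x)"
  shows "((\<lambda>y. (f y - f x) / of_real (y - x)) \<longlongrightarrow> D) (at x)"
proof -
  have "((\<lambda>y. norm ((f y - f x) - (y - x) *\<^sub>R D) / norm (y - x)) \<longlongrightarrow> 0) (at x)"
    using assms unfolding has_vector_derivative_def has_derivative_iff_norm by simp
  moreover have "\<forall>\<^sub>F y in at x. norm ((f y - f x) - (y - x) *\<^sub>R D) / norm (y - x) =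
      norm ((f y - f x) / of_real (y - x) - D)"
  proof (rule eventually_at_topological[THEN iffD2], intro exI[of _ UNIV] conjI ballI impI)
    fix y :: real assume "y \<noteq> x"
    then have "(f y - f x) / of_real (y - x) - D = ((f y - f x) - (y - x) *\<^sub>R D) / of_real (y - x)"
      by (simp add: divide_simps scaleR_conv_of_real mult.commute)
    then show "norm ((f y - f x) - (y - x) *\<^sub>R D) / norm (y - x) = norm ((f y - f x) / of_real (y - x) - D)"
      by (simp only: norm_divide norm_of_real real_norm_def)
  qed auto
  ultimately have "((\<lambda>y. norm ((f y - f x) / of_real (y - x) - D)) \<longlongrightarrow> 0) (at x)"
    using tendsto_cong by fastforce
  then show ?thesis by (simp add: tendsto_norm_zero_iff LIM_zero_iff)
qed

lemma periodic_int_shift: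
  fixes f :: "real \<Rightarrow> 'a"
  assumes "\<And>x. f (x + T) = f x"
  shows "f (x + of_int k * T) = f x"
proof -
  have nat: "f (x + real n * T) = f x" for n x
  proof (induction n)
    case (Suc n)
    have "f (x + real (Suc n) * T) = f ((x + real n * T) + T)" by (simp add: algebra_simps)
    then show ?case using assms Suc by simp
  qed simp
  show ?thesis
  proof (cases "k \<ge> 0")
    case True
    then show ?thesis using nat[of x "nat k"] by simp
  next
    case False
    then show ?thesis using nat[of "x + of_int k * T" "nat (- k)"] by simp
  qed
qed

lemma fourier_mode_1_eq:
  assumes T: "0 < T" and eq: "fourier_mode T 1 x = fourier_mode T 1 y"
  obtains k :: int where "x = y + of_int k * T"
proof -
  have "cis (2 * pi * x / T - 2 * pi * y / T) = 1"
    using eq by (simp add: fourier_mode_def cis_divide[symmetric])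
  then have "cos (2 * pi * x / T - 2 * pi * y / T) = 1" by (metis cis.simps(1) one_complex.simps(1))
  then obtain k :: int where "2 * pi * x / T - 2 * pi * y / T = of_int k * 2 * pi"
    unfolding cos_one_2pi_int by blast
  then have "2 * pi * (x - y) = 2 * pi * (of_int k * T)" using T by (simp add: field_simps)
  then have "x - y = of_int k * T" by (simp only: mult_cancel_left) simp
  then show ?thesis using that[of k] by simp
qed

text \<open>Chernoff's argument: dividing \<open>\<phi> - \<phi>(x\<^sub>0)\<close> by \<open>e\<^sub>1 / e\<^sub>1(x\<^sub>0) - 1\<close> turns the partial
  sums into a telescoping sum of Fourier coefficients of a continuous function.\<close>

lemma Fourier_inversion:
  assumes T: "0 < T" and \<phi>: "\<phi> \<in> test_functions T"
  shows "(\<lambda>K. \<Sum>n\<in>{- int K..int K}. pairing T \<phi> (- n) / of_real T * fourier_mode T n x0) \<longlonglongrightarrow> \<phi> x0"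
proof -
  define z where "z = fourier_mode T 1 x0"
  define E where "E = (\<lambda>x. fourier_mode T 1 x / z - 1)"
  \<comment> \<open>The value that makes \<open>h\<close> continuous at the zeros of
    \<open>E\<close>: by periodicity the numerator vanishes there with derivative \<phi>'(x0), and E
    has derivative \<open>mode_freq T 1\<close> since e_1/z equals 1 at such points.\<close>
  define L where "L = iter_deriv 1 \<phi> x0 / mode_freq T 1"
  define h where "h = (\<lambda>x. if E x = 0 then L else (\<phi> x - \<phi> x0) / E x)"
  have z: "z \<noteq> 0" by (simp add: z_def)
  have w: "mode_freq T 1 \<noteq> 0" using T by (simp add: mode_freq_def)
  have per: "\<phi> (x + T) = \<phi> x" for x using iter_deriv_periodic[OF \<phi>, of 0] by simp
  have E0: "\<phi> x = \<phi> x0 \<and> iter_deriv 1 \<phi> x = iter_deriv 1 \<phi> x0" if "E x = 0" for x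
  proof -
    have "fourier_mode T 1 x = fourier_mode T 1 x0" using that z by (simp add: E_def z_def)
    then obtain k :: int where "x = x0 + of_int k * T" using fourier_mode_1_eq[OF T] by blast
    then show ?thesis
      using periodic_int_shift[of \<phi> T x0 k] periodic_int_shift[of "iter_deriv 1 \<phi>" T x0 k]
        iter_deriv_periodic[OF \<phi>] per by simp
  qed
  have Ed: "(E has_vector_derivative mode_freq T 1 * fourier_mode T 1 x / z) (at x)" for x
    unfolding E_def
    using has_vector_derivative_divide[OF fourier_mode_deriv[of T 1 x UNIV], of z]
    by (simp add: has_vector_derivative_diff_const)
  have Ec: "isCont E x" for x using Ed by (rule has_vector_derivative_continuous)
  have \<phi>d: "(\<phi> has_vector_derivative iter_deriv 1 \<phi> x) (at x)" for x
    using iter_deriv_works[OF \<phi>, of 0 x] by simp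
  have "isCont h x" for x
  proof (cases "E x = 0")
    case False
    then have ev: "\<forall>\<^sub>F y in nhds x. E y \<noteq> 0"
      using Ec[of x] by (simp add: isCont_def t1_space_nhds eventually_nhds_conv_at)
        (metis False Ec continuous_at tendsto_imp_eventually_ne)
    have "isCont (\<lambda>y. (\<phi> y - \<phi> x0) / E y) x"
      by (intro continuous_intros has_vector_derivative_continuous[OF \<phi>d] Ec False)
    moreover have "\<forall>\<^sub>F y in nhds x. h y = (\<phi> y - \<phi> x0) / E y"
      using ev by eventually_elim (simp add: h_def)
    ultimately show ?thesis using isCont_cong[of h "\<lambda>y. (\<phi> y - \<phi> x0) / E y" x] by simp
  next
    case True
    have e1: "fourier_mode T 1 x / z = 1" using True by (simp add: E_def)
    have "((\<lambda>y. ((\<phi> y - \<phi> x) / of_real (y - x)) / ((E y - E x) / of_real (y - x))) \<longlongrightarrow>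
       iter_deriv 1 \<phi> x / (mode_freq T 1 * fourier_mode T 1 x / z)) (at x)"
      by (intro tendsto_divide vector_derivative_quotient \<phi>d Ed) (use w z in simp)
    moreover have "iter_deriv 1 \<phi> x / (mode_freq T 1 * fourier_mode T 1 x / z) = L"
      using e1 E0[OF True] by (metis L_def mult.right_neutral times_divide_eq_right)
    moreover have ev: "\<forall>\<^sub>F y in at x. E y \<noteq> 0"
    proof -
      have "((\<lambda>y. (E y - E x) / of_real (y - x)) \<longlongrightarrow> mode_freq T 1 * fourier_mode T 1 x / z) (at x)"
        by (rule vector_derivative_quotient[OF Ed])
      then have "\<forall>\<^sub>F y in at x. (E y - E x) / of_real (y - x) \<noteq> 0"
        by (rule tendsto_imp_eventually_ne) (use w z in simp)
      then show ?thesis by eventually_elim (use True in auto)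
    qed
    then have "\<forall>\<^sub>F y in at x. ((\<phi> y - \<phi> x) / of_real (y - x)) / ((E y - E x) / of_real (y - x)) = h y"
    proof -
      have "\<forall>\<^sub>F y in at x. y \<noteq> x" by (rule eventually_neq_at_within)
      with ev show ?thesis
        by eventually_elim (use True E0[OF True] in \<open>simp add: h_def\<close>)
    qed
    ultimately have "(h \<longlongrightarrow> L) (at x)" using tendsto_cong by fastforce
    then show ?thesis using True by (simp add: isCont_def h_def)
  qed
  then have hc: "continuous_on {0..T} h" by (simp add: continuous_at_imp_continuous_on)
  have factor: "\<phi> x - \<phi> x0 = (fourier_mode T 1 x / z - 1) * h x" for x
  proof -
    have "fourier_mode T 1 x / z - 1 = E x" by (simp add: E_def)
    then show ?thesis using E0[of x] by (cases "E x = 0") (simp_all add: h_def)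
  qed
  define p where "p = (\<lambda>n. pairing T h (- n) * fourier_mode T n x0)"
  \<comment> \<open>Multiplication of \<open>h\<close> by e_1/z shifts its coefficients by one, so
    the n-th term is a difference of neighbours; the constant \<phi>(x0) contributes at n = 0
    only.\<close>
  have coeff: "pairing T \<phi> (- n) * fourier_mode T n x0 =
      (if n = 0 then of_real T * \<phi> x0 else 0) + (p (n - 1) - p n)" for n
  proof -
    have "fourier_mode T (- n) x * \<phi> x =
       \<phi> x0 * fourier_mode T (- n) x + (1 / z * (fourier_mode T (- (n - 1)) x * h x) - fourier_mode T (- n) x * h x)" for x
    proof -
      have 1: "fourier_mode T (- (n - 1)) x = fourier_mode T (- n) x * fourier_mode T 1 x"
        by (simp add: fourier_mode_mult)
      have 2: "\<phi> x = \<phi> x0 + (fourier_mode T 1 x / z - 1) * h x"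
        using factor[of x] by (simp only: diff_eq_eq add.commute)
      show ?thesis unfolding 1 2 by (simp add: algebra_simps)
    qed
    moreover have "((\<lambda>x. \<phi> x0 * fourier_mode T (- n) x + (1 / z * (fourier_mode T (- (n - 1)) x * h x) - fourier_mode T (- n) x * h x))
       has_integral (\<phi> x0 * (if n = 0 then of_real T else 0) + (1 / z * pairing T h (- (n - 1)) - pairing T h (- n)))) {0..T}"
    proof (intro has_integral_add has_integral_diff has_integral_mult_right)
      show "(fourier_mode T (- n) has_integral (if n = 0 then of_real T else 0)) {0..T}"
        using pairing_mode[OF T, of "- n"]
          integrable_integral[OF integrable_continuous_real[OF fourier_mode_continuous[of "{0..T}" T "- n"]]]
        by (simp split: if_splits)
    qed (simp_all only: pairing_def integrable_integral mode_mult_integrable[OF hc])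
    ultimately have pc: "pairing T \<phi> (- n) = \<phi> x0 * (if n = 0 then of_real T else 0) + (1 / z * pairing T h (- (n - 1)) - pairing T h (- n))"
      unfolding pairing_def[of T \<phi>] by (simp add: integral_unique)
    have en: "fourier_mode T (n - 1) x0 = fourier_mode T n x0 / z"
      using fourier_mode_mult[of T "n - 1" x0 1] z by (simp add: z_def field_simps)
    show ?thesis
      unfolding p_def en pc by (cases "n = 0") (simp_all add: algebra_simps)
  qed
  have tele: "(\<Sum>n\<in>{- int K..int K}. pairing T \<phi> (- n) / of_real T * fourier_mode T n x0) =
      \<phi> x0 + (p (- 1 - int K) - p (int K)) / of_real T" for K
  proof -
    have "(\<Sum>n\<in>{- int K..int K}. p (n - 1) - p n) = p (- 1 - int K) - p (int K)"
    proof (induction K)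
      case (Suc K)
      have "{- int (Suc K)..int (Suc K)} = insert (- int (Suc K)) (insert (int (Suc K)) {- int K..int K})" by auto
      then show ?case using Suc by simp
    qed simp
    moreover have "(\<Sum>n\<in>{- int K..int K}. if n = 0 then of_real T * \<phi> x0 else 0) = of_real T * \<phi> x0"
      by simp
    moreover have "(\<Sum>n\<in>{- int K..int K}. pairing T \<phi> (- n) / of_real T * fourier_mode T n x0) =
        (\<Sum>n\<in>{- int K..int K}. pairing T \<phi> (- n) * fourier_mode T n x0) / of_real T"
      by (simp add: sum_divide_distrib)
    ultimately show ?thesis
      unfolding coeff sum.distrib using T by (simp add: add_divide_distrib)
  qed
  have p0: "(\<lambda>K. p (f K)) \<longlonglongrightarrow> 0" if "inj f" for f :: "nat \<Rightarrow> int"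
  proof (rule tendsto_norm_zero_cancel)
    have "inj (\<lambda>K. - f K)" using that by (simp add: inj_def)
    from tendsto_norm_zero[OF Riemann_Lebesgue[OF T hc this]]
    show "(\<lambda>K. norm (p (f K))) \<longlonglongrightarrow> 0" by (simp add: p_def norm_mult)
  qed
  have "(\<lambda>K. \<phi> x0 + (p (- 1 - int K) - p (int K)) / of_real T) \<longlonglongrightarrow> \<phi> x0 + (0 - 0) / of_real T"
    using T by (intro tendsto_intros p0) (auto simp: inj_def)
  then show ?thesis unfolding tele by simp
qed

lemma int_tail_LIMSEQ:
  fixes f :: "int \<Rightarrow> real"
  assumes "f summable_on UNIV" and nn: "\<And>k. 0 \<le> f k"
  shows "(\<lambda>K. infsum f {k. \<bar>k\<bar> > int K}) \<longlonglongrightarrow> 0"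
proof (rule LIMSEQ_I)
  fix r :: real assume "0 < r"
  then obtain K0 where K0: "\<And>n. K0 \<le> n \<Longrightarrow> infsum f {k. \<bar>k\<bar> > int n} \<le> r / 2"
    using int_tail_tendsto_0[OF assms, of "r / 2"] by auto
  have "norm (infsum f {k. \<bar>k\<bar> > int n} - 0) < r" if "K0 \<le> n" for n
    using K0[OF that] infsum_nonneg[of "{k. \<bar>k\<bar> > int n}" f] nn \<open>0 < r\<close> by simp
  then show "\<exists>no. \<forall>n\<ge>no. norm (infsum f {k. \<bar>k\<bar> > int n} - 0) < r" by blast
qed

lemma infsum_int_split:
  fixes g :: "int \<Rightarrow> complex"
  assumes "(\<lambda>n. cmod (g n)) summable_on UNIV"
  shows "cmod (infsum g UNIV - (\<Sum>n\<in>{- int K..int K}. g n)) \<le> infsum (\<lambda>n. cmod (g n)) {n. \<bar>n\<bar> > int K}"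
proof -
  have U: "UNIV = {- int K..int K} \<union> {n. \<bar>n\<bar> > int K}" by auto
  have sub: "(\<lambda>n. cmod (g n)) summable_on B" for B by (rule summable_on_subset_banach[OF assms]) auto
  have "infsum g UNIV = (\<Sum>n\<in>{- int K..int K}. g n) + infsum g {n. \<bar>n\<bar> > int K}"
    by (subst U, subst infsum_Un_disjoint) (auto intro: abs_summable_summable[OF sub])
  then show ?thesis using norm_infsum_bound[OF sub, of "{n. \<bar>n\<bar> > int K}"] by simp
qed

lemma infsum_int_LIMSEQ:
  fixes g :: "int \<Rightarrow> complex"
  assumes "(\<lambda>n. cmod (g n)) summable_on UNIV"
  shows "(\<lambda>K. \<Sum>n\<in>{- int K..int K}. g n) \<longlonglongrightarrow> infsum g UNIV"
proof -
  have "(\<lambda>K. infsum g UNIV - (\<Sum>n\<in>{- int K..int K}. g n)) \<longlonglongrightarrow> 0"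
    by (rule Lim_null_comparison[OF always_eventually[OF allI[OF infsum_int_split[OF assms]]] int_tail_LIMSEQ[OF assms]]) simp
  from tendsto_diff[OF tendsto_const[of "infsum g UNIV"] this] show ?thesis by simp
qed

lemma pairing_summable':
  assumes "0 < T" "\<phi> \<in> test_functions T"
  shows "(\<lambda>n. cmod (pairing T \<phi> n)) summable_on UNIV"
  using pairing_summable[OF assms, of 0] by simp

text \<open>The bound is independent of \<open>x\<close>; applied to every derivative it controls
  the seminorms in which distributions are continuous.\<close>

lemma Fourier_truncation:
  assumes T: "0 < T" and \<phi>: "\<phi> \<in> test_functions T"
  shows "cmod (\<phi> x - (\<Sum>n\<in>{- int K..int K}. pairing T \<phi> (- n) / of_real T * fourier_mode T n x)) \<le>
    infsum (\<lambda>n. cmod (pairing T \<phi> (- n) / of_real T)) {n. \<bar>n\<bar> > int K}"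
proof -
  define g where "g = (\<lambda>n. pairing T \<phi> (- n) / of_real T * fourier_mode T n x)"
  have "(\<lambda>n. cmod (pairing T \<phi> (- n))) summable_on UNIV"
    using pairing_summable'[OF T \<phi>] infsum_int_shift(3)[of "\<lambda>n. cmod (pairing T \<phi> n)" 0] by simp
  from summable_on_cmult_left[OF this, of "1 / T"]
  have g: "(\<lambda>n. cmod (g n)) summable_on UNIV" using T by (simp add: g_def norm_mult norm_divide)
  have "infsum g UNIV = \<phi> x"
    using infsum_int_LIMSEQ[OF g] Fourier_inversion[OF T \<phi>, of x] LIMSEQ_unique unfolding g_def by blast
  moreover have "(\<lambda>n. cmod (g n)) = (\<lambda>n. cmod (pairing T \<phi> (- n) / of_real T))"
    by (simp add: g_def norm_mult norm_divide)
  ultimately show ?thesis using infsum_int_split[OF g, of K] unfolding g_def by simp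
qed

section \<open>Distributions and their Fourier coefficients\<close>

lemma
  assumes u: "u \<in> periodic_distributions T"
  shows distribution_add: "\<phi> \<in> test_functions T \<Longrightarrow> \<psi> \<in> test_functions T \<Longrightarrow> u (\<lambda>x. \<phi> x + \<psi> x) = u \<phi> + u \<psi>"
    and distribution_scale: "\<phi> \<in> test_functions T \<Longrightarrow> u (\<lambda>x. c * \<phi> x) = c * u \<phi>"
    and distribution_bound: "\<exists>C N. \<forall>\<phi>\<in>test_functions T.
            norm (u \<phi>) \<le> C * (\<Sum>k\<le>N. SUP x\<in>{0..T}. norm (iter_deriv k \<phi> x))"
    and distribution_outside: "\<phi> \<notin> test_functions T \<Longrightarrow> u \<phi> = 0"
  using u by (auto simp: periodic_distributions_def)

lemma distribution_zero:
  assumes "u \<in> periodic_distributions T" shows "u (\<lambda>_. 0) = 0"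
  using distribution_scale[OF assms test_zero(1), of 2] by simp

lemma distribution_sum:
  assumes u: "u \<in> periodic_distributions T" and "finite F" "\<And>n. n \<in> F \<Longrightarrow> \<phi> n \<in> test_functions T"
  shows "u (\<lambda>x. \<Sum>n\<in>F. c n * \<phi> n x) = (\<Sum>n\<in>F. c n * u (\<phi> n))"
  using assms(2,3)
proof (induction F rule: finite_induct)
  case empty
  then show ?case using distribution_zero[OF u] by simp
next
  case (insert n F)
  have n: "\<phi> n \<in> test_functions T" using insert by simp
  have "u (\<lambda>x. c n * \<phi> n x + (\<Sum>n\<in>F. c n * \<phi> n x)) = u (\<lambda>x. c n * \<phi> n x) + u (\<lambda>x. \<Sum>n\<in>F. c n * \<phi> n x)"
    using test_sum[of F \<phi> T c] insert by (intro distribution_add[OF u] test_scale(2) n) auto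
  also have "u (\<lambda>x. c n * \<phi> n x) = c n * u (\<phi> n)" by (rule distribution_scale[OF u n])
  finally show ?case using insert by simp
qed

text \<open>The partial Fourier sums of a test function converge to it uniformly with every
  derivative, because the coefficients of each derivative are absolutely summable. The seminorm
  estimate of \<open>u\<close>, which involves finitely many derivatives, carries the convergence
  over.\<close>

lemma distribution_expansion:
  assumes T: "0 < T" and u: "u \<in> periodic_distributions T" and \<phi>: "\<phi> \<in> test_functions T"
  shows "(\<lambda>K. \<Sum>n\<in>{- int K..int K}. fourier_coeff T u n * pairing T \<phi> n) \<longlonglongrightarrow> u \<phi>"
proof -
  define c where "c = (\<lambda>n. pairing T \<phi> (- n) / of_real T)"
  define p where "p = (\<lambda>K x. \<Sum>n\<in>{- int K..int K}. c n * fourier_mode T n x)"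
  define r where "r = (\<lambda>K x. \<phi> x + (-1) * p K x)"
  have T0: "T \<noteq> 0" using T by simp
  note mode = test_mode[OF T0]
  have p: "p K \<in> test_functions T"
    and pd: "iter_deriv k (p K) = (\<lambda>x. \<Sum>n\<in>{- int K..int K}. c n * (mode_freq T n ^ k * fourier_mode T n x))" for K k
    using test_sum[of "{- int K..int K}" "fourier_mode T" T c k] mode by (simp_all add: p_def)
  have r: "r K \<in> test_functions T" for K
    unfolding r_def by (intro test_add(2) test_scale(2) p \<phi>)
  have rd: "iter_deriv k (r K) x = iter_deriv k \<phi> x - iter_deriv k (p K) x" for k K x
    using test_add(1)[OF \<phi> test_scale(2)[OF p, of "-1"], of k K] test_scale(1)[OF p, of k "-1" K]
    by (simp add: r_def)
  obtain C N where bound: "\<And>\<psi>. \<psi> \<in> test_functions T \<Longrightarrow>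
      norm (u \<psi>) \<le> C * (\<Sum>k\<le>N. SUP x\<in>{0..T}. norm (iter_deriv k \<psi> x))"
    using distribution_bound[OF u] by metis
  define tl where "tl = (\<lambda>k K. infsum (\<lambda>n. cmod (pairing T (iter_deriv k \<phi>) (- n) / of_real T)) {n. \<bar>n\<bar> > int K})"
  have mf: "mode_freq T (- n) = - mode_freq T n" for n by (simp add: mode_freq_def)
  have rb: "cmod (iter_deriv k (r K) x) \<le> tl k K" for k K x
  proof -
    have "pairing T (iter_deriv k \<phi>) (- n) / of_real T * fourier_mode T n x =
       c n * (mode_freq T n ^ k * fourier_mode T n x)" for n
      using pairing_iter_deriv[OF T \<phi>, of k "- n"] by (simp add: c_def mf)
    then show ?thesis
      using Fourier_truncation[OF T iter_deriv_mem[OF \<phi>], of k x K] unfolding rd pd tl_def by simp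
  qed
  have sup: "0 \<le> (SUP x\<in>{0..T}. norm (iter_deriv k (r K) x))" "(SUP x\<in>{0..T}. norm (iter_deriv k (r K) x)) \<le> tl k K" for k K
  proof -
    show "(SUP x\<in>{0..T}. norm (iter_deriv k (r K) x)) \<le> tl k K"
      using T rb by (intro cSUP_least) auto
    have "bdd_above ((\<lambda>x. norm (iter_deriv k (r K) x)) ` {0..T})" using rb by (intro bdd_aboveI2)
    then show "0 \<le> (SUP x\<in>{0..T}. norm (iter_deriv k (r K) x))"
      using T by (intro cSUP_upper2[where x = 0]) auto
  qed
  have ub: "norm (u (r K)) \<le> \<bar>C\<bar> * (\<Sum>k\<le>N. tl k K)" for K
  proof -
    have "norm (u (r K)) \<le> C * (\<Sum>k\<le>N. SUP x\<in>{0..T}. norm (iter_deriv k (r K) x))" by (rule bound[OF r])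
    also have "\<dots> \<le> \<bar>C\<bar> * (\<Sum>k\<le>N. SUP x\<in>{0..T}. norm (iter_deriv k (r K) x))"
      by (intro mult_right_mono sum_nonneg sup) simp
    also have "\<dots> \<le> \<bar>C\<bar> * (\<Sum>k\<le>N. tl k K)"
      by (intro mult_left_mono sum_mono sup) simp
    finally show ?thesis .
  qed
  have tl0: "(\<lambda>K. tl k K) \<longlonglongrightarrow> 0" for k
    unfolding tl_def
  proof (rule int_tail_LIMSEQ)
    have "(\<lambda>n. cmod (pairing T (iter_deriv k \<phi>) (- n))) summable_on UNIV"
      using pairing_summable'[OF T iter_deriv_mem[OF \<phi>, of k]]
        infsum_int_shift(3)[of "\<lambda>n. cmod (pairing T (iter_deriv k \<phi>) n)" 0] by simp
    from summable_on_cmult_left[OF this, of "1 / T"]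
    show "(\<lambda>n. cmod (pairing T (iter_deriv k \<phi>) (- n) / of_real T)) summable_on UNIV"
      using T by (simp add: norm_divide)
  qed simp
  have "(\<lambda>K. \<bar>C\<bar> * (\<Sum>k\<le>N. tl k K)) \<longlonglongrightarrow> \<bar>C\<bar> * (\<Sum>k\<le>N. 0)"
    by (intro tendsto_intros tl0)
  then have "(\<lambda>K. \<bar>C\<bar> * (\<Sum>k\<le>N. tl k K)) \<longlonglongrightarrow> 0" by simp
  from Lim_null_comparison[OF always_eventually[OF allI[OF ub]] this]
  have "(\<lambda>K. u (r K)) \<longlonglongrightarrow> 0" .
  from tendsto_diff[OF tendsto_const[of "u \<phi>"] this]
  have "(\<lambda>K. u \<phi> - u (r K)) \<longlonglongrightarrow> u \<phi>" by simp
  moreover have "u \<phi> - u (r K) = (\<Sum>n\<in>{- int K..int K}. fourier_coeff T u n * pairing T \<phi> n)" for K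
  proof -
    have "u (r K) = u \<phi> + u (\<lambda>x. (-1) * p K x)"
      unfolding r_def by (intro distribution_add[OF u] \<phi> test_scale(2) p)
    also have "u (\<lambda>x. (-1) * p K x) = - u (p K)"
      using distribution_scale[OF u p[of K], of "-1"] by simp
    also have "u (p K) = (\<Sum>n\<in>{- int K..int K}. c n * u (fourier_mode T n))"
      unfolding p_def using mode by (intro distribution_sum[OF u]) auto
    also have "\<dots> = (\<Sum>n\<in>{- int K..int K}. c (- n) * u (fourier_mode T (- n)))"
      by (rule sum.reindex_bij_witness[of _ uminus uminus]) auto
    also have "\<dots> = (\<Sum>n\<in>{- int K..int K}. fourier_coeff T u n * pairing T \<phi> n)"
      using T by (intro sum.cong) (auto simp: c_def fourier_coeff_def)
    finally show ?thesis by simp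
  qed
  ultimately show ?thesis by simp
qed

lemma distribution_eqI:
  assumes T: "0 < T" and u: "u \<in> periodic_distributions T" and v: "v \<in> periodic_distributions T"
    and eq: "\<And>n. fourier_coeff T u n = fourier_coeff T v n"
  shows "u = v"
proof
  fix \<phi>
  show "u \<phi> = v \<phi>"
  proof (cases "\<phi> \<in> test_functions T")
    case True
    show ?thesis
      using distribution_expansion[OF T u True] distribution_expansion[OF T v True] eq LIMSEQ_unique by simp
  next
    case False
    then show ?thesis using distribution_outside[OF u] distribution_outside[OF v] by simp
  qed
qed

lemma pairing_fourier_mode:
  assumes "0 < T"
  shows "pairing T (fourier_mode T m) n = (if n = - m then of_real T else 0)"
proof -
  have "(\<lambda>x. fourier_mode T n x * fourier_mode T m x) = fourier_mode T (n + m)"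
    by (simp add: fourier_mode_mult fun_eq_iff)
  then show ?thesis using pairing_mode[OF assms, of "n + m"] by (auto simp: pairing_def)
qed

lemma of_fourier_coeffs_test:
  "\<phi> \<in> test_functions T \<Longrightarrow> of_fourier_coeffs T a \<phi> = (\<Sum>\<^sub>\<infinity>n. a n * pairing T \<phi> n)"
  by (simp add: of_fourier_coeffs_def pairing_def)

lemma of_fourier_coeffs_mode:
  assumes "0 < T"
  shows "of_fourier_coeffs T a (fourier_mode T (- n)) = of_real T * a n"
proof -
  have "of_fourier_coeffs T a (fourier_mode T (- n)) = (\<Sum>\<^sub>\<infinity>m. a m * (if m = n then of_real T else 0))"
    using assms test_mode(2)[of T "- n"] by (simp add: of_fourier_coeffs_test pairing_fourier_mode)
  also have "\<dots> = (\<Sum>\<^sub>\<infinity>m\<in>{n}. a m * of_real T)" by (rule infsum_cong_neutral) auto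
  finally show ?thesis by (simp add: mult.commute)
qed

lemma fourier_coeff_of_fourier_coeffs:
  "0 < T \<Longrightarrow> fourier_coeff T (of_fourier_coeffs T a) n = a n"
  by (simp add: fourier_coeff_def of_fourier_coeffs_mode)

lemma bounded_mult_summable:
  fixes a b :: "int \<Rightarrow> complex"
  assumes "\<And>n. cmod (a n) \<le> B" "(\<lambda>n. cmod (b n)) summable_on UNIV"
  shows "(\<lambda>n. cmod (a n * b n)) summable_on UNIV" "(\<lambda>n. a n * b n) summable_on UNIV"
proof -
  show *: "(\<lambda>n. cmod (a n * b n)) summable_on UNIV"
    by (rule summable_on_comparison_test[OF summable_on_cmult_right[OF assms(2), of B]])
      (auto simp: norm_mult intro!: mult_right_mono assms(1))
  show "(\<lambda>n. a n * b n) summable_on UNIV" using * by (rule abs_summable_summable)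
qed

text \<open>With absolutely summable coefficients the functional has order 0, so the supremum of the
  test function alone bounds it. This covers all sequences in the form domain.\<close>

lemma of_fourier_coeffs_mem:
  assumes T: "0 < T" and a: "(\<lambda>n. cmod (a n)) summable_on UNIV"
  shows "of_fourier_coeffs T a \<in> periodic_distributions T"
proof -
  have aB: "cmod (a n) \<le> (\<Sum>\<^sub>\<infinity>n. cmod (a n))" for n
    using finite_sum_le_infsum[OF a, of "{n}"] by simp
  have s: "(\<lambda>n. a n * pairing T \<phi> n) summable_on UNIV" "(\<lambda>n. cmod (a n * pairing T \<phi> n)) summable_on UNIV"
    if "\<phi> \<in> test_functions T" for \<phi>
    by (intro bounded_mult_summable[OF aB] pairing_summable'[OF T that])+
  have padd: "pairing T (\<lambda>x. \<phi> x + \<psi> x) n = pairing T \<phi> n + pairing T \<psi> n"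
    if "\<phi> \<in> test_functions T" "\<psi> \<in> test_functions T" for \<phi> \<psi> n
    unfolding pairing_def distrib_left
    by (intro integral_add mode_mult_integrable test_continuous[OF that(1)] test_continuous[OF that(2)])
  have pscale: "pairing T (\<lambda>x. c * \<phi> x) n = c * pairing T \<phi> n" for \<phi> n c
    unfolding pairing_def by (simp add: mult.left_commute)
  have bd: "cmod (of_fourier_coeffs T a \<phi>) \<le>
      (\<Sum>\<^sub>\<infinity>n. cmod (a n)) * T * (\<Sum>k\<le>0. SUP x\<in>{0..T}. norm (iter_deriv k \<phi> x))"
    if \<phi>: "\<phi> \<in> test_functions T" for \<phi>
  proof -
    define M where "M = (SUP x\<in>{0..T}. norm (\<phi> x))"
    have bb: "bdd_above ((\<lambda>x. norm (\<phi> x)) ` {0..T})"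
    proof -
      obtain B where "\<And>x. x \<in> {0..T} \<Longrightarrow> cmod (iter_deriv 0 \<phi> x) \<le> B"
        using iter_deriv_bounded[OF \<phi>, of 0] by blast
      then show ?thesis by (intro bdd_aboveI2[of _ _ B]) simp
    qed
    have M: "cmod (\<phi> x) \<le> M" if "x \<in> {0..T}" for x
      unfolding M_def by (rule cSUP_upper[OF that bb])
    have P: "cmod (pairing T \<phi> n) \<le> M * T" for n
      by (rule pairing_bound[OF T test_continuous[OF \<phi>] M])
    have "cmod (of_fourier_coeffs T a \<phi>) \<le> (\<Sum>\<^sub>\<infinity>n. cmod (a n * pairing T \<phi> n))"
      using norm_infsum_bound[OF s(2)[OF \<phi>]] \<phi> by (simp add: of_fourier_coeffs_test)
    also have "\<dots> \<le> (\<Sum>\<^sub>\<infinity>n. cmod (a n) * (M * T))"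
      by (intro infsum_mono s(2)[OF \<phi>] summable_on_cmult_left a) (auto simp: norm_mult intro!: mult_left_mono P)
    also have "\<dots> = (\<Sum>\<^sub>\<infinity>n. cmod (a n)) * T * M" by (simp add: infsum_cmult_left')
    finally show ?thesis by (simp add: M_def)
  qed
  show ?thesis
    unfolding periodic_distributions_def mem_Collect_eq
  proof (intro conjI ballI allI impI)
    fix \<phi> \<psi> assume "\<phi> \<in> test_functions T" "\<psi> \<in> test_functions T"
    then show "of_fourier_coeffs T a (\<lambda>x. \<phi> x + \<psi> x) = of_fourier_coeffs T a \<phi> + of_fourier_coeffs T a \<psi>"
      by (simp add: of_fourier_coeffs_test test_add padd distrib_left infsum_add s)
  next
    fix c \<phi> assume "\<phi> \<in> test_functions T"
    then show "of_fourier_coeffs T a (\<lambda>x. c * \<phi> x) = c * of_fourier_coeffs T a \<phi>"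
      by (simp add: of_fourier_coeffs_test test_scale pscale mult.left_commute infsum_cmult_right')
  next
    show "\<exists>C N. \<forall>\<phi>\<in>test_functions T. norm (of_fourier_coeffs T a \<phi>) \<le>
        C * (\<Sum>k\<le>N. SUP x\<in>{0..T}. norm (iter_deriv k \<phi> x))"
      using bd by blast
  qed (simp add: of_fourier_coeffs_def)
qed

section \<open>The eigenvalues as min-max values\<close>

definition pot_coeff :: "distribution \<Rightarrow> int \<Rightarrow> complex" where
  "pot_coeff q n = (if even n then fourier_coeff 1 q (n div 2) else 0)"

lemma powr_2_eq: "0 \<le> x \<Longrightarrow> x powr 2 = (x::real)\<^sup>2"
  by (cases "x = 0") auto

lemma fourier_mode_2_shift: "fourier_mode 2 n (x + 1) = (if even n then 1 else - 1) * fourier_mode 2 n x"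
proof -
  have "fourier_mode 2 n (x + 1) = cis (pi * of_int n) * fourier_mode 2 n x"
  proof -
    have "2 * pi * of_int n * (x + 1) / 2 = pi * of_int n + 2 * pi * of_int n * x / 2"
      by (simp add: field_simps)
    then show ?thesis unfolding fourier_mode_def by (simp only: cis_mult)
  qed
  moreover have "cis (pi * of_int n) = (if even n then 1 else - 1)"
  proof (cases "even n")
    case True
    then obtain m where "n = 2 * m" by blast
    then have "pi * of_int n = 2 * pi * of_int m" by simp
    then show ?thesis using True by (simp only: cis_multiple_2pi Ints_of_int if_True)
  next
    case False
    then obtain m where "n = 2 * m + 1" by (elim oddE)
    then have "pi * of_int n = 2 * pi * of_int m + pi" by (simp add: algebra_simps)
    then have "cis (pi * of_int n) = cis (2 * pi * of_int m) * cis pi" by (simp only: cis_mult)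
    then show ?thesis using False by (simp only: cis_multiple_2pi Ints_of_int cis_pi if_False mult_1_left)
  qed
  ultimately show ?thesis by simp
qed

lemma fourier_mode_2_even: "fourier_mode 2 (2 * n) = fourier_mode 1 n"
proof
  fix x
  have "2 * pi * real_of_int (2 * n) * x / 2 = 2 * pi * real_of_int n * x / 1" by simp
  then show "fourier_mode 2 (2 * n) x = fourier_mode 1 n x" unfolding fourier_mode_def by (simp only:)
qed

text \<open>Adding the translate by 1 cancels an odd mode and doubles an even one; the factor 2 is
  absorbed by dividing by the period.\<close>

lemma fourier_coeff_as_2_periodic:
  assumes q: "q \<in> periodic_distributions 1"
  shows "fourier_coeff 2 (as_2_periodic q) n = pot_coeff q n"
proof -
  have "as_2_periodic q (fourier_mode 2 (- n)) = q (\<lambda>x. fourier_mode 2 (- n) x + fourier_mode 2 (- n) (x + 1))"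
    using test_mode(2)[of 2 "- n"] by (simp add: as_2_periodic_def)
  also have "\<dots> = 2 * pot_coeff q n"
  proof (cases "even n")
    case True
    then obtain j where j: "n = 2 * j" by blast
    then have "(\<lambda>x. fourier_mode 2 (- n) x + fourier_mode 2 (- n) (x + 1)) = (\<lambda>x. 2 * fourier_mode 1 (- j) x)"
      using fourier_mode_2_even[of "- j"] by (simp add: fourier_mode_2_shift fun_eq_iff)
    then show ?thesis
      using distribution_scale[OF q test_mode(2)[of 1 "- j"], of 2] by (simp add: pot_coeff_def j fourier_coeff_def)
  next
    case False
    then show ?thesis
      using distribution_zero[OF q] by (simp add: fourier_mode_2_shift pot_coeff_def)
  qed
  finally show ?thesis by (simp add: fourier_coeff_def)
qed

lemma summable_on_even_int:
  fixes f :: "int \<Rightarrow> real"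
  assumes "\<And>j. odd j \<Longrightarrow> f j = 0"
  shows "f summable_on UNIV \<longleftrightarrow> (\<lambda>j. f (2 * j)) summable_on UNIV"
    and "infsum f UNIV = (\<Sum>\<^sub>\<infinity>j. f (2 * j))"
proof -
  have inj: "inj ((*) (2::int))" by (simp add: inj_def)
  have 0: "f j = 0" if "j \<notin> range ((*) 2)" for j
    using that assms[of j] by (auto simp: image_iff dvd_def)
  have "f summable_on UNIV \<longleftrightarrow> f summable_on range ((*) 2)"
    by (rule summable_on_cong_neutral) (use 0 in auto)
  then show "f summable_on UNIV \<longleftrightarrow> (\<lambda>j. f (2 * j)) summable_on UNIV"
    by (simp add: summable_on_reindex[OF inj] o_def)
  have "infsum f UNIV = infsum f (range ((*) 2))"
    by (rule infsum_cong_neutral) (use 0 in auto)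
  then show "infsum f UNIV = (\<Sum>\<^sub>\<infinity>j. f (2 * j))"
    by (simp add: infsum_reindex[OF inj] o_def)
qed

lemma potential_pot_coeff:
  assumes q: "q \<in> sobolev0 (-1)"
  shows "potential (pot_coeff q)"
proof
  have r: "real_distribution q" and z: "fourier_coeff 1 q 0 = 0"
    and s: "(\<lambda>n. \<langle>of_int n\<rangle> powr (- 1 * 2) * norm (fourier_coeff 1 q n) powr 2) summable_on UNIV"
    using q by (auto simp: sobolev0_def fourier_lebesgue0_def fourier_lebesgue_def)
  have herm: "fourier_coeff 1 q (- n) = cnj (fourier_coeff 1 q n)" for n
  proof -
    have "q (\<lambda>x. cnj (fourier_mode 1 (- n) x)) = cnj (q (fourier_mode 1 (- n)))"
      using r by (simp add: real_distribution_def)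
    then show ?thesis by (simp add: fourier_coeff_def fourier_mode_cnj)
  qed
  show "pot_coeff q (- j) = cnj (pot_coeff q j)" for j
  proof (cases "even j")
    case True
    then obtain b where b: "j = 2 * b" by blast
    then have "(- j) div 2 = - b" by simp
    then show ?thesis using herm[of b] by (simp add: pot_coeff_def b del: mult_minus_right)
  qed (simp add: pot_coeff_def)
  show "pot_coeff q 0 = 0" using z by (simp add: pot_coeff_def)
  have "(\<lambda>j. (cmod (fourier_coeff 1 q j) / \<bar>real_of_int (2 * j)\<bar>)\<^sup>2) summable_on UNIV"
  proof (rule summable_on_comparison_test[OF s])
    fix n :: int
    show "(cmod (fourier_coeff 1 q n) / \<bar>real_of_int (2 * n)\<bar>)\<^sup>2 \<le> \<langle>of_int n\<rangle> powr (- 1 * 2) * norm (fourier_coeff 1 q n) powr 2"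
    proof (cases "n = 0")
      case False
      define x where "x = \<bar>real_of_int n\<bar>"
      have x: "1 \<le> x" unfolding x_def using False by linarith
      have "1 / (2 * x)\<^sup>2 \<le> 1 / (1 + x)\<^sup>2"
        using x by (intro divide_left_mono power_mono) auto
      then have "(cmod (fourier_coeff 1 q n))\<^sup>2 * (1 / (2 * x)\<^sup>2) \<le> (cmod (fourier_coeff 1 q n))\<^sup>2 * (1 / (1 + x)\<^sup>2)"
        by (rule mult_left_mono) simp
      moreover have "(1 + x) powr (- 2) = 1 / (1 + x)\<^sup>2"
        using x by (simp add: powr_minus_divide powr_2_eq)
      ultimately show ?thesis
        by (simp add: japanese_def powr_2_eq power_divide abs_mult x_def mult.commute)
    qed simp
  qed simp
  then show "(\<lambda>j. (cmod (pot_coeff q j) / \<bar>real_of_int j\<bar>)\<^sup>2) summable_on UNIV"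
    by (subst summable_on_even_int(1)) (auto simp: pot_coeff_def)
qed

context potential begin

lemma shift_exists: "\<exists>c. shifted_potential Q c"
proof -
  \<comment> \<open>The shift will be t^4, since the kinetic estimate decays like the fourth root of
    the shift. The factor 16 is the 4 of that estimate divided by the admissible bound 1/4.\<close>
  define t where "t = max 1 (16 * \<alpha>2 * (1 + zeta32))"
  define c where "c = t ^ 4"
  have t: "1 \<le> t" "16 * \<alpha>2 * (1 + zeta32) \<le> t" by (auto simp: t_def)
  have c: "1 \<le> c" unfolding c_def using t by (intro one_le_power)
  have c4: "c powr (1/4) = t"
    using t by (simp add: c_def powr_powr flip: powr_numeral)
  have "1 / c \<le> 1 / t"
    using t power_increasing[of 1 4 t] by (intro divide_left_mono) (auto simp: c_def)
  then have "1 / c + zeta32 / t \<le> (1 + zeta32) / t" by (simp add: add_divide_distrib)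
  then have "4 * \<alpha>2 * (1 / c + zeta32 / t) \<le> 4 * \<alpha>2 * ((1 + zeta32) / t)"
    using \<alpha>2_nonneg by (intro mult_left_mono) auto
  also have "\<dots> \<le> 1 / 4" using t by (simp add: field_simps)
  finally show ?thesis
    using c by (intro exI[of _ c]) (unfold_locales, auto simp: c4)
qed

end

section \<open>Distributional eigenspaces as eigenspaces of the pair of forms\<close>

context shifted_potential begin

text \<open>The pointwise equation is recovered from the weak one by testing with the unit sequences
  \<open>\<delta> k\<close>. The eigenvalue moves by \<open>c\<close> because \<open>A\<close> is
  the form of L(q) + c.\<close>

lemma eigen_sequence_iff:
  assumes F: "F \<in> X"
  shows "(\<forall>k. of_real (pi\<^sup>2 * (real_of_int k)\<^sup>2) * F k + Qop F k = \<mu> * F k) \<longleftrightarrow> (\<forall>h\<in>X. A F h = (\<mu> + of_real c) * S F h)"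
    (is "?L \<longleftrightarrow> ?R")
proof
  assume L: ?L
  have eq: "of_real (wt k) * F k + Qop F k = (\<mu> + of_real c) * F k" for k
    using L[rule_format, of k] unfolding wt_def by (simp add: algebra_simps)
  show ?R
    unfolding A_def S_def eq by (simp add: mult.assoc infsum_cmult_right')
next
  assume R: ?R
  have single: "(\<Sum>\<^sub>\<infinity>k. g k * cnj (\<delta> j k)) = g j" for g :: "int \<Rightarrow> complex" and j
  proof -
    have "(\<Sum>\<^sub>\<infinity>k. g k * cnj (\<delta> j k)) = (\<Sum>\<^sub>\<infinity>k\<in>{j}. g k)"
      by (rule infsum_cong_neutral) (auto simp: \<delta>_def)
    then show ?thesis by simp
  qed
  have "of_real (wt k) * F k + Qop F k = (\<mu> + of_real c) * F k" for k
  proof -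
    have "A F (\<delta> k) = (\<mu> + of_real c) * S F (\<delta> k)" using R \<delta>_mem[of k] by blast
    then show ?thesis by (simp only: A_def S_def single)
  qed
  then show ?L unfolding wt_def by (simp add: algebra_simps)
qed

text \<open>Cauchy-Schwarz against the summable sequence 1/wt: the embedding of H^1 into absolutely
  convergent Fourier series.\<close>

lemma X_abs_summable:
  assumes F: "F \<in> X"
  shows "(\<lambda>k. cmod (F k)) summable_on UNIV"
proof -
  have 1: "(\<lambda>k. (sqrt (wt k) * cmod (F k))\<^sup>2) summable_on UNIV"
    using X_D[OF F] by (simp add: power_mult_distrib)
  have 2: "(\<lambda>k. (1 / sqrt (wt k))\<^sup>2) summable_on UNIV"
    using kinetic_weight_sum(1)[OF c_ge_1, folded wt_def] by (simp add: power_divide)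
  have "\<bar>sqrt (wt k) * cmod (F k) * (1 / sqrt (wt k))\<bar> = cmod (F k)" for k
    by (simp add: abs_mult)
  then show ?thesis using infsum_Cauchy_Schwarz(1)[OF 1 2] by simp
qed

lemma sobolev_weight_bounds:
  "wt n \<le> (pi\<^sup>2 + c) * (1 + \<bar>real_of_int n\<bar>)\<^sup>2" "(1 + \<bar>real_of_int n\<bar>)\<^sup>2 \<le> 2 * wt n"
proof -
  have n2: "(1 + \<bar>real_of_int n\<bar>)\<^sup>2 = 1 + 2 * \<bar>real_of_int n\<bar> + (real_of_int n)\<^sup>2"
    by (simp add: power2_eq_square algebra_simps)
  then have "(real_of_int n)\<^sup>2 \<le> (1 + \<bar>real_of_int n\<bar>)\<^sup>2" "1 \<le> (1 + \<bar>real_of_int n\<bar>)\<^sup>2" by simp_all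
  then have "pi\<^sup>2 * (real_of_int n)\<^sup>2 \<le> pi\<^sup>2 * (1 + \<bar>real_of_int n\<bar>)\<^sup>2" "c * 1 \<le> c * (1 + \<bar>real_of_int n\<bar>)\<^sup>2"
    using c_ge_1 by (auto intro!: mult_left_mono simp del: power2_less_eq_zero_iff)
  then show "wt n \<le> (pi\<^sup>2 + c) * (1 + \<bar>real_of_int n\<bar>)\<^sup>2" unfolding wt_def distrib_right by linarith
  have "0 \<le> (1 - \<bar>real_of_int n\<bar>)\<^sup>2" by simp
  then have "(1 + \<bar>real_of_int n\<bar>)\<^sup>2 \<le> 2 * (real_of_int n)\<^sup>2 + 2"
    by (simp add: power2_eq_square algebra_simps)
  also have "(real_of_int n)\<^sup>2 \<le> pi\<^sup>2 * (real_of_int n)\<^sup>2"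
    using mult_right_mono[of 1 "pi\<^sup>2" "(real_of_int n)\<^sup>2"] pi_gt3 by (simp add: one_le_power)
  then have "2 * (real_of_int n)\<^sup>2 + 2 \<le> 2 * wt n" using c_ge_1 by (simp add: wt_def distrib_left)
  finally show "(1 + \<bar>real_of_int n\<bar>)\<^sup>2 \<le> 2 * wt n" .
qed

lemma sobolev_1_iff:
  assumes "f \<in> periodic_distributions 2"
  shows "f \<in> sobolev 2 1 \<longleftrightarrow> fourier_coeff 2 f \<in> X"
proof -
  have eq: "\<langle>of_int n\<rangle> powr (1 * 2) * norm (fourier_coeff 2 f n) powr 2 = (1 + \<bar>real_of_int n\<bar>)\<^sup>2 * (cmod (fourier_coeff 2 f n))\<^sup>2" for n
    by (simp add: japanese_def powr_2_eq)
  have "f \<in> sobolev 2 1 \<longleftrightarrow> (\<lambda>n. (1 + \<bar>real_of_int n\<bar>)\<^sup>2 * (cmod (fourier_coeff 2 f n))\<^sup>2) summable_on UNIV"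
    using assms by (simp only: sobolev_def fourier_lebesgue_def mem_Collect_eq eq simp_thms)
  also have "\<dots> \<longleftrightarrow> fourier_coeff 2 f \<in> X"
  proof
    assume s: "(\<lambda>n. (1 + \<bar>real_of_int n\<bar>)\<^sup>2 * (cmod (fourier_coeff 2 f n))\<^sup>2) summable_on UNIV"
    show "fourier_coeff 2 f \<in> X"
      unfolding X_def mem_Collect_eq
    proof (rule summable_on_comparison_test[OF summable_on_cmult_right[OF s, of "pi\<^sup>2 + c"]])
      fix n
      show "wt n * (cmod (fourier_coeff 2 f n))\<^sup>2 \<le> (pi\<^sup>2 + c) * ((1 + \<bar>real_of_int n\<bar>)\<^sup>2 * (cmod (fourier_coeff 2 f n))\<^sup>2)"
        using mult_right_mono[OF sobolev_weight_bounds(1)[of n], of "(cmod (fourier_coeff 2 f n))\<^sup>2"] by (simp add: mult.assoc)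
    qed simp
  next
    assume "fourier_coeff 2 f \<in> X"
    from summable_on_cmult_right[OF X_D[OF this], of 2]
    show "(\<lambda>n. (1 + \<bar>real_of_int n\<bar>)\<^sup>2 * (cmod (fourier_coeff 2 f n))\<^sup>2) summable_on UNIV"
    proof (rule summable_on_comparison_test)
      fix n
      show "(1 + \<bar>real_of_int n\<bar>)\<^sup>2 * (cmod (fourier_coeff 2 f n))\<^sup>2 \<le> 2 * (wt n * (cmod (fourier_coeff 2 f n))\<^sup>2)"
        using mult_right_mono[OF sobolev_weight_bounds(2)[of n], of "(cmod (fourier_coeff 2 f n))\<^sup>2"] by (simp add: mult.assoc)
    qed simp
  qed
  finally show ?thesis .
qed

end

lemma distr_deriv_twice:
  assumes "\<phi> \<in> test_functions T"
  shows "distr_deriv T (distr_deriv T f) \<phi> = f (iter_deriv 2 \<phi>)"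
proof -
  have "iter_deriv 1 (iter_deriv 1 \<phi>) = iter_deriv 2 \<phi>"
    unfolding iter_deriv_iter_deriv by (simp add: numeral_2_eq_2)
  then show ?thesis using assms iter_deriv_mem[OF assms, of 1] by (simp add: distr_deriv_def)
qed

lemma mode_freq_2_sq: "(mode_freq 2 k)\<^sup>2 = - of_real (pi\<^sup>2 * (real_of_int k)\<^sup>2)"
  by (simp add: mode_freq_def power_mult_distrib)

locale schroedinger_operator = shifted_potential "pot_coeff q" c for q c +
  assumes q: "q \<in> periodic_distributions 1"
begin

abbreviation synth :: "(int \<Rightarrow> complex) \<Rightarrow> distribution" where
  "synth \<equiv> of_fourier_coeffs 2"

lemma synth_mem: "F \<in> X \<Longrightarrow> synth F \<in> periodic_distributions 2"
  by (intro of_fourier_coeffs_mem X_abs_summable) simp_all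

lemma synth_coeff: "fourier_coeff 2 (synth F) = F"
  by (simp add: fun_eq_iff fourier_coeff_of_fourier_coeffs)

lemma distr_mult_eq: "distr_mult 2 (as_2_periodic q) f = synth (Qop (fourier_coeff 2 f))"
  unfolding distr_mult_def Qop_def fourier_coeff_as_2_periodic[OF q] ..

lemma synth_test_summable:
  assumes "F \<in> X" "\<phi> \<in> test_functions 2"
  shows "(\<lambda>n. F n * pairing 2 \<phi> n) summable_on UNIV"
proof -
  have "cmod (F n) \<le> (\<Sum>\<^sub>\<infinity>n. cmod (F n))" for n
    using finite_sum_le_infsum[OF X_abs_summable[OF assms(1)], of "{n}"] by simp
  then show ?thesis using pairing_summable'[OF _ assms(2)] by (intro bounded_mult_summable(2)) simp_all
qed

text \<open>Testing a distributional eigenvector with modes gives the equation for its coefficients,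
  and such a distribution is synthesised from them since coefficients determine it. For the converse
  the equation must be checked on every test function by summing over the modes.\<close>

lemma eigenspace_eq:
  "eigenspace q \<mu> = synth ` {F \<in> X. \<forall>h\<in>X. A F h = (\<mu> + of_real c) * S F h}"
proof (intro set_eqI iffI)
  fix f assume f: "f \<in> eigenspace q \<mu>"
  then have PD: "f \<in> periodic_distributions 2" and sob: "f \<in> sobolev 2 1"
    and eig: "\<And>\<phi>. schroedinger q f \<phi> = \<mu> * f \<phi>"
    by (auto simp: eigenspace_def sobolev_def fourier_lebesgue_def)
  define F where "F = fourier_coeff 2 f"
  have F: "F \<in> X" using sob sobolev_1_iff[OF PD] by (simp add: F_def)
  have fF: "f = synth F"
    by (rule distribution_eqI[OF _ PD synth_mem[OF F]]) (simp_all add: synth_coeff F_def)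
  have "of_real (pi\<^sup>2 * (real_of_int k)\<^sup>2) * F k + Qop F k = \<mu> * F k" for k
  proof -
    let ?e = "fourier_mode 2 (- k)"
    have e: "?e \<in> test_functions 2" and e2: "iter_deriv 2 ?e = (\<lambda>x. (mode_freq 2 (- k))\<^sup>2 * ?e x)"
      by (simp_all add: test_mode)
    have fe: "f ?e = 2 * F k" unfolding fF by (simp add: of_fourier_coeffs_mode)
    have "f (iter_deriv 2 ?e) = - of_real (pi\<^sup>2 * (real_of_int k)\<^sup>2) * (2 * F k)"
      unfolding e2 distribution_scale[OF PD e] fe mode_freq_2_sq by simp
    moreover have "schroedinger q f ?e = - f (iter_deriv 2 ?e) + 2 * Qop F k"
      unfolding schroedinger_def distr_deriv_twice[OF e] distr_mult_eq F_def[symmetric]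
      by (simp add: of_fourier_coeffs_mode)
    ultimately have "2 * (of_real (pi\<^sup>2 * (real_of_int k)\<^sup>2) * F k + Qop F k) = 2 * (\<mu> * F k)"
      using eig[of ?e] fe by (simp add: algebra_simps)
    then show ?thesis by (simp only: mult_cancel_left) simp
  qed
  then show "f \<in> synth ` {F \<in> X. \<forall>h\<in>X. A F h = (\<mu> + of_real c) * S F h}"
    using eigen_sequence_iff[OF F, of \<mu>] F fF by blast
next
  fix f assume "f \<in> synth ` {F \<in> X. \<forall>h\<in>X. A F h = (\<mu> + of_real c) * S F h}"
  then obtain F where fF: "f = synth F" and F: "F \<in> X"
    and eig: "\<And>k. of_real (pi\<^sup>2 * (real_of_int k)\<^sup>2) * F k + Qop F k = \<mu> * F k"
    using eigen_sequence_iff by blast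
  have PD: "f \<in> periodic_distributions 2" unfolding fF by (rule synth_mem[OF F])
  have sob: "f \<in> sobolev 2 1" using sobolev_1_iff[OF PD] F by (simp add: fF synth_coeff)
  have "schroedinger q f \<phi> = \<mu> * f \<phi>" for \<phi>
  proof (cases "\<phi> \<in> test_functions 2")
    case False
    then show ?thesis
      by (simp add: schroedinger_def distr_deriv_def distr_mult_eq fF of_fourier_coeffs_def)
  next
    case True
    define \<psi> where "\<psi> = iter_deriv 2 \<phi>"
    have \<psi>: "\<psi> \<in> test_functions 2" unfolding \<psi>_def by (rule iter_deriv_mem[OF True])
    have p\<psi>: "pairing 2 \<psi> n = - of_real (pi\<^sup>2 * (real_of_int n)\<^sup>2) * pairing 2 \<phi> n" for n
      unfolding \<psi>_def using pairing_iter_deriv[OF _ True, of 2 n] mode_freq_2_sq[of n] by simp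
    \<comment> \<open>The eigenvalue equation trades the potential term for two series in
      \<open>F\<close> alone, whose summability is known; the product with \<open>q\<close> is then
      summed through them.\<close>
    have Q: "Qop F n * pairing 2 \<phi> n = \<mu> * (F n * pairing 2 \<phi> n) + F n * pairing 2 \<psi> n" for n
    proof -
      have QF: "Qop F n = \<mu> * F n - of_real (pi\<^sup>2 * (real_of_int n)\<^sup>2) * F n"
        using eig[of n] by (simp add: algebra_simps)
      show ?thesis unfolding p\<psi> QF by (simp add: algebra_simps)
    qed
    have "schroedinger q f \<phi> = - (\<Sum>\<^sub>\<infinity>n. F n * pairing 2 \<psi> n) + (\<Sum>\<^sub>\<infinity>n. Qop F n * pairing 2 \<phi> n)"
      unfolding schroedinger_def distr_deriv_twice[OF True] distr_mult_eq fF synth_coeff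
        of_fourier_coeffs_test[OF True] \<psi>_def[symmetric] of_fourier_coeffs_test[OF \<psi>] ..
    also have "(\<Sum>\<^sub>\<infinity>n. Qop F n * pairing 2 \<phi> n) = \<mu> * (\<Sum>\<^sub>\<infinity>n. F n * pairing 2 \<phi> n) + (\<Sum>\<^sub>\<infinity>n. F n * pairing 2 \<psi> n)"
      unfolding Q infsum_cmult_right'[symmetric]
      by (intro infsum_add summable_on_cmult_right synth_test_summable F True \<psi>)
    finally show ?thesis by (simp add: fF of_fourier_coeffs_test[OF True])
  qed
  then show "f \<in> eigenspace q \<mu>" using sob by (simp add: eigenspace_def fun_eq_iff)
qed

lemma synth_combination_span:
  assumes "finite J" "\<And>m. m \<in> J \<Longrightarrow> e m \<in> X" "\<And>m. m \<in> J \<Longrightarrow> synth (e m) \<in> B"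
  shows "synth (\<lambda>k. \<Sum>m\<in>J. t m * e m k) \<in> distr.span B"
  using assms
proof (induction J rule: finite_induct)
  case empty
  have z: "synth (\<lambda>k. 0) = 0"
    by (simp add: of_fourier_coeffs_def fun_eq_iff)
  show ?case unfolding sum.empty z by (rule distr.span_zero)
next
  case (insert m J)
  let ?G = "\<lambda>k. \<Sum>m\<in>J. t m * e m k"
  have G: "?G \<in> X" using insert by (intro S.sum_mem) auto
  have em: "e m \<in> X" using insert by simp
  have "synth (\<lambda>k. t m * e m k + ?G k) \<phi> = ((\<lambda>\<phi>. t m * synth (e m) \<phi>) + synth ?G) \<phi>" for \<phi>
  proof (cases "\<phi> \<in> test_functions 2")
    case True
    have "(\<Sum>\<^sub>\<infinity>n. (t m * e m n + ?G n) * pairing 2 \<phi> n) =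
       (\<Sum>\<^sub>\<infinity>n. t m * (e m n * pairing 2 \<phi> n) + ?G n * pairing 2 \<phi> n)"
      by (simp add: distrib_right mult.assoc)
    also have "\<dots> = t m * (\<Sum>\<^sub>\<infinity>n. e m n * pairing 2 \<phi> n) + (\<Sum>\<^sub>\<infinity>n. ?G n * pairing 2 \<phi> n)"
      unfolding infsum_cmult_right'[symmetric]
      by (intro infsum_add summable_on_cmult_right synth_test_summable G em True)
    finally show ?thesis by (simp add: of_fourier_coeffs_test[OF True])
  qed (simp add: of_fourier_coeffs_def)
  then have "synth (\<lambda>k. t m * e m k + ?G k) = (\<lambda>\<phi>. t m * synth (e m) \<phi>) + synth ?G" by (rule ext)
  also have "\<dots> \<in> distr.span B"
    using insert by (intro distr.span_add[OF distr.span_scale[OF distr.span_base]]) auto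
  finally show ?case using insert by simp
qed

text \<open>The eigenvectors with the given eigenvalue synthesise to a basis: they span by the
  expansion of eigenvectors. They are independent because everything in the span of the others is
  S-orthogonal to the eigenvector left out.\<close>

lemma multiplicity_eq:
  assumes e: "is_eigensystem e"
  shows "multiplicity q \<mu> = card {m. complex_of_real (Re (A (e m) (e m)) - c) = \<mu>}"
proof -
  define J where "J = {m. complex_of_real (Re (A (e m) (e m)) - c) = \<mu>}"
  have J': "J = {m. complex_of_real (Re (A (e m) (e m))) = \<mu> + of_real c}"
    by (auto simp: J_def algebra_simps)
  have fin: "finite J" unfolding J' by (rule finite_l_eq[OF e refl])
  define B where "B = (\<lambda>m. synth (e m)) ` J"
  have eX: "e m \<in> X" for m by (rule e_mem[OF e refl])
  have on: "S (e i) (e j) = (if i = j then 1 else 0)" for i j by (rule e_orthonormal[OF e refl])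
  have inj: "inj_on (\<lambda>m. synth (e m)) J"
  proof (rule inj_onI)
    fix i j assume "synth (e i) = synth (e j)"
    then have "e i = e j" by (metis synth_coeff)
    then show "i = j" using on[of i j] on[of i i] by (simp split: if_splits)
  qed
  have "distr.dim (eigenspace q \<mu>) = card J"
  proof (rule distr.dim_unique[of B])
    show "B \<subseteq> eigenspace q \<mu>"
      unfolding eigenspace_eq B_def
      by (auto simp: J' intro!: imageI eX simp: eigen[OF e refl])
    show "eigenspace q \<mu> \<subseteq> distr.span B"
    proof
      fix f assume "f \<in> eigenspace q \<mu>"
      then obtain F where f: "f = synth F" and F: "F \<in> X"
        and eig: "\<And>h. h \<in> X \<Longrightarrow> A F h = (\<mu> + of_real c) * S F h"
        unfolding eigenspace_eq by blast
      have "F = (\<lambda>k. \<Sum>m\<in>J. S F (e m) * e m k)"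
        unfolding J' using eigenvector_expansion[OF e refl F eig] .
      then have "f = synth (\<lambda>k. \<Sum>m\<in>J. S F (e m) * e m k)" using f by simp
      then show "f \<in> distr.span B"
        using synth_combination_span[OF fin, of e B "\<lambda>m. S F (e m)"] eX by (simp add: B_def)
    qed
    show "distr.independent B"
    proof
      assume "distr.dependent B"
      then obtain f where fB: "f \<in> B" and fs: "f \<in> distr.span (B - {f})"
        unfolding distr.dependent_def by blast
      then obtain m where m: "m \<in> J" "f = synth (e m)" by (auto simp: B_def)
      have "fourier_coeff 2 f \<in> X \<and> S (fourier_coeff 2 f) (e m) = 0"
      proof (rule distr.span_induct[OF fs, where P = "\<lambda>u. fourier_coeff 2 u \<in> X \<and> S (fourier_coeff 2 u) (e m) = 0"])
        have z: "fourier_coeff 2 (0::distribution) = (\<lambda>_. 0)"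
          by (simp add: fourier_coeff_def fun_eq_iff)
        have a: "fourier_coeff 2 (u + v) = (\<lambda>k. fourier_coeff 2 u k + fourier_coeff 2 v k)" for u v
          by (simp add: fourier_coeff_def fun_eq_iff add_divide_distrib)
        have sc: "fourier_coeff 2 (\<lambda>\<phi>. t * u \<phi>) = (\<lambda>k. t * fourier_coeff 2 u k)" for u t
          by (simp add: fourier_coeff_def fun_eq_iff)
        show "distr.subspace {u. fourier_coeff 2 u \<in> X \<and> S (fourier_coeff 2 u) (e m) = 0}"
          by (rule distr.subspaceI)
            (auto simp: z a sc S.zero_mem S.zero_left S.add_mem S.add_left S.scale_mem S.scale_left eX)
        fix u assume "u \<in> B - {f}"
        then obtain i where "u = synth (e i)" "i \<noteq> m" using m by (auto simp: B_def)
        then show "fourier_coeff 2 u \<in> X \<and> S (fourier_coeff 2 u) (e m) = 0"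
          using on[of i m] eX by (simp add: synth_coeff)
      qed
      then show False using on[of m m] by (simp add: m synth_coeff)
    qed
    show "card B = card J" unfolding B_def by (rule card_image[OF inj])
  qed
  then show ?thesis by (simp add: multiplicity_def J_def)
qed

end

text \<open>Counting: if \<open>l n < l' n\<close>, the finite set of values l(0), ..., l(n) is
  attained by \<open>l\<close> at n + 1 indices at least, but by \<open>l'\<close> only at indices
  below n, because all these values lie below \<open>l' n\<close>. Equal fibre sizes exclude
  this.\<close>

lemma mono_fibers_le:
  fixes l l' :: "nat \<Rightarrow> real"
  assumes "mono l" "mono l'" and fin: "\<And>x. finite {k. l k = x}" "\<And>x. finite {k. l' k = x}"
    and card: "\<And>x. card {k. l k = x} = card {k. l' k = x}"
  shows "l' n \<le> l n"
proof (rule ccontr)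
  assume less: "\<not> l' n \<le> l n"
  define V where "V = l ` {..n}"
  have V: "finite V" by (simp add: V_def)
  have U: "{k. f k \<in> V} = (\<Union>y\<in>V. {k. f k = y})" for f :: "nat \<Rightarrow> real" by auto
  have "card {k. l k \<in> V} = (\<Sum>y\<in>V. card {k. l k = y})"
    unfolding U using V fin by (intro card_UN_disjoint) auto
  also have "\<dots> = card {k. l' k \<in> V}"
    unfolding U card using V fin by (intro card_UN_disjoint[symmetric]) auto
  also have "\<dots> \<le> card {..<n}"
  proof (rule card_mono)
    show "{k. l' k \<in> V} \<subseteq> {..<n}"
    proof
      fix k assume "k \<in> {k. l' k \<in> V}"
      then obtain i where "i \<le> n" "l' k = l i" by (auto simp: V_def)
      then have "l' k \<le> l n" using monoD[OF \<open>mono l\<close>] by simp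
      then have "l' k < l' n" using less by simp
      then show "k \<in> {..<n}" using monoD[OF \<open>mono l'\<close>, of n k] by (cases "k < n") auto
    qed
  qed simp
  finally have "card {k. l k \<in> V} \<le> n" by simp
  moreover have "card {..n} \<le> card {k. l k \<in> V}"
  proof (rule card_mono)
    show "finite {k. l k \<in> V}" unfolding U using V fin by auto
  qed (auto simp: V_def)
  ultimately show False by simp
qed

lemma eigenvalue_list_unique:
  assumes "eigenvalue_list q l" "eigenvalue_list q l'"
  shows "l = l'"
proof -
  have fin: "finite {k. f k = x}" and card: "card {k. f k = x} = multiplicity q (complex_of_real x)"
    if "eigenvalue_list q f" for f and x :: real
    using that unfolding eigenvalue_list_def of_real_eq_iff[of _ x, symmetric, where 'a = complex] by blast+
  have mono: "mono l" "mono l'" using assms by (auto simp: eigenvalue_list_def)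
  have "l n \<le> l' n" "l' n \<le> l n" for n
    using mono_fibers_le[OF mono(2,1) fin[OF assms(2)] fin[OF assms(1)]]
      mono_fibers_le[OF mono fin[OF assms(1)] fin[OF assms(2)]]
    by (simp_all add: card[OF assms(1)] card[OF assms(2)])
  then show ?thesis by (intro ext antisym)
qed

context schroedinger_operator begin

lemma eigenvalues_eq:
  assumes e: "is_eigensystem e"
  shows "eigenvalues q m = Re (A (e m) (e m)) - c"
proof -
  have mono: "mono (\<lambda>m. Re (A (e m) (e m)) - c)"
    using l_mono[OF e refl] by (simp add: mono_def)
  have "finite {m. complex_of_real (Re (A (e m) (e m)) - c) = \<mu>}" for \<mu>
    using finite_l_eq[OF e refl, of "\<mu> + of_real c"] by (simp add: diff_eq_eq)
  then have list: "eigenvalue_list q (\<lambda>m. Re (A (e m) (e m)) - c)"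
    unfolding eigenvalue_list_def using mono multiplicity_eq[OF e] by simp
  have "eigenvalues q = (\<lambda>m. Re (A (e m) (e m)) - c)"
    unfolding eigenvalues_def by (rule the_equality[where P = "eigenvalue_list q", OF list]) (rule eigenvalue_list_unique[OF _ list])
  then show ?thesis by simp
qed

end

section \<open>The gap inequality\<close>

text \<open>The distance |k^2 - n^2| between free levels up to the factor pi^2, kept as a product
  because the kernel sums are taken over its two factors.\<close>

definition gap_weight :: "nat \<Rightarrow> int \<Rightarrow> real" where
  "gap_weight n k = \<bar>real_of_int (int n - k)\<bar> * \<bar>real_of_int (int n + k)\<bar>"

lemma gap_weight_eq: "gap_weight n k = \<bar>(real_of_int k)\<^sup>2 - (real n)\<^sup>2\<bar>"
proof -
  have "(real_of_int k)\<^sup>2 - (real n)\<^sup>2 = - (real_of_int (int n - k) * real_of_int (int n + k))"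
    by (simp add: power2_eq_square algebra_simps)
  then show ?thesis by (simp only: gap_weight_def abs_minus_cancel abs_mult)
qed

lemma gap_weight_nonneg [simp]: "0 \<le> gap_weight n k"
  by (simp add: gap_weight_def)

lemma gap_weight_zero_iff: "gap_weight n k = 0 \<longleftrightarrow> k = int n \<or> k = - int n"
  unfolding gap_weight_def mult_eq_0_iff abs_eq_0 of_int_eq_0_iff by linarith

lemma gap_weight_uminus: "gap_weight n (- k) = gap_weight n k"
  by (simp add: gap_weight_eq)

lemma gap_weight_ge:
  assumes "k \<noteq> int n" "k \<noteq> - int n" shows "real n \<le> gap_weight n k"
proof -
  have "1 \<le> \<bar>int n - k\<bar>" "1 \<le> \<bar>int n + k\<bar>" using assms by linarith+
  then have "int n \<le> \<bar>int n - k\<bar> * \<bar>int n + k\<bar>"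
  proof (cases "k \<ge> 0")
    case True
    have "1 * int n \<le> \<bar>int n - k\<bar> * \<bar>int n + k\<bar>" using True \<open>1 \<le> \<bar>int n - k\<bar>\<close> by (intro mult_mono) auto
    then show ?thesis by simp
  next
    case False
    have "int n * 1 \<le> \<bar>int n - k\<bar> * \<bar>int n + k\<bar>" using False \<open>1 \<le> \<bar>int n + k\<bar>\<close> by (intro mult_mono) auto
    then show ?thesis by simp
  qed
  then have "real_of_int (int n) \<le> real_of_int (\<bar>int n - k\<bar> * \<bar>int n + k\<bar>)" by (simp only: of_int_le_iff)
  then show ?thesis by (simp add: gap_weight_def)
qed

text \<open>Meant for x = k - m with a, b the two factors of the weight at k and a', b' those at m.
  Bounding x^2 by (a + a') (b + b') and expanding cancels two of the four factors in each term,
  which leaves four summable kernels.\<close>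

lemma kernel_expansion:
  fixes a b a' b' x :: real
  assumes "1 \<le> a" "1 \<le> b" "1 \<le> a'" "1 \<le> b'" "\<bar>x\<bar> \<le> a + a'" "\<bar>x\<bar> \<le> b + b'"
  shows "x\<^sup>2 / ((a * b) * (a' * b')) \<le> 1 / (a * b) + 1 / (a' * b') + 1 / (a * b') + 1 / (a' * b)"
proof -
  have "x\<^sup>2 = \<bar>x\<bar> * \<bar>x\<bar>" by (simp add: power2_eq_square)
  also have "\<dots> \<le> (a + a') * (b + b')" using assms by (intro mult_mono) auto
  finally have "x\<^sup>2 / ((a * b) * (a' * b')) \<le> ((a + a') * (b + b')) / ((a * b) * (a' * b'))"
    using assms by (intro divide_right_mono) auto
  also have "\<dots> = 1 / (a * b) + 1 / (a' * b') + 1 / (a * b') + 1 / (a' * b)"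
    using assms by (simp add: field_simps)
  finally show ?thesis .
qed

section \<open>Smallness of the potential relative to the gap weight, and the error term\<close>

context potential begin

text \<open>For fixed j = k - m the four kernels are those with shifts 2n, 2n, 2n - j and 2n + j. If
  |j| \<le> n all shifts are at least n and give a factor n^(-1/2); if |j| > n no decay is used, and
  the tail of \<alpha> supplies the smallness.\<close>

lemma HS_gap:
  assumes n: "1 \<le> n"
  shows "(\<lambda>(k, m). (cmod (Q (k - m)))\<^sup>2 / (gap_weight n k * gap_weight n m)) summable_on UNIV"
    and "(\<Sum>\<^sub>\<infinity>(k, m). (cmod (Q (k - m)))\<^sup>2 / (gap_weight n k * gap_weight n m)) \<le>
      16 * zeta32 * (\<alpha>2 / sqrt (real n) + (\<Sum>\<^sub>\<infinity>j\<in>{j. \<bar>j\<bar> > int n}. (\<alpha> j)\<^sup>2))"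
proof -
  define g1 where "g1 = (\<lambda>k. 1 / gap_weight n k)"
  define g2 where "g2 = (\<lambda>j k. 1 / (\<bar>real_of_int (int n - k)\<bar> * \<bar>real_of_int (2 * int n - j - (int n - k))\<bar>))"
  define g3 where "g3 = (\<lambda>j k. 1 / (\<bar>real_of_int (k + int n)\<bar> * \<bar>real_of_int (2 * int n + j - (k + int n))\<bar>))"
  define h where "h = (\<lambda>j k. (cmod (Q j))\<^sup>2 / (gap_weight n k * gap_weight n (k - j)))"
  have hle: "h j k \<le> (\<alpha> j)\<^sup>2 * (g1 k + g1 (k - j) + g2 j k + g3 j k)" for j k
  proof -
    have nn: "0 \<le> g1 k + g1 (k - j) + g2 j k + g3 j k"
      unfolding g1_def g2_def g3_def by (intro add_nonneg_nonneg) simp_all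
    show ?thesis
    proof (cases "gap_weight n k = 0 \<or> gap_weight n (k - j) = 0")
      case True
      then have "h j k = 0" by (auto simp: h_def)
      then show ?thesis using nn by simp
    next
      case False
      define a b a' b' where "a = \<bar>real_of_int (int n - k)\<bar>" and "b = \<bar>real_of_int (int n + k)\<bar>"
        and "a' = \<bar>real_of_int (int n - (k - j))\<bar>" and "b' = \<bar>real_of_int (int n + (k - j))\<bar>"
      have "1 \<le> a" "1 \<le> b" "1 \<le> a'" "1 \<le> b'"
        using False unfolding gap_weight_zero_iff a_def b_def a'_def b'_def by linarith+
      moreover have "\<bar>real_of_int j\<bar> \<le> a + a'" "\<bar>real_of_int j\<bar> \<le> b + b'"
        unfolding a_def b_def a'_def b'_def by linarith+
      ultimately have "(real_of_int j)\<^sup>2 / ((a * b) * (a' * b')) \<le> 1 / (a * b) + 1 / (a' * b') + 1 / (a * b') + 1 / (a' * b)"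
        by (rule kernel_expansion)
      also have "1 / (a * b) = g1 k"
        by (simp add: g1_def gap_weight_def a_def b_def)
      also have "1 / (a' * b') = g1 (k - j)"
        by (simp add: g1_def gap_weight_def a'_def b'_def)
      also have "1 / (a * b') = g2 j k"
        unfolding g2_def a_def b'_def by (intro arg_cong2[where f = "\<lambda>u v. 1 / (\<bar>real_of_int u\<bar> * \<bar>real_of_int v\<bar>)"]) auto
      also have "1 / (a' * b) = g3 j k"
        unfolding g3_def a'_def b_def mult.commute[of "\<bar>real_of_int (k + int n)\<bar>"]
        by (intro arg_cong2[where f = "\<lambda>u v. 1 / (\<bar>real_of_int u\<bar> * \<bar>real_of_int v\<bar>)"]) auto
      finally have "(real_of_int j)\<^sup>2 / ((a * b) * (a' * b')) \<le> g1 k + g1 (k - j) + g2 j k + g3 j k" .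
      then have "(\<alpha> j)\<^sup>2 * ((real_of_int j)\<^sup>2 / ((a * b) * (a' * b'))) \<le> (\<alpha> j)\<^sup>2 * (g1 k + g1 (k - j) + g2 j k + g3 j k)"
        by (rule mult_left_mono) simp
      moreover have "h j k = (\<alpha> j)\<^sup>2 * ((real_of_int j)\<^sup>2 / ((a * b) * (a' * b')))"
        by (simp add: h_def norm_Q gap_weight_def a_def b_def a'_def b'_def)
      ultimately show ?thesis by simp
    qed
  qed
  let ?Z = "\<lambda>d::int. 4 * zeta32 / sqrt (max 1 \<bar>real_of_int d\<bar>)"
  let ?K = "\<lambda>d x. 1 / (\<bar>real_of_int x\<bar> * \<bar>real_of_int (d - x)\<bar>)"
  have g1K: "g1 = (\<lambda>k. ?K (2 * int n) (int n - k))"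
    by (simp add: g1_def gap_weight_def fun_eq_iff)
  have s1: "g1 summable_on UNIV" and b1: "infsum g1 UNIV \<le> ?Z (2 * int n)"
    unfolding g1K infsum_int_shift(1)[of "?K (2 * int n)" "int n"] infsum_int_shift(3)[of "?K (2 * int n)" "int n"]
    by (rule kernel_sum)+
  have s1': "(\<lambda>k. g1 (k - j)) summable_on UNIV" and b1': "(\<Sum>\<^sub>\<infinity>k. g1 (k - j)) \<le> ?Z (2 * int n)" for j
    using s1 b1 infsum_int_shift(2,4)[of g1 "- j"] by simp_all
  have s2: "g2 j summable_on UNIV" and b2: "infsum (g2 j) UNIV \<le> ?Z (2 * int n - j)" for j
    unfolding g2_def infsum_int_shift(1)[of "?K (2 * int n - j)" "int n"] infsum_int_shift(3)[of "?K (2 * int n - j)" "int n"]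
    by (rule kernel_sum)+
  have s3: "g3 j summable_on UNIV" and b3: "infsum (g3 j) UNIV \<le> ?Z (2 * int n + j)" for j
    unfolding g3_def infsum_int_shift(2)[of "?K (2 * int n + j)" "int n"] infsum_int_shift(4)[of "?K (2 * int n + j)" "int n"]
    by (rule kernel_sum)+
  define t where "t = (\<lambda>j. if \<bar>j\<bar> \<le> int n then 1 / sqrt (real n) else 1)"
  have Zt: "?Z d \<le> 4 * zeta32 * t j" if "\<bar>j\<bar> \<le> int n \<Longrightarrow> int n \<le> \<bar>d\<bar>" for d j
  proof (cases "\<bar>j\<bar> \<le> int n")
    case True
    with that have "real n \<le> max 1 \<bar>real_of_int d\<bar>" by linarith
    then have "1 / sqrt (max 1 \<bar>real_of_int d\<bar>) \<le> 1 / sqrt (real n)"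
      using n by (intro divide_left_mono) auto
    from mult_left_mono[OF this, of "4 * zeta32"] show ?thesis using True zeta32_nonneg by (simp add: t_def)
  next
    case False
    have "1 / sqrt (max 1 \<bar>real_of_int d\<bar>) \<le> 1" by simp
    from mult_left_mono[OF this, of "4 * zeta32"] show ?thesis using False zeta32_nonneg by (simp add: t_def)
  qed
  have rs: "(\<lambda>k. (\<alpha> j)\<^sup>2 * (g1 k + g1 (k - j) + g2 j k + g3 j k)) summable_on UNIV" for j
    by (intro summable_on_cmult_right summable_on_add s1 s1' s2 s3)
  have nn: "0 \<le> h j k" for j k by (simp add: h_def)
  have hs: "h j summable_on UNIV" for j
    by (rule summable_on_comparison_test[OF rs hle nn])
  have hb: "infsum (h j) UNIV \<le> 16 * zeta32 * ((\<alpha> j)\<^sup>2 * t j)" for j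
  proof -
    have "infsum (h j) UNIV \<le> (\<Sum>\<^sub>\<infinity>k. (\<alpha> j)\<^sup>2 * (g1 k + g1 (k - j) + g2 j k + g3 j k))"
      by (intro infsum_mono hs rs hle)
    also have "\<dots> = (\<alpha> j)\<^sup>2 * (infsum g1 UNIV + (\<Sum>\<^sub>\<infinity>k. g1 (k - j)) + infsum (g2 j) UNIV + infsum (g3 j) UNIV)"
      unfolding infsum_cmult_right' by (simp add: infsum_add summable_on_add s1 s1' s2 s3)
    also have "\<dots> \<le> (\<alpha> j)\<^sup>2 * (4 * zeta32 * t j + 4 * zeta32 * t j + 4 * zeta32 * t j + 4 * zeta32 * t j)"
      by (intro mult_left_mono add_mono order_trans[OF b1 Zt] order_trans[OF b1' Zt]
          order_trans[OF b2 Zt] order_trans[OF b3 Zt]) auto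
    finally show ?thesis by (simp add: mult_ac)
  qed
  have ts: "(\<lambda>j. (\<alpha> j)\<^sup>2 * t j) summable_on B" for B
  proof (rule summable_on_comparison_test)
    show "(\<lambda>j. (\<alpha> j)\<^sup>2) summable_on B" by (rule summable_on_subset_banach[OF \<alpha>_summable]) simp
    have "t j \<le> 1" "0 \<le> t j" for j using n by (auto simp: t_def)
    then show "(\<alpha> j)\<^sup>2 * t j \<le> (\<alpha> j)\<^sup>2" "0 \<le> (\<alpha> j)\<^sup>2 * t j" for j
      by (simp_all add: mult_left_le)
  qed
  note D = nonneg_double_sum[of h "\<lambda>j. 16 * zeta32 * ((\<alpha> j)\<^sup>2 * t j)", OF nn hs hb summable_on_cmult_right[OF ts]]
  note R = reparametrize_pairs[of h]
  show "(\<lambda>(k, m). (cmod (Q (k - m)))\<^sup>2 / (gap_weight n k * gap_weight n m)) summable_on UNIV"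
    using D(1) R(1) by (simp add: h_def)
  have "(\<Sum>\<^sub>\<infinity>(k, m). (cmod (Q (k - m)))\<^sup>2 / (gap_weight n k * gap_weight n m)) \<le> 16 * zeta32 * (\<Sum>\<^sub>\<infinity>j. (\<alpha> j)\<^sup>2 * t j)"
    using D(2) R(2) unfolding infsum_cmult_right' by (simp add: h_def)
  also have "(\<Sum>\<^sub>\<infinity>j. (\<alpha> j)\<^sup>2 * t j) \<le> \<alpha>2 / sqrt (real n) + (\<Sum>\<^sub>\<infinity>j\<in>{j. \<bar>j\<bar> > int n}. (\<alpha> j)\<^sup>2)"
  proof -
    have sub: "(\<lambda>j. (\<alpha> j)\<^sup>2) summable_on B" for B by (rule summable_on_subset_banach[OF \<alpha>_summable]) simp
    have U: "UNIV = {j. \<bar>j\<bar> \<le> int n} \<union> {j. \<bar>j\<bar> > int n}" by auto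
    have "(\<Sum>\<^sub>\<infinity>j. (\<alpha> j)\<^sup>2 * t j) = (\<Sum>\<^sub>\<infinity>j\<in>{j. \<bar>j\<bar> \<le> int n}. (\<alpha> j)\<^sup>2 * t j) + (\<Sum>\<^sub>\<infinity>j\<in>{j. \<bar>j\<bar> > int n}. (\<alpha> j)\<^sup>2 * t j)"
      by (subst U, subst infsum_Un_disjoint) (auto intro: ts)
    also have "(\<Sum>\<^sub>\<infinity>j\<in>{j. \<bar>j\<bar> \<le> int n}. (\<alpha> j)\<^sup>2 * t j) = (\<Sum>\<^sub>\<infinity>j\<in>{j. \<bar>j\<bar> \<le> int n}. (\<alpha> j)\<^sup>2 * (1 / sqrt (real n)))"
      by (intro infsum_cong) (simp add: t_def)
    also have "\<dots> = (\<Sum>\<^sub>\<infinity>j\<in>{j. \<bar>j\<bar> \<le> int n}. (\<alpha> j)\<^sup>2) * (1 / sqrt (real n))"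
      by (rule infsum_cmult_left')
    also have "\<dots> \<le> \<alpha>2 * (1 / sqrt (real n))"
      unfolding \<alpha>2_def by (intro mult_right_mono infsum_mono2 sub) auto
    also have "(\<Sum>\<^sub>\<infinity>j\<in>{j. \<bar>j\<bar> > int n}. (\<alpha> j)\<^sup>2 * t j) = (\<Sum>\<^sub>\<infinity>j\<in>{j. \<bar>j\<bar> > int n}. (\<alpha> j)\<^sup>2)"
      by (intro infsum_cong) (simp add: t_def)
    finally show ?thesis by simp
  qed
  finally show "(\<Sum>\<^sub>\<infinity>(k, m). (cmod (Q (k - m)))\<^sup>2 / (gap_weight n k * gap_weight n m)) \<le>
      16 * zeta32 * (\<alpha>2 / sqrt (real n) + (\<Sum>\<^sub>\<infinity>j\<in>{j. \<bar>j\<bar> > int n}. (\<alpha> j)\<^sup>2))"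
    using zeta32_nonneg by (simp add: mult_left_mono)
qed

text \<open>The bound 1 says that on sequences vanishing at \<plusminus>n the potential is at most
  the form of \<open>gap_weight\<close> itself, well below the factor pi^2 that the kinetic energy
  provides.\<close>

lemma HS_gap_small:
  "\<exists>n0\<ge>1. \<forall>n\<ge>n0. (\<Sum>\<^sub>\<infinity>(k, m). (cmod (Q (k - m)))\<^sup>2 / (gap_weight n k * gap_weight n m)) \<le> 1"
proof -
  have "(\<lambda>n. 16 * zeta32 * (\<alpha>2 / sqrt (real n) + (\<Sum>\<^sub>\<infinity>j\<in>{j. \<bar>j\<bar> > int n}. (\<alpha> j)\<^sup>2))) \<longlonglongrightarrow> 16 * zeta32 * (0 + 0)"
    by (intro tendsto_intros int_tail_LIMSEQ \<alpha>_summable tendsto_divide_0[OF tendsto_const] filterlim_at_top_imp_at_infinity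
        filterlim_compose[OF sqrt_at_top] filterlim_real_sequentially) simp
  then have "\<forall>\<^sub>F n in sequentially. 16 * zeta32 * (\<alpha>2 / sqrt (real n) + (\<Sum>\<^sub>\<infinity>j\<in>{j. \<bar>j\<bar> > int n}. (\<alpha> j)\<^sup>2)) < 1"
    using order_tendstoD(2)[of _ "16 * zeta32 * (0 + 0)" sequentially 1] by simp
  then obtain n0 where n0: "\<And>n. n0 \<le> n \<Longrightarrow> 16 * zeta32 * (\<alpha>2 / sqrt (real n) + (\<Sum>\<^sub>\<infinity>j\<in>{j. \<bar>j\<bar> > int n}. (\<alpha> j)\<^sup>2)) < 1"
    by (auto simp: eventually_sequentially)
  have "(\<Sum>\<^sub>\<infinity>(k, m). (cmod (Q (k - m)))\<^sup>2 / (gap_weight n k * gap_weight n m)) \<le> 1" if "max 1 n0 \<le> n" for n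
    using HS_gap(2)[of n] n0[of n] that by linarith
  then show ?thesis by (intro exI[of _ "max 1 n0"]) simp
qed

text \<open>The squared dual norm, relative to \<open>gap_weight\<close>, of the column of the
  potential at n: the strength of the coupling of the n-th mode to modes other than \<plusminus>n.
  The terms k = \<plusminus>n are 0 by division by 0, so the resonant entry Q(2n) is
  excluded.\<close>

definition gap_error :: "nat \<Rightarrow> real" where
  "gap_error n = (\<Sum>\<^sub>\<infinity>k. (cmod (Q (k - int n)))\<^sup>2 / gap_weight n k)"

lemma gap_error_summable:
  "(\<lambda>k. (cmod (Q (k - int n)))\<^sup>2 / gap_weight n k) summable_on UNIV"
proof (rule summable_on_comparison_test)
  have "(\<lambda>k. (\<alpha> (k - int n))\<^sup>2) summable_on UNIV"
    using infsum_int_shift(4)[of "\<lambda>k. (\<alpha> k)\<^sup>2" "- int n"] \<alpha>_summable by simp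
  then show "(\<lambda>k. (\<alpha> (k - int n))\<^sup>2 * (1 + 2 * real n)) summable_on UNIV" by (rule summable_on_cmult_left)
  fix k
  show "(cmod (Q (k - int n)))\<^sup>2 / gap_weight n k \<le> (\<alpha> (k - int n))\<^sup>2 * (1 + 2 * real n)"
  proof (cases "gap_weight n k = 0")
    case False
    define x y where "x = \<bar>real_of_int (int n - k)\<bar>" and "y = \<bar>real_of_int (int n + k)\<bar>"
    have xy: "1 \<le> x" "1 \<le> y" using False unfolding gap_weight_zero_iff x_def y_def by linarith+
    have "x \<le> y + 2 * real n" unfolding x_def y_def by linarith
    also have "\<dots> \<le> y * (1 + 2 * real n)" using xy mult_right_mono[of 1 y "2 * real n"] by (simp add: distrib_left)
    finally have "x / y \<le> 1 + 2 * real n" using xy by (simp add: field_simps)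
    then have "(\<alpha> (k - int n))\<^sup>2 * (x / y) \<le> (\<alpha> (k - int n))\<^sup>2 * (1 + 2 * real n)"
      by (rule mult_left_mono) simp
    moreover have "(real_of_int (k - int n))\<^sup>2 = x\<^sup>2" unfolding x_def power2_abs by (simp add: power2_eq_square algebra_simps)
    then have "(cmod (Q (k - int n)))\<^sup>2 / gap_weight n k = (\<alpha> (k - int n))\<^sup>2 * (x / y)"
      unfolding norm_Q gap_weight_def x_def[symmetric] y_def[symmetric] using xy by (simp add: power2_eq_square)
    ultimately show ?thesis by simp
  qed simp
qed simp

lemma gap_error_nonneg: "0 \<le> gap_error n"
  unfolding gap_error_def by (rule infsum_nonneg) simp

lemma norm_Q_uminus: "cmod (Q (- j)) = cmod (Q j)"
  by (simp add: Q_hermitian)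

lemma gap_error_reflect:
  "(\<lambda>k. (cmod (Q (k + int n)))\<^sup>2 / gap_weight n k) summable_on UNIV"
  "(\<Sum>\<^sub>\<infinity>k. (cmod (Q (k + int n)))\<^sup>2 / gap_weight n k) = gap_error n"
proof -
  have eq: "(cmod (Q (k + int n)))\<^sup>2 / gap_weight n k = (cmod (Q (0 - k - int n)))\<^sup>2 / gap_weight n (0 - k)" for k
    using norm_Q_uminus[of "k + int n"] gap_weight_uminus[of n k] by (simp add: algebra_simps)
  show "(\<lambda>k. (cmod (Q (k + int n)))\<^sup>2 / gap_weight n k) summable_on UNIV"
    unfolding eq infsum_int_shift(3)[of "\<lambda>k. (cmod (Q (k - int n)))\<^sup>2 / gap_weight n k" 0] by (rule gap_error_summable)
  show "(\<Sum>\<^sub>\<infinity>k. (cmod (Q (k + int n)))\<^sup>2 / gap_weight n k) = gap_error n"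
    unfolding eq infsum_int_shift(1)[of "\<lambda>k. (cmod (Q (k - int n)))\<^sup>2 / gap_weight n k" 0] gap_error_def ..
qed

text \<open>Keeps the resonant entry below the least nonzero value of \<open>gap_weight\<close>, so
  that moving the level by |Q(2n)| cannot change the sign of the form at the other modes.\<close>

lemma Q_eventually_small: "\<exists>n0. \<forall>n\<ge>n0. cmod (Q (2 * int n)) \<le> real n"
proof -
  obtain K where K: "\<And>n. K \<le> n \<Longrightarrow> (\<Sum>\<^sub>\<infinity>j\<in>{j. \<bar>j\<bar> > int n}. (\<alpha> j)\<^sup>2) \<le> 1 / 4"
    using int_tail_tendsto_0[OF \<alpha>_summable, of "1/4"] by auto
  have "cmod (Q (2 * int n)) \<le> real n" if n: "max K 1 \<le> n" for n
  proof -
    have s: "(\<lambda>j. (\<alpha> j)\<^sup>2) summable_on {j. \<bar>j\<bar> > int n}" by (rule summable_on_subset_banach[OF \<alpha>_summable]) simp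
    have "(\<alpha> (2 * int n))\<^sup>2 \<le> (\<Sum>\<^sub>\<infinity>j\<in>{j. \<bar>j\<bar> > int n}. (\<alpha> j)\<^sup>2)"
      using finite_sum_le_infsum[OF s, of "{2 * int n}"] n by simp
    also have "\<dots> \<le> (1 / 2)\<^sup>2" using K[of n] n by (simp add: power_divide)
    finally have "\<alpha> (2 * int n) \<le> 1 / 2" by (rule power2_le_imp_le) simp
    then show ?thesis using n by (simp add: \<alpha>_def field_simps)
  qed
  then show ?thesis by blast
qed

end

section \<open>Trial vectors at the n-th gap and estimates for its two edges\<close>

context shifted_potential begin

text \<open>The vector \<open>e\<^sub>n + \<tau> e\<^sub>-\<^sub>n\<close> spanning one direction of the two-dimensional eigenspace of
  the free operator at \<open>n\<^sup>2\<pi>\<^sup>2\<close>.\<close>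

definition pair_vec :: "nat \<Rightarrow> complex \<Rightarrow> int \<Rightarrow> complex" where
  "pair_vec n \<tau> k = (if k = int n then 1 else if k = - int n then \<tau> else 0)"

lemma pair_vec_mem: "pair_vec n \<tau> \<in> X"
  by (rule X_finite) (auto simp: pair_vec_def intro: finite_subset[of _ "{int n, - int n}"])

lemma Qop_pair_vec:
  assumes n: "1 \<le> n"
  shows "Qop (pair_vec n \<tau>) k = Q (k - int n) + \<tau> * Q (k + int n)"
proof -
  have "Qop (pair_vec n \<tau>) k = (\<Sum>\<^sub>\<infinity>m\<in>{int n, - int n}. Q (k - m) * pair_vec n \<tau> m)"
    unfolding Qop_def by (rule infsum_cong_neutral) (auto simp: pair_vec_def)
  also have "\<dots> = Q (k - int n) + \<tau> * Q (k + int n)"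
    using n by (simp add: pair_vec_def)
  finally show ?thesis .
qed

lemma N_pair_vec:
  assumes n: "1 \<le> n" and \<tau>: "cmod \<tau> = 1"
  shows "Re (N (pair_vec n \<tau>) (pair_vec n \<tau>)) = 2 * Re (\<tau> * Q (2 * int n))"
proof -
  have "N (pair_vec n \<tau>) (pair_vec n \<tau>) = (\<Sum>\<^sub>\<infinity>k\<in>{int n, - int n}. Qop (pair_vec n \<tau>) k * cnj (pair_vec n \<tau> k))"
    unfolding N_def by (rule infsum_cong_neutral) (auto simp: pair_vec_def)
  also have "\<dots> = \<tau> * Q (2 * int n) + cnj (\<tau> * Q (2 * int n))"
    using n Q_hermitian[of "2 * int n"] by (simp add: pair_vec_def Qop_pair_vec Q_zero mult.commute)
  finally show ?thesis by simp
qed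

lemma gap_weight_le_wt: "gap_weight n k \<le> (1 + (real n)\<^sup>2) * wt k"
proof -
  have 1: "gap_weight n k \<le> (real_of_int k)\<^sup>2 + (real n)\<^sup>2" unfolding gap_weight_eq by (auto simp: abs_if)
  have "(real_of_int k)\<^sup>2 \<le> pi\<^sup>2 * (real_of_int k)\<^sup>2"
    using mult_right_mono[of 1 "pi\<^sup>2" "(real_of_int k)\<^sup>2"] pi_gt3 by (simp add: one_le_power)
  then have "(real_of_int k)\<^sup>2 \<le> wt k" using c_ge_1 by (simp add: wt_def)
  moreover have "(real n)\<^sup>2 * 1 \<le> (real n)\<^sup>2 * wt k" using wt_ge_1 by (intro mult_left_mono) auto
  ultimately have "(real_of_int k)\<^sup>2 + (real n)\<^sup>2 \<le> (1 + (real n)\<^sup>2) * wt k" by (simp add: distrib_right)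
  with 1 show ?thesis by linarith
qed

lemma gap_weight_summable:
  assumes f: "f \<in> X"
  shows "(\<lambda>k. gap_weight n k * (cmod (f k))\<^sup>2) summable_on UNIV"
proof (rule summable_on_comparison_test[OF summable_on_cmult_right[OF X_D[OF f], of "1 + (real n)\<^sup>2"]])
  show "gap_weight n k * (cmod (f k))\<^sup>2 \<le> (1 + (real n)\<^sup>2) * (wt k * (cmod (f k))\<^sup>2)" for k
    using mult_right_mono[OF gap_weight_le_wt, of "(cmod (f k))\<^sup>2" n k] by (simp add: mult.assoc)
qed simp

text \<open>Splits f = v + a u with \<open>u\<close> the pair vector and \<open>v\<close> vanishing
  at \<plusminus>n. The part in \<open>v\<close> is at most Y, the form of the weight at v; the
  mixed part is, by 2xy \<le> x^2 + y^2, at most Y plus 4 times the error times |a|^2; the part in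
  \<open>u\<close> is the resonant term. Since \<open>u\<close> has squared norm 2, the 4 becomes a
  2 in the eigenvalue bounds.\<close>

lemma N_near_pair:
  assumes n: "1 \<le> n" and \<tau>: "cmod \<tau> = 1" and f: "f \<in> X" and f\<tau>: "f (- int n) = \<tau> * f (int n)"
    and HS: "(\<Sum>\<^sub>\<infinity>(k, m). (cmod (Q (k - m)))\<^sup>2 / (gap_weight n k * gap_weight n m)) \<le> 1"
  shows "\<bar>Re (N f f) - 2 * (cmod (f (int n)))\<^sup>2 * Re (\<tau> * Q (2 * int n))\<bar> \<le>
     2 * (\<Sum>\<^sub>\<infinity>k. gap_weight n k * (cmod (f k))\<^sup>2) + 4 * gap_error n * (cmod (f (int n)))\<^sup>2"
proof -
  define u where "u = pair_vec n \<tau>"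
  define a where "a = f (int n)"
  define v where "v = (\<lambda>k. if k = int n \<or> k = - int n then 0 else f k)"
  have u: "u \<in> X" unfolding u_def by (rule pair_vec_mem)
  have f_eq: "f = (\<lambda>k. v k + a * u k)"
    using f\<tau> n by (auto simp: v_def a_def u_def pair_vec_def fun_eq_iff)
  have v: "v \<in> X"
  proof -
    have "v = (\<lambda>k. f k - a * u k)"
      using f\<tau> n by (auto simp: v_def a_def u_def pair_vec_def fun_eq_iff)
    then show ?thesis using S.diff_mem[OF f S.scale_mem[OF u, of a]] by simp
  qed
  define Y where "Y = (\<Sum>\<^sub>\<infinity>k. gap_weight n k * (cmod (v k))\<^sup>2)"
  have Yf: "Y = (\<Sum>\<^sub>\<infinity>k. gap_weight n k * (cmod (f k))\<^sup>2)"
    unfolding Y_def by (intro infsum_cong) (auto simp: v_def gap_weight_zero_iff)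
  have Y0: "0 \<le> Y" unfolding Y_def by (rule infsum_nonneg) simp
  have v0: "gap_weight n k = 0 \<Longrightarrow> v k = 0" for k by (auto simp: gap_weight_zero_iff v_def)
  have vs: "(\<lambda>k. gap_weight n k * (cmod (v k))\<^sup>2) summable_on UNIV" by (rule gap_weight_summable[OF v])
  have Nvv: "cmod (N v v) \<le> Y"
  proof -
    note K = kernel_form_bound[of "gap_weight n" Q 1 v v, OF gap_weight_nonneg HS_gap(1)[OF n] HS vs v0 vs v0]
    have "cmod (N v v) \<le> (\<Sum>\<^sub>\<infinity>x. cmod (case x of (k, m) \<Rightarrow> Q (k - m) * v m * cnj (v k)))"
      unfolding N_eq_pairs(1)[OF v v]
    proof (rule norm_infsum_bound)
      show "(\<lambda>x. cmod (case x of (k, m) \<Rightarrow> Q (k - m) * v m * cnj (v k))) summable_on UNIV"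
        using K(1) by (simp only: case_prod_unfold)
    qed
    also have "\<dots> = (\<Sum>\<^sub>\<infinity>(k, m). cmod (Q (k - m) * v m * cnj (v k)))"
      by (intro infsum_cong) auto
    also have "\<dots> \<le> Y" using K(2) Y0 by (simp add: Y_def)
    finally show ?thesis .
  qed
  \<comment> \<open>The image of \<open>u\<close> is the sum of the columns at n and -n up to a
    phase. Each contributes one \<open>gap_error\<close> by reflection, and (x + y)^2 \<le> 2 x^2 +
    2 y^2 makes the total 4.\<close>
  have Nuv: "cmod (N u v) \<le> sqrt (4 * gap_error n) * sqrt Y"
  proof -
    have Qu: "Qop u k = Q (k - int n) + \<tau> * Q (k + int n)" for k
      unfolding u_def by (rule Qop_pair_vec[OF n])
    let ?p = "\<lambda>k. (cmod (Q (k - int n)))\<^sup>2 / gap_weight n k"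
    let ?r = "\<lambda>k. (cmod (Q (k + int n)))\<^sup>2 / gap_weight n k"
    have bs: "(\<lambda>k. 2 * ?p k + 2 * ?r k) summable_on UNIV"
      by (intro summable_on_add summable_on_cmult_right gap_error_summable gap_error_reflect)
    have le: "(cmod (Qop u k) / sqrt (gap_weight n k))\<^sup>2 \<le> 2 * ?p k + 2 * ?r k" for k
    proof -
      have "(cmod (Qop u k))\<^sup>2 \<le> (cmod (Q (k - int n)) + cmod (Q (k + int n)))\<^sup>2"
        unfolding Qu using norm_triangle_ineq[of "Q (k - int n)" "\<tau> * Q (k + int n)"] \<tau>
        by (intro power_mono) (simp_all add: norm_mult)
      also have "\<dots> \<le> 2 * (cmod (Q (k - int n)))\<^sup>2 + 2 * (cmod (Q (k + int n)))\<^sup>2"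
        using zero_le_power2[of "cmod (Q (k - int n)) - cmod (Q (k + int n))"]
        by (simp add: power2_eq_square algebra_simps)
      finally have "(cmod (Qop u k))\<^sup>2 / gap_weight n k \<le>
          (2 * (cmod (Q (k - int n)))\<^sup>2 + 2 * (cmod (Q (k + int n)))\<^sup>2) / gap_weight n k"
        by (rule divide_right_mono) simp
      then show ?thesis by (simp add: power_divide add_divide_distrib)
    qed
    have 1: "(\<lambda>k. (cmod (Qop u k) / sqrt (gap_weight n k))\<^sup>2) summable_on UNIV"
      by (rule summable_on_comparison_test[OF bs le]) simp
    have 2: "(\<lambda>k. (sqrt (gap_weight n k) * cmod (v k))\<^sup>2) summable_on UNIV"
      using vs by (simp add: power_mult_distrib)
    have eq: "\<bar>cmod (Qop u k) / sqrt (gap_weight n k) * (sqrt (gap_weight n k) * cmod (v k))\<bar> = cmod (Qop u k * cnj (v k))" for k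
      using v0[of k] by (cases "gap_weight n k = 0") (simp_all add: norm_mult abs_mult)
    have "cmod (N u v) \<le> (\<Sum>\<^sub>\<infinity>k. cmod (Qop u k * cnj (v k)))"
      unfolding N_def by (rule norm_infsum_bound[OF N_eq_pairs(3)[OF u v]])
    also have "\<dots> \<le> sqrt (\<Sum>\<^sub>\<infinity>k. (cmod (Qop u k) / sqrt (gap_weight n k))\<^sup>2) * sqrt Y"
      using infsum_Cauchy_Schwarz(2)[OF 1 2] unfolding eq by (simp add: power_mult_distrib Y_def)
    also have "\<dots> \<le> sqrt (4 * gap_error n) * sqrt Y"
    proof (intro mult_right_mono real_sqrt_le_mono)
      have "(\<Sum>\<^sub>\<infinity>k. (cmod (Qop u k) / sqrt (gap_weight n k))\<^sup>2) \<le> (\<Sum>\<^sub>\<infinity>k. 2 * ?p k + 2 * ?r k)"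
        by (intro infsum_mono 1 bs le)
      also have "\<dots> = 2 * infsum ?p UNIV + 2 * infsum ?r UNIV"
        unfolding infsum_cmult_right'[symmetric]
        by (intro infsum_add summable_on_cmult_right gap_error_summable gap_error_reflect)
      finally show "(\<Sum>\<^sub>\<infinity>k. (cmod (Qop u k) / sqrt (gap_weight n k))\<^sup>2) \<le> 4 * gap_error n"
        by (simp add: gap_error_reflect(2) gap_error_def[symmetric])
    qed (simp add: Y0)
    finally show ?thesis .
  qed
  have expand: "Re (N f f) = Re (N v v) + 2 * Re (cnj a * N v u) + (cmod a)\<^sup>2 * Re (N u u)"
    unfolding f_eq using u v N.diagonal_scale[OF u, of a]
    by (subst N.diagonal_add) (auto simp: scale_X N.scale_right)
  have cross: "2 * \<bar>Re (cnj a * N v u)\<bar> \<le> Y + 4 * gap_error n * (cmod a)\<^sup>2"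
  proof -
    have "N v u = cnj (N u v)" by (rule N.hermitian[OF u v])
    then have "\<bar>Re (cnj a * N v u)\<bar> \<le> cmod a * cmod (N u v)"
      using abs_Re_le_cmod[of "cnj a * N v u"] by (simp add: norm_mult)
    also have "\<dots> \<le> cmod a * (sqrt (4 * gap_error n) * sqrt Y)"
      using Nuv by (rule mult_left_mono) simp
    finally have "2 * \<bar>Re (cnj a * N v u)\<bar> \<le> 2 * (sqrt Y * (sqrt (4 * gap_error n) * cmod a))"
      by (simp add: mult_ac)
    also have "\<dots> \<le> (sqrt Y)\<^sup>2 + (sqrt (4 * gap_error n) * cmod a)\<^sup>2"
      using zero_le_power2[of "sqrt Y - sqrt (4 * gap_error n) * cmod a"]
      by (simp add: power2_eq_square algebra_simps)
    also have "\<dots> = Y + 4 * gap_error n * (cmod a)\<^sup>2"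
      using Y0 gap_error_nonneg[of n] by (simp add: power_mult_distrib)
    finally show ?thesis .
  qed
  have "Re (N u u) = 2 * Re (\<tau> * Q (2 * int n))" unfolding u_def by (rule N_pair_vec[OF n \<tau>])
  then have "Re (N f f) - 2 * (cmod a)\<^sup>2 * Re (\<tau> * Q (2 * int n)) = Re (N v v) + 2 * Re (cnj a * N v u)"
    using expand by simp
  moreover have "\<bar>Re (N v v)\<bar> \<le> Y" using Nvv abs_Re_le_cmod[of "N v v"] by linarith
  ultimately have "\<bar>Re (N f f) - 2 * (cmod a)\<^sup>2 * Re (\<tau> * Q (2 * int n))\<bar> \<le> 2 * Y + 4 * gap_error n * (cmod a)\<^sup>2"
    using cross by linarith
  then show ?thesis unfolding Yf a_def .
qed

lemma shifted_form_diag: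
  assumes f: "f \<in> X"
  shows "Re (A f f) - (\<mu> + c) * Re (S f f) = (\<Sum>\<^sub>\<infinity>k. (pi\<^sup>2 * (real_of_int k)\<^sup>2 - \<mu>) * (cmod (f k))\<^sup>2) + Re (N f f)"
    and "(\<lambda>k. (pi\<^sup>2 * (real_of_int k)\<^sup>2 - \<mu>) * (cmod (f k))\<^sup>2) summable_on UNIV"
proof -
  have eq: "(pi\<^sup>2 * (real_of_int k)\<^sup>2 - \<mu>) * (cmod (f k))\<^sup>2 = wt k * (cmod (f k))\<^sup>2 + (- (\<mu> + c)) * (cmod (f k))\<^sup>2" for k
    by (simp add: wt_def algebra_simps)
  show "(\<lambda>k. (pi\<^sup>2 * (real_of_int k)\<^sup>2 - \<mu>) * (cmod (f k))\<^sup>2) summable_on UNIV"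
    unfolding eq by (intro summable_on_add summable_on_cmult_right X_D f sq_norm_summable)
  have "(\<Sum>\<^sub>\<infinity>k. (pi\<^sup>2 * (real_of_int k)\<^sup>2 - \<mu>) * (cmod (f k))\<^sup>2) = W f + (- (\<mu> + c)) * (\<Sum>\<^sub>\<infinity>k. (cmod (f k))\<^sup>2)"
    unfolding eq W_def infsum_cmult_right'[symmetric]
    by (intro infsum_add summable_on_cmult_right X_D f sq_norm_summable)
  then show "Re (A f f) - (\<mu> + c) * Re (S f f) = (\<Sum>\<^sub>\<infinity>k. (pi\<^sup>2 * (real_of_int k)\<^sup>2 - \<mu>) * (cmod (f k))\<^sup>2) + Re (N f f)"
    by (simp add: A_diag[OF f] S_diag[OF f] algebra_simps)
qed

lemma infsum_pair:
  assumes n: "1 \<le> n"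
  shows "(\<Sum>\<^sub>\<infinity>k. if k = int n \<or> k = - int n then x else 0) = 2 * (x::real)"
    and "(\<lambda>k. if k = int n \<or> k = - int n then x else (0::real)) summable_on UNIV"
proof -
  have "(\<Sum>\<^sub>\<infinity>k. if k = int n \<or> k = - int n then x else 0) = (\<Sum>\<^sub>\<infinity>k\<in>{int n, - int n}. x)"
    by (rule infsum_cong_neutral) auto
  then show "(\<Sum>\<^sub>\<infinity>k. if k = int n \<or> k = - int n then x else 0) = 2 * x" using n by simp
  show "(\<lambda>k. if k = int n \<or> k = - int n then x else (0::real)) summable_on UNIV"
    by (rule finite_nonzero_values_imp_summable_on) (auto intro: finite_subset[of _ "{int n, - int n}"])
qed

lemma pi2_ge: "9 \<le> pi\<^sup>2"
proof -
  have "3\<^sup>2 \<le> pi\<^sup>2" using pi_gt3 by (intro power_mono) auto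
  then show ?thesis by simp
qed

text \<open>The level is chosen so that the kinetic terms at \<plusminus>n cancel the resonant term
  and the error exactly. At |k| < n the kinetic deficit is at least 9 times the weight; twice the
  weight is spent on the potential, and the rest exceeds \<rho> because the weight is at least
  n.\<close>

lemma form_upper:
  assumes n: "1 \<le> n" and \<tau>: "cmod \<tau> = 1" and f: "f \<in> X" and f\<tau>: "f (- int n) = \<tau> * f (int n)"
    and HS: "(\<Sum>\<^sub>\<infinity>(k, m). (cmod (Q (k - m)))\<^sup>2 / (gap_weight n k * gap_weight n m)) \<le> 1"
    and supp: "\<And>k. \<bar>k\<bar> > int n \<Longrightarrow> f k = 0"
    and \<rho>: "Re (\<tau> * Q (2 * int n)) = - \<rho>" "\<rho> \<le> real n"
  shows "Re (A f f) \<le> (pi\<^sup>2 * (real n)\<^sup>2 - \<rho> + 2 * gap_error n + c) * Re (S f f)"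
proof -
  define \<mu> where "\<mu> = pi\<^sup>2 * (real n)\<^sup>2 - \<rho> + 2 * gap_error n"
  let ?g = "\<lambda>k. gap_weight n k * (cmod (f k))\<^sup>2"
  let ?h = "\<lambda>k. (pi\<^sup>2 * (real_of_int k)\<^sup>2 - \<mu>) * (cmod (f k))\<^sup>2"
  let ?x = "(pi\<^sup>2 * (real n)\<^sup>2 - \<mu>) * (cmod (f (int n)))\<^sup>2"
  have le: "?h k + 2 * ?g k \<le> (if k = int n \<or> k = - int n then ?x else 0)" for k
  proof (cases "k = int n \<or> k = - int n")
    case True
    then have "gap_weight n k = 0" "(real_of_int k)\<^sup>2 = (real n)\<^sup>2" "cmod (f k) = cmod (f (int n))"
      using f\<tau> \<tau> by (auto simp: gap_weight_zero_iff norm_mult)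
    then show ?thesis using True by simp
  next
    case False
    show ?thesis
    proof (cases "\<bar>k\<bar> > int n")
      case True
      then show ?thesis using supp False by simp
    next
      case le: False
      have "\<bar>real_of_int k\<bar> \<le> real n" using le by linarith
      then have "(real_of_int k)\<^sup>2 \<le> (real n)\<^sup>2" using power_mono[of "\<bar>real_of_int k\<bar>" "real n" 2] by simp
      then have gw: "gap_weight n k = (real n)\<^sup>2 - (real_of_int k)\<^sup>2" by (simp add: gap_weight_eq)
      have gn: "real n \<le> gap_weight n k" using False by (intro gap_weight_ge) auto
      have "9 * gap_weight n k \<le> pi\<^sup>2 * gap_weight n k" by (intro mult_right_mono pi2_ge) simp
      then have "pi\<^sup>2 * (real_of_int k)\<^sup>2 - \<mu> + 2 * gap_weight n k \<le> 0"
        using gn \<rho>(2) gap_error_nonneg[of n] unfolding gw \<mu>_def by (simp add: right_diff_distrib)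
      then have "(pi\<^sup>2 * (real_of_int k)\<^sup>2 - \<mu> + 2 * gap_weight n k) * (cmod (f k))\<^sup>2 \<le> 0"
        by (rule mult_nonpos_nonneg) simp
      then show ?thesis using False by (simp add: algebra_simps)
    qed
  qed
  have gs: "?g summable_on UNIV" by (rule gap_weight_summable[OF f])
  note hs = shifted_form_diag(2)[OF f, of \<mu>]
  have "infsum ?h UNIV + 2 * infsum ?g UNIV = (\<Sum>\<^sub>\<infinity>k. ?h k + 2 * ?g k)"
    unfolding infsum_cmult_right'[symmetric] by (intro infsum_add[symmetric] summable_on_cmult_right hs gs)
  also have "\<dots> \<le> (\<Sum>\<^sub>\<infinity>k. if k = int n \<or> k = - int n then ?x else 0)"
    by (intro infsum_mono summable_on_add summable_on_cmult_right hs gs infsum_pair(2)[OF n] le)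
  also have "\<dots> = 2 * ?x" by (rule infsum_pair(1)[OF n])
  finally have 1: "infsum ?h UNIV + 2 * infsum ?g UNIV \<le> 2 * ?x" .
  have 2: "Re (N f f) \<le> 2 * (cmod (f (int n)))\<^sup>2 * (- \<rho>) + (2 * infsum ?g UNIV + 4 * gap_error n * (cmod (f (int n)))\<^sup>2)"
    using N_near_pair[OF n \<tau> f f\<tau> HS] unfolding \<rho>(1) by linarith
  have "2 * ?x = 2 * (cmod (f (int n)))\<^sup>2 * \<rho> - 4 * gap_error n * (cmod (f (int n)))\<^sup>2"
    by (simp add: \<mu>_def algebra_simps)
  then have "infsum ?h UNIV + Re (N f f) \<le> 0" using 1 2 by linarith
  then show ?thesis using shifted_form_diag(1)[OF f, of \<mu>] unfolding \<mu>_def[symmetric] by linarith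
qed

text \<open>The mirror image of \<open>form_upper\<close>, with the kinetic excess at |k| > n in
  place of the deficit at |k| < n.\<close>

lemma form_lower:
  assumes n: "1 \<le> n" and \<tau>: "cmod \<tau> = 1" and f: "f \<in> X" and f\<tau>: "f (- int n) = \<tau> * f (int n)"
    and HS: "(\<Sum>\<^sub>\<infinity>(k, m). (cmod (Q (k - m)))\<^sup>2 / (gap_weight n k * gap_weight n m)) \<le> 1"
    and supp: "\<And>k. \<bar>k\<bar> < int n \<Longrightarrow> f k = 0"
    and \<rho>: "Re (\<tau> * Q (2 * int n)) = \<rho>" "\<rho> \<le> real n"
  shows "(pi\<^sup>2 * (real n)\<^sup>2 + \<rho> - 2 * gap_error n + c) * Re (S f f) \<le> Re (A f f)"
proof -
  define \<mu> where "\<mu> = pi\<^sup>2 * (real n)\<^sup>2 + \<rho> - 2 * gap_error n"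
  let ?g = "\<lambda>k. gap_weight n k * (cmod (f k))\<^sup>2"
  let ?h = "\<lambda>k. (pi\<^sup>2 * (real_of_int k)\<^sup>2 - \<mu>) * (cmod (f k))\<^sup>2"
  let ?x = "(pi\<^sup>2 * (real n)\<^sup>2 - \<mu>) * (cmod (f (int n)))\<^sup>2"
  have le: "(if k = int n \<or> k = - int n then ?x else 0) \<le> ?h k + (- 2) * ?g k" for k
  proof (cases "k = int n \<or> k = - int n")
    case True
    then have "gap_weight n k = 0" "(real_of_int k)\<^sup>2 = (real n)\<^sup>2" "cmod (f k) = cmod (f (int n))"
      using f\<tau> \<tau> by (auto simp: gap_weight_zero_iff norm_mult)
    then show ?thesis using True by simp
  next
    case False
    show ?thesis
    proof (cases "\<bar>k\<bar> < int n")
      case True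
      then show ?thesis using supp False by simp
    next
      case le: False
      have "real n \<le> \<bar>real_of_int k\<bar>" using le by linarith
      then have "(real n)\<^sup>2 \<le> (real_of_int k)\<^sup>2" using power_mono[of "real n" "\<bar>real_of_int k\<bar>" 2] by simp
      then have gw: "gap_weight n k = (real_of_int k)\<^sup>2 - (real n)\<^sup>2" by (simp add: gap_weight_eq)
      have gn: "real n \<le> gap_weight n k" using False by (intro gap_weight_ge) auto
      have "9 * gap_weight n k \<le> pi\<^sup>2 * gap_weight n k" by (intro mult_right_mono pi2_ge) simp
      then have "0 \<le> pi\<^sup>2 * (real_of_int k)\<^sup>2 - \<mu> - 2 * gap_weight n k"
        using gn \<rho>(2) gap_error_nonneg[of n] unfolding gw \<mu>_def by (simp add: right_diff_distrib)
      then have "0 \<le> (pi\<^sup>2 * (real_of_int k)\<^sup>2 - \<mu> - 2 * gap_weight n k) * (cmod (f k))\<^sup>2"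
        by (rule mult_nonneg_nonneg) simp
      then show ?thesis using False by (simp add: algebra_simps)
    qed
  qed
  have gs: "?g summable_on UNIV" by (rule gap_weight_summable[OF f])
  note hs = shifted_form_diag(2)[OF f, of \<mu>]
  have "2 * ?x = (\<Sum>\<^sub>\<infinity>k. if k = int n \<or> k = - int n then ?x else 0)" by (rule infsum_pair(1)[OF n, symmetric])
  also have "\<dots> \<le> (\<Sum>\<^sub>\<infinity>k. ?h k + (- 2) * ?g k)"
    by (intro infsum_mono summable_on_add summable_on_cmult_right hs gs infsum_pair(2)[OF n] le)
  also have "\<dots> = infsum ?h UNIV + (- 2) * infsum ?g UNIV"
    unfolding infsum_cmult_right'[symmetric] by (intro infsum_add summable_on_cmult_right hs gs)
  finally have 1: "2 * ?x \<le> infsum ?h UNIV + (- 2) * infsum ?g UNIV" .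
  have 2: "2 * (cmod (f (int n)))\<^sup>2 * \<rho> - (2 * infsum ?g UNIV + 4 * gap_error n * (cmod (f (int n)))\<^sup>2) \<le> Re (N f f)"
    using N_near_pair[OF n \<tau> f f\<tau> HS] unfolding \<rho>(1) by linarith
  have "2 * ?x = - 2 * (cmod (f (int n)))\<^sup>2 * \<rho> + 4 * gap_error n * (cmod (f (int n)))\<^sup>2"
    by (simp add: \<mu>_def algebra_simps)
  then have "0 \<le> infsum ?h UNIV + Re (N f f)" using 1 2 by linarith
  then show ?thesis using shifted_form_diag(1)[OF f, of \<mu>] unfolding \<mu>_def[symmetric] by linarith
qed

lemma unit_phase:
  obtains \<tau> where "cmod \<tau> = 1" "Re (\<tau> * z) = cmod z"
proof (cases "z = 0")
  case True
  then show ?thesis using that[of 1] by simp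
next
  case False
  have "cnj z / of_real (cmod z) * z = of_real (cmod z)"
    using False complex_norm_square[of z] by (simp add: field_simps power2_eq_square)
  then show ?thesis using that[of "cnj z / of_real (cmod z)"] False by (simp add: norm_divide)
qed

text \<open>The trial space has dimension 2n: 2n - 1 modes with |k| < n and one pair vector, whose
  phase is opposite to that of the resonant entry so as to lower the energy. It therefore bounds the
  eigenvalue with index 2n - 1.\<close>

lemma lower_gap_edge:
  assumes e: "is_eigensystem e" and n: "1 \<le> n"
    and HS: "(\<Sum>\<^sub>\<infinity>(k, m). (cmod (Q (k - m)))\<^sup>2 / (gap_weight n k * gap_weight n m)) \<le> 1"
    and small: "cmod (Q (2 * int n)) \<le> real n"
  shows "Re (A (e (2 * n - 1)) (e (2 * n - 1))) \<le> pi\<^sup>2 * (real n)\<^sup>2 - cmod (Q (2 * int n)) + 2 * gap_error n + c"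
proof -
  obtain \<tau>' where "cmod \<tau>' = 1" "Re (\<tau>' * Q (2 * int n)) = cmod (Q (2 * int n))" by (rule unit_phase)
  then obtain \<tau> where \<tau>: "cmod \<tau> = 1" "Re (\<tau> * Q (2 * int n)) = - cmod (Q (2 * int n))"
    using that[of "- \<tau>'"] by simp
  \<comment> \<open>The index n stands for the pair vector in place of the mode n, and the mode -n
    is left out.\<close>
  define I where "I = {- int n + 1..int n}"
  define b where "b = (\<lambda>i. if i = int n then pair_vec n \<tau> else \<delta> i)"
  have I: "finite I" "card I = 2 * n" using n by (simp_all add: I_def)
  have comb: "(\<Sum>i\<in>I. t i * b i k) = (if \<bar>k\<bar> < int n then t k else if k = int n then t (int n) else if k = - int n then \<tau> * t (int n) else 0)" for t k
  proof -
    have In: "I = insert (int n) {- int n + 1..<int n}" using n by (auto simp: I_def)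
    have "(\<Sum>i\<in>I. t i * b i k) = t (int n) * pair_vec n \<tau> k + (\<Sum>i\<in>{- int n + 1..<int n}. t i * b i k)"
      unfolding In by (subst sum.insert) (auto simp: b_def)
    also have "(\<Sum>i\<in>{- int n + 1..<int n}. t i * b i k) = (\<Sum>i\<in>{- int n + 1..<int n}. t i * \<delta> i k)"
      by (intro sum.cong) (auto simp: b_def)
    also have "\<dots> = (if k \<in> {- int n + 1..<int n} then t k else 0)"
      by (rule \<delta>_combination) simp
    finally show ?thesis using n by (auto simp: pair_vec_def)
  qed
  show ?thesis
  proof (rule eigenvalue_le[OF e refl, of I "2 * n - 1" b])
    show "finite I" "2 * n - 1 < card I" using I n by auto
    show "b i \<in> X" for i by (simp add: b_def pair_vec_mem \<delta>_mem)
    show "\<forall>t. (\<forall>k. (\<Sum>i\<in>I. t i * b i k) = 0) \<longrightarrow> (\<forall>i\<in>I. t i = 0)"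
    proof (intro allI impI ballI)
      fix t i assume "\<forall>k. (\<Sum>i\<in>I. t i * b i k) = 0" "i \<in> I"
      then show "t i = 0" using comb[of t i] by (auto simp: I_def split: if_splits)
    qed
    fix t
    show "Re (A (\<lambda>k. \<Sum>i\<in>I. t i * b i k) (\<lambda>k. \<Sum>i\<in>I. t i * b i k)) \<le>
      (pi\<^sup>2 * (real n)\<^sup>2 - cmod (Q (2 * int n)) + 2 * gap_error n + c) *
        Re (S (\<lambda>k. \<Sum>i\<in>I. t i * b i k) (\<lambda>k. \<Sum>i\<in>I. t i * b i k))"
    proof (rule form_upper[OF n \<tau>(1) _ _ HS _ \<tau>(2) small])
      show "(\<lambda>k. \<Sum>i\<in>I. t i * b i k) \<in> X"
        by (intro S.sum_mem I) (simp add: b_def pair_vec_mem \<delta>_mem)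
    qed (use n in \<open>auto simp: comb\<close>)
  qed
qed

text \<open>Admissible vectors satisfy 2n linear conditions, hence a bound for the eigenvalue with
  index 2n. The phase is aligned with the resonant entry so as to raise the energy.\<close>

lemma upper_gap_edge:
  assumes e: "is_eigensystem e" and n: "1 \<le> n"
    and HS: "(\<Sum>\<^sub>\<infinity>(k, m). (cmod (Q (k - m)))\<^sup>2 / (gap_weight n k * gap_weight n m)) \<le> 1"
    and small: "cmod (Q (2 * int n)) \<le> real n"
  shows "pi\<^sup>2 * (real n)\<^sup>2 + cmod (Q (2 * int n)) - 2 * gap_error n + c \<le> Re (A (e (2 * n)) (e (2 * n)))"
proof -
  obtain \<tau> where \<tau>: "cmod \<tau> = 1" "Re (\<tau> * Q (2 * int n)) = cmod (Q (2 * int n))" by (rule unit_phase)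
  \<comment> \<open>The conditions j < 2n - 1 run through the modes k = j - n + 1 with |k| < n; the
    last one, j = 2n - 1, ties the value at -n to that at n.\<close>
  define M where "M = (\<lambda>j f. if j < 2 * n - 1 then f (int j - int n + 1) else f (- int n) - \<tau> * f (int n) :: complex)"
  show ?thesis
  proof (rule eigenvalue_ge[OF e refl, of "2 * n" M])
    show "M j (\<lambda>k. \<Sum>i\<le>2 * n. t i * e i k) = (\<Sum>i\<le>2 * n. t i * M j (e i))" for j t
      by (simp add: M_def sum_subtractf right_diff_distrib sum_distrib_left mult.left_commute)
    fix f assume f: "f \<in> X" and M: "\<And>j. j < 2 * n \<Longrightarrow> M j f = 0"
    show "(pi\<^sup>2 * (real n)\<^sup>2 + cmod (Q (2 * int n)) - 2 * gap_error n + c) * Re (S f f) \<le> Re (A f f)"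
    proof (rule form_lower[OF n \<tau>(1) f _ HS _ \<tau>(2) small])
      show "f (- int n) = \<tau> * f (int n)" using M[of "2 * n - 1"] n by (simp add: M_def)
      fix k assume k: "\<bar>k\<bar> < int n"
      define j where "j = nat (k + int n - 1)"
      have "j < 2 * n - 1" "int j - int n + 1 = k" using k by (auto simp: j_def)
      then show "f k = 0" using M[of j] by (simp add: M_def)
    qed
  qed
qed

end

context schroedinger_operator begin

text \<open>In the difference of the two edges the free level and the shift cancel, leaving a gap of
  at least 2 |q_n| minus 4 times the error.\<close>

lemma gap_length_lower_bound:
  "\<exists>n0\<ge>1. \<forall>n\<ge>n0. cmod (fourier_coeff 1 q (int n)) \<le> gap_length q n / 2 + 2 * gap_error n"
proof -
  obtain e where e: "is_eigensystem e" using eigensystem_exists by blast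
  obtain n1 where n1: "1 \<le> n1" "\<And>n. n1 \<le> n \<Longrightarrow> (\<Sum>\<^sub>\<infinity>(k, m). (cmod (pot_coeff q (k - m)))\<^sup>2 / (gap_weight n k * gap_weight n m)) \<le> 1"
    using HS_gap_small by blast
  obtain n2 where n2: "\<And>n. n2 \<le> n \<Longrightarrow> cmod (pot_coeff q (2 * int n)) \<le> real n"
    using Q_eventually_small by blast
  have "cmod (fourier_coeff 1 q (int n)) \<le> gap_length q n / 2 + 2 * gap_error n" if n: "max n1 n2 \<le> n" for n
  proof -
    have n': "1 \<le> n" "n1 \<le> n" "n2 \<le> n" using n n1(1) by auto
    have "gap_length q n = Re (A (e (2 * n)) (e (2 * n))) - Re (A (e (2 * n - 1)) (e (2 * n - 1)))"
      by (simp add: gap_length_def lambda_plus_def lambda_minus_def eigenvalues_eq[OF e])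
    moreover have "cmod (pot_coeff q (2 * int n)) = cmod (fourier_coeff 1 q (int n))"
      by (simp add: pot_coeff_def)
    ultimately show ?thesis
      using lower_gap_edge[OF e n'(1) n1(2)[OF n'(2)] n2[OF n'(3)]]
        upper_gap_edge[OF e n'(1) n1(2)[OF n'(2)] n2[OF n'(3)]] by linarith
  qed
  then show ?thesis using n1(1) by (intro exI[of _ "max n1 n2"]) auto
qed

end

section \<open>Decay from the gap inequality\<close>

definition near :: "nat \<Rightarrow> nat set" where
  "near n = {j. j \<noteq> n \<and> n \<le> 2 * j \<and> 2 * j \<le> 3 * n}"

lemma near_finite [simp]: "finite (near n)"
  by (rule finite_subset[of _ "{..3 * n}"]) (auto simp: near_def)

lemma powr_add_le:
  fixes x y P :: real
  assumes "0 \<le> x" "0 \<le> y" "0 \<le> P"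
  shows "(x + y) powr P \<le> 2 powr P * (x powr P + y powr P)"
proof -
  have "(x + y) powr P \<le> (2 * max x y) powr P"
    using assms by (intro powr_mono2) auto
  also have "\<dots> = 2 powr P * (max x y) powr P" using assms by (simp add: powr_mult)
  also have "(max x y) powr P \<le> x powr P + y powr P" by (simp add: max_def)
  finally show ?thesis by simp
qed

text \<open>The endpoint 0 is included because terms of the sequences may vanish; there convexity
  reduces to t^r \<le> t for t in [0, 1].\<close>

lemma powr_convex_nonneg:
  assumes r: "1 \<le> r" shows "convex_on {0..} (\<lambda>x::real. x powr r)"
  unfolding convex_on_def
proof (intro conjI ballI allI impI)
  have scale: "(t * x) powr r \<le> t * x powr r" if "0 \<le> t" "t \<le> 1" "0 \<le> x" for t x :: real
  proof -
    have "t powr r \<le> t powr 1" using that r by (intro powr_mono') auto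
    then have "t powr r * x powr r \<le> t * x powr r" using that by (intro mult_right_mono) auto
    then show ?thesis using that by (simp add: powr_mult)
  qed
  fix x y u v :: real
  assume *: "x \<in> {0..}" "y \<in> {0..}" "0 \<le> u" "0 \<le> v" "u + v = 1"
  show "(u *\<^sub>R x + v *\<^sub>R y) powr r \<le> u * x powr r + v * y powr r"
  proof (cases "x = 0 \<or> y = 0")
    case True
    then show ?thesis using scale[of u x] scale[of v y] * by auto
  next
    case False
    then have "x \<in> {0<..}" "y \<in> {0<..}" using * by auto
    then show ?thesis using powr_convex[OF r] * unfolding convex_on_def by blast
  qed
qed simp

text \<open>Jensen for the weights divided by their sum s. Undoing the normalisation costs s^(r -
  1), estimated by K^r so that the constant is the same for all index sets and also when s is
  small.\<close>

lemma weighted_Jensen_powr: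
  fixes \<kappa> z :: "'a \<Rightarrow> real"
  assumes J: "finite J" and \<kappa>: "\<And>j. j \<in> J \<Longrightarrow> 0 \<le> \<kappa> j" and z: "\<And>j. j \<in> J \<Longrightarrow> 0 \<le> z j"
    and K: "sum \<kappa> J \<le> K" "1 \<le> K" and r: "1 \<le> r"
  shows "(\<Sum>j\<in>J. \<kappa> j * z j) powr r \<le> K powr r * (\<Sum>j\<in>J. \<kappa> j * z j powr r)"
proof (cases "sum \<kappa> J = 0")
  case True
  then have "\<And>j. j \<in> J \<Longrightarrow> \<kappa> j = 0" using J \<kappa> by (simp add: sum_nonneg_eq_0_iff)
  then show ?thesis by simp
next
  case False
  define s where "s = sum \<kappa> J"
  have s: "0 < s" using False sum_nonneg[of J \<kappa>] \<kappa> by (simp add: s_def less_le)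
  have J0: "J \<noteq> {}" using False by auto
  have "(\<Sum>j\<in>J. (\<kappa> j / s) *\<^sub>R z j) powr r \<le> (\<Sum>j\<in>J. (\<kappa> j / s) * z j powr r)"
  proof (rule convex_on_sum[OF J J0 powr_convex_nonneg[OF r]])
    show "(\<Sum>j\<in>J. \<kappa> j / s) = 1" using s by (simp add: s_def flip: sum_divide_distrib)
  qed (use \<kappa> z s in auto)
  then have "s powr r * (\<Sum>j\<in>J. (\<kappa> j / s) * z j) powr r \<le> s powr r * (\<Sum>j\<in>J. (\<kappa> j / s) * z j powr r)"
    by (intro mult_left_mono) auto
  moreover have "s powr r * (\<Sum>j\<in>J. (\<kappa> j / s) * z j) powr r = (\<Sum>j\<in>J. \<kappa> j * z j) powr r"
  proof -
    have "(\<Sum>j\<in>J. \<kappa> j * z j) = s * (\<Sum>j\<in>J. (\<kappa> j / s) * z j)"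
      using s by (simp add: sum_distrib_left)
    moreover have "0 \<le> (\<Sum>j\<in>J. (\<kappa> j / s) * z j)" using s \<kappa> z by (intro sum_nonneg) auto
    ultimately show ?thesis using s by (simp add: powr_mult)
  qed
  moreover have "s powr r * (\<Sum>j\<in>J. (\<kappa> j / s) * z j powr r) \<le> K powr r * (\<Sum>j\<in>J. \<kappa> j * z j powr r)"
  proof -
    have "s powr r * (\<Sum>j\<in>J. (\<kappa> j / s) * z j powr r) = (s powr r / s) * (\<Sum>j\<in>J. \<kappa> j * z j powr r)"
      by (simp add: sum_distrib_left)
    also have "s powr r / s = s powr (r - 1)" using s by (simp add: powr_diff)
    also have "s powr (r - 1) \<le> K powr (r - 1)" using s K r by (intro powr_mono2) (auto simp: s_def)
    also have "K powr (r - 1) \<le> K powr r" using K by (intro powr_mono) auto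
    finally show ?thesis
      using \<kappa> by (simp add: mult_right_mono sum_nonneg)
  qed
  ultimately show ?thesis by linarith
qed

text \<open>The maximum with 1 gives the lower bound that Jensen's constant requires without
  evaluating the series.\<close>

definition zeta2 :: real where
  "zeta2 = max 1 (\<Sum>\<^sub>\<infinity>i::int. 1 / (real_of_int i)\<^sup>2)"

lemma zeta2_bound:
  assumes "finite F" and inj: "inj_on f F"
  shows "(\<Sum>n\<in>F. 1 / (real_of_int (f n))\<^sup>2) \<le> zeta2"
proof -
  have s: "(\<lambda>i::int. 1 / (real_of_int i)\<^sup>2) summable_on UNIV"
    using kernel_sum(1)[of 0] by (simp add: power2_eq_square abs_mult[symmetric])
  have "(\<Sum>n\<in>F. 1 / (real_of_int (f n))\<^sup>2) = (\<Sum>i\<in>f ` F. 1 / (real_of_int i)\<^sup>2)"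
    by (simp add: sum.reindex[OF inj])
  also have "\<dots> \<le> (\<Sum>\<^sub>\<infinity>i::int. 1 / (real_of_int i)\<^sup>2)"
    using assms by (intro finite_sum_le_infsum s) auto
  finally show ?thesis by (simp add: zeta2_def)
qed

text \<open>The quadratic term is a small linear operator in \<open>a\<close> far out, so that it can be absorbed;
  truncating the weight at \<open>M\<close> makes the norm to be absorbed finite a priori.\<close>

lemma absorb_quadratic_term:
  fixes a G :: "nat \<Rightarrow> real"
  assumes a: "\<And>n. 0 \<le> a n" and a2: "(\<lambda>n. (a n)\<^sup>2) summable_on UNIV"
    and G: "\<And>n. 0 \<le> G n" and GP: "(\<lambda>n. (real n powr \<beta> * G n) powr P) summable_on UNIV"
    and le: "\<And>n. n0 \<le> n \<Longrightarrow> a n \<le> G n + C * (\<Sum>j\<in>near n. (a j)\<^sup>2 / \<bar>real_of_int (int j - int n)\<bar>)"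
    and "0 \<le> \<beta>" "2 \<le> P" "0 \<le> C"
  shows "(\<lambda>n. (real n powr \<beta> * a n) powr P) summable_on UNIV"
proof -
  \<comment> \<open>P-th powers of the sequence are r-th powers of its square, the quantity that is
    convolved; \<open>2 \<le> P\<close> makes r admissible in Jensen's inequality.\<close>
  define r where "r = P / 2"
  have r: "1 \<le> r" using \<open>2 \<le> P\<close> by (simp add: r_def)
  define c0 where "c0 = max 1 (C * 2 powr \<beta>)"
  define L where "L = 2 * zeta2 powr r * zeta2"
  have zz: "1 \<le> zeta2" by (simp add: zeta2_def)
  have L: "1 \<le> L"
  proof -
    have "1 \<le> zeta2 powr r" using zz r by (simp add: ge_one_powr_ge_zero)
    then have "1 * 1 \<le> (2 * zeta2 powr r) * zeta2" using zz by (intro mult_mono) auto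
    then show ?thesis by (simp add: L_def)
  qed
  \<comment> \<open>Then 2 c0 \<epsilon> = 1/L, and (1/L)^P \<le> 1/L since L \<ge> 1, so the
    coefficient of the absorbed term is at most \<open>zeta2 powr r * zeta2 / L\<close>, which is
    1/2.\<close>
  define \<epsilon> where "\<epsilon> = 1 / (2 * c0 * L)"
  have c0: "1 \<le> c0" by (simp add: c0_def)
  have \<epsilon>: "0 < \<epsilon>" using c0 L by (simp add: \<epsilon>_def)
  obtain n1 where n1: "\<And>F. finite F \<Longrightarrow> F \<subseteq> {n1..} \<Longrightarrow> (\<Sum>j\<in>F. (a j)\<^sup>2) \<le> \<epsilon>\<^sup>2"
  proof -
    obtain F0 where F0: "finite F0" "dist (\<Sum>j\<in>F0. (a j)\<^sup>2) (\<Sum>\<^sub>\<infinity>j. (a j)\<^sup>2) \<le> \<epsilon>\<^sup>2"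
      using infsum_finite_approximation[OF a2, of "\<epsilon>\<^sup>2"] \<epsilon> by auto
    define m where "m = Suc (Max (insert 0 F0))"
    have "(\<Sum>j\<in>F. (a j)\<^sup>2) \<le> \<epsilon>\<^sup>2" if F: "finite F" "F \<subseteq> {m..}" for F
    proof -
      have "j < m" if "j \<in> F0" for j
        using Max_ge[of "insert 0 F0" j] F0(1) that unfolding m_def less_Suc_eq_le by blast
      then have disj: "F0 \<inter> F = {}" using F by fastforce
      have "(\<Sum>j\<in>F0. (a j)\<^sup>2) + (\<Sum>j\<in>F. (a j)\<^sup>2) = (\<Sum>j\<in>F0 \<union> F. (a j)\<^sup>2)"
        using F F0 disj by (simp add: sum.union_disjoint)
      also have "\<dots> \<le> (\<Sum>\<^sub>\<infinity>j. (a j)\<^sup>2)" using F F0 by (intro finite_sum_le_infsum a2) auto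
      finally show ?thesis using F0(2) by (simp add: dist_real_def)
    qed
    then show ?thesis using that by blast
  qed
  \<comment> \<open>Elements of \<open>near n\<close> are at least n/2, hence at least n1 once n
    \<ge> 2 n1; there \<open>a\<close> has small l^2 norm.\<close>
  define n2 where "n2 = max n0 (2 * n1)"
  define H where "H = 2 powr P * (\<Sum>\<^sub>\<infinity>n. (real n powr \<beta> * G n) powr P) + (\<Sum>n<n2. (real n powr \<beta> * a n) powr P)"
  have trunc: "(\<Sum>n\<in>F. (min (real n) M powr \<beta> * a n) powr P) \<le> 2 * H"
    if M: "1 \<le> M" and F: "finite F" for M and F :: "nat set"
  proof -
    define w where "w = (\<lambda>n. min (real n) M powr \<beta>)"
    define y where "y = (\<lambda>n. w n * a n)"
    have w: "0 \<le> w n" "w n \<le> real n powr \<beta>" "w n \<le> M powr \<beta>" for n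
      using M \<open>0 \<le> \<beta>\<close> by (auto simp: w_def intro!: powr_mono2)
    have y: "0 \<le> y n" for n using w a by (simp add: y_def)
    \<comment> \<open>The a priori finiteness that permits subtracting Y / 2 later: the truncated
      weight is at most M^\<beta>, and the square summable \<open>a\<close> is bounded, hence in
      l^P.\<close>
    have ys: "(\<lambda>n. y n powr P) summable_on UNIV"
    proof (rule summable_on_comparison_test)
      define B where "B = sqrt (\<Sum>\<^sub>\<infinity>n. (a n)\<^sup>2)"
      show "(\<lambda>n. ((M powr \<beta>) powr P * B powr (P - 2)) * (a n)\<^sup>2) summable_on UNIV"
        by (rule summable_on_cmult_right[OF a2])
      fix n
      have "a n \<le> B"
        unfolding B_def using finite_sum_le_infsum[OF a2, of "{n}"] by (intro real_le_rsqrt) simp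
      have "y n powr P \<le> (M powr \<beta> * a n) powr P"
        unfolding y_def using w[of n] a[of n] \<open>2 \<le> P\<close> by (intro powr_mono2 mult_right_mono) auto
      also have "\<dots> = (M powr \<beta>) powr P * a n powr P" using a by (simp add: powr_mult)
      also have "a n powr P = a n powr (P - 2) * (a n)\<^sup>2"
      proof (cases "a n = 0")
        case False
        then have "0 < a n" using a[of n] by simp
        then show ?thesis by (simp add: powr_diff)
      qed simp
      also have "\<dots> \<le> B powr (P - 2) * (a n)\<^sup>2"
        using \<open>a n \<le> B\<close> a[of n] \<open>2 \<le> P\<close> by (intro mult_right_mono powr_mono2) auto
      finally show "y n powr P \<le> ((M powr \<beta>) powr P * B powr (P - 2)) * (a n)\<^sup>2"
        by (simp add: mult.assoc mult_left_mono)
    qed simp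
    define Y where "Y = (\<Sum>\<^sub>\<infinity>n. y n powr P)"
    define \<kappa> where "\<kappa> = (\<lambda>n j. 1 / (real_of_int (int j - int n))\<^sup>2)"
    define Tz where "Tz = (\<lambda>n. \<Sum>j\<in>near n. \<kappa> n j * (y j)\<^sup>2)"
    have Tz0: "0 \<le> Tz n" for n unfolding Tz_def \<kappa>_def by (intro sum_nonneg) simp
    have pointwise: "y n powr P \<le> 2 powr P * ((real n powr \<beta> * G n) powr P + (c0 * \<epsilon>) powr P * Tz n powr r)"
      if n: "n2 \<le> n" for n
    proof -
      \<comment> \<open>Doubling: n \<le> 2 j on \<open>near n\<close>, so the weight at n can be
        moved to j at the cost of 2^\<beta>; truncation preserves this.\<close>
      have wn: "w n \<le> 2 powr \<beta> * w j" if "j \<in> near n" for j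
      proof -
        have "real n \<le> 2 * real j" using that unfolding near_def by (simp flip: of_nat_mult)
        then have "min (real n) M \<le> 2 * min (real j) M" using M by (auto simp: min_def)
        then have "w n \<le> (2 * min (real j) M) powr \<beta>"
          unfolding w_def using \<open>0 \<le> \<beta>\<close> M by (intro powr_mono2) auto
        then show ?thesis using M by (simp add: w_def powr_mult)
      qed
      \<comment> \<open>Of the two factors \<open>a j\<close> one is measured in l^2, where it is
        small, and the other takes the weight and becomes \<open>y j\<close>. This is how the
        quadratic term turns into a linear one with a small constant.\<close>
      have "w n * (\<Sum>j\<in>near n. (a j)\<^sup>2 / \<bar>real_of_int (int j - int n)\<bar>) \<le>
          2 powr \<beta> * (\<Sum>j\<in>near n. \<bar>a j\<bar> * \<bar>y j / real_of_int (int j - int n)\<bar>)"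
        unfolding sum_distrib_left
      proof (rule sum_mono)
        fix j assume j: "j \<in> near n"
        have "w n * ((a j)\<^sup>2 / \<bar>real_of_int (int j - int n)\<bar>) \<le> (2 powr \<beta> * w j) * ((a j)\<^sup>2 / \<bar>real_of_int (int j - int n)\<bar>)"
          by (intro mult_right_mono wn j) simp
        also have "\<dots> = 2 powr \<beta> * (\<bar>a j\<bar> * \<bar>y j / real_of_int (int j - int n)\<bar>)"
          using a[of j] y[of j] by (simp add: y_def power2_eq_square abs_divide)
        finally show "w n * ((a j)\<^sup>2 / \<bar>real_of_int (int j - int n)\<bar>) \<le> 2 powr \<beta> * (\<bar>a j\<bar> * \<bar>y j / real_of_int (int j - int n)\<bar>)" .
      qed
      also have "(\<Sum>j\<in>near n. \<bar>a j\<bar> * \<bar>y j / real_of_int (int j - int n)\<bar>) \<le>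
          L2_set a (near n) * L2_set (\<lambda>j. y j / real_of_int (int j - int n)) (near n)"
        by (rule L2_set_mult_ineq)
      also have "L2_set (\<lambda>j. y j / real_of_int (int j - int n)) (near n) = sqrt (Tz n)"
        unfolding L2_set_def Tz_def \<kappa>_def by (simp add: power_divide)
      also have "L2_set a (near n) \<le> \<epsilon>"
      proof -
        have "near n \<subseteq> {n1..}" using n by (auto simp: near_def n2_def)
        then have "(\<Sum>j\<in>near n. (a j)\<^sup>2) \<le> \<epsilon>\<^sup>2" by (intro n1) simp_all
        then show ?thesis unfolding L2_set_def using \<epsilon> by (intro real_le_lsqrt) (auto intro: sum_nonneg)
      qed
      finally have "w n * (\<Sum>j\<in>near n. (a j)\<^sup>2 / \<bar>real_of_int (int j - int n)\<bar>) \<le> 2 powr \<beta> * (\<epsilon> * sqrt (Tz n))"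
        using Tz0 by (simp add: mult_left_mono mult_right_mono)
      from mult_left_mono[OF this \<open>0 \<le> C\<close>]
      have Cle: "C * (w n * (\<Sum>j\<in>near n. (a j)\<^sup>2 / \<bar>real_of_int (int j - int n)\<bar>)) \<le> (C * 2 powr \<beta>) * (\<epsilon> * sqrt (Tz n))"
        by (simp add: mult_ac)
      also have "\<dots> \<le> c0 * (\<epsilon> * sqrt (Tz n))"
        using \<epsilon> Tz0 by (intro mult_right_mono) (auto simp: c0_def)
      finally have Cle: "C * (w n * (\<Sum>j\<in>near n. (a j)\<^sup>2 / \<bar>real_of_int (int j - int n)\<bar>)) \<le> c0 * (\<epsilon> * sqrt (Tz n))" .
      have "y n \<le> w n * (G n + C * (\<Sum>j\<in>near n. (a j)\<^sup>2 / \<bar>real_of_int (int j - int n)\<bar>))"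
        unfolding y_def using n le[of n] w by (intro mult_left_mono) (auto simp: n2_def)
      also have "\<dots> = w n * G n + C * (w n * (\<Sum>j\<in>near n. (a j)\<^sup>2 / \<bar>real_of_int (int j - int n)\<bar>))"
        by (simp add: distrib_left mult_ac)
      also have "\<dots> \<le> real n powr \<beta> * G n + c0 * \<epsilon> * sqrt (Tz n)"
        using Cle mult_right_mono[OF w(2)[of n] G[of n]] by simp
      finally have "y n powr P \<le> (real n powr \<beta> * G n + c0 * \<epsilon> * sqrt (Tz n)) powr P"
        using y \<open>2 \<le> P\<close> by (intro powr_mono2) auto
      also have "\<dots> \<le> 2 powr P * ((real n powr \<beta> * G n) powr P + (c0 * \<epsilon> * sqrt (Tz n)) powr P)"
        using G \<epsilon> c0 Tz0 \<open>2 \<le> P\<close> by (intro powr_add_le mult_nonneg_nonneg) auto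
      also have "(c0 * \<epsilon> * sqrt (Tz n)) powr P = (c0 * \<epsilon>) powr P * Tz n powr r"
        using c0 \<epsilon> Tz0[of n] by (simp add: powr_mult r_def powr_half_sqrt[symmetric] powr_powr)
      finally show ?thesis .
    qed
    have ypow: "((y j)\<^sup>2) powr r = y j powr P" for j
    proof (cases "y j = 0")
      case False
      then have "0 < y j" using y[of j] by simp
      then show ?thesis by (simp add: r_def powr_powr flip: powr_numeral)
    qed (simp add: r_def)
    \<comment> \<open>Young's inequality for convolution of y^2 with the summable kernel 1/i^2 in
      l^r: Jensen in each row, then exchange of the sums. Both row and column sums of the kernel are
      at most \<open>zeta2\<close>.\<close>
    have conv: "(\<Sum>n\<in>F'. Tz n powr r) \<le> zeta2 powr r * (zeta2 * Y)" if F': "finite F'" for F'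
    proof -
      define J where "J = (\<Union>n\<in>F'. near n)"
      have J: "finite J" using F' by (simp add: J_def)
      have "(\<Sum>n\<in>F'. Tz n powr r) \<le> (\<Sum>n\<in>F'. zeta2 powr r * (\<Sum>j\<in>J. \<kappa> n j * y j powr P))"
      proof (rule sum_mono)
        fix n assume n: "n \<in> F'"
        have "Tz n powr r \<le> zeta2 powr r * (\<Sum>j\<in>near n. \<kappa> n j * ((y j)\<^sup>2) powr r)"
          unfolding Tz_def
        proof (rule weighted_Jensen_powr)
          show "sum (\<kappa> n) (near n) \<le> zeta2"
            unfolding \<kappa>_def by (rule zeta2_bound) (auto simp: inj_on_def)
        qed (auto simp: \<kappa>_def zz r)
        also have "(\<Sum>j\<in>near n. \<kappa> n j * ((y j)\<^sup>2) powr r) = (\<Sum>j\<in>near n. \<kappa> n j * y j powr P)"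
          by (simp only: ypow)
        also have "(\<Sum>j\<in>near n. \<kappa> n j * y j powr P) \<le> (\<Sum>j\<in>J. \<kappa> n j * y j powr P)"
          using n J by (intro sum_mono2) (auto simp: J_def \<kappa>_def)
        finally show "Tz n powr r \<le> zeta2 powr r * (\<Sum>j\<in>J. \<kappa> n j * y j powr P)"
          by (simp add: mult_left_mono)
      qed
      also have "\<dots> = zeta2 powr r * (\<Sum>j\<in>J. (\<Sum>n\<in>F'. \<kappa> n j) * y j powr P)"
        by (simp add: sum_distrib_left[symmetric] sum.swap[of _ _ F'] sum_distrib_right)
      also have "\<dots> \<le> zeta2 powr r * (\<Sum>j\<in>J. zeta2 * y j powr P)"
      proof (intro mult_left_mono sum_mono mult_right_mono)
        show "(\<Sum>n\<in>F'. \<kappa> n j) \<le> zeta2" for j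
          unfolding \<kappa>_def by (rule zeta2_bound[OF F']) (auto simp: inj_on_def)
      qed auto
      also have "\<dots> \<le> zeta2 powr r * (zeta2 * Y)"
        unfolding sum_distrib_left[symmetric] Y_def
        using zz by (intro mult_left_mono finite_sum_le_infsum ys J) auto
      finally show ?thesis .
    qed
    have small: "2 powr P * ((c0 * \<epsilon>) powr P * (zeta2 powr r * zeta2)) \<le> 1 / 2"
    proof -
      have "2 powr P * (c0 * \<epsilon>) powr P = (1 / L) powr P"
        using c0 \<epsilon> L by (simp add: \<epsilon>_def flip: powr_mult)
      also have "\<dots> \<le> (1 / L) powr 1" using L \<open>2 \<le> P\<close> by (intro powr_mono') auto
      finally have "2 powr P * (c0 * \<epsilon>) powr P * (zeta2 powr r * zeta2) \<le> 1 / L * (zeta2 powr r * zeta2)"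
        using zz L by (intro mult_right_mono) auto
      also have "\<dots> = 1 / 2" using zz L by (simp add: L_def field_simps)
      finally show ?thesis by (simp add: mult.assoc)
    qed
    have fin: "(\<Sum>n\<in>F'. y n powr P) \<le> H + Y / 2" if F': "finite F'" for F'
    proof -
      have Y0: "0 \<le> Y" unfolding Y_def by (intro infsum_nonneg) simp
      let ?A = "F' \<inter> {..<n2}" and ?B = "F' - {..<n2}"
      have "(\<Sum>n\<in>F'. y n powr P) = (\<Sum>n\<in>?A. y n powr P) + (\<Sum>n\<in>?B. y n powr P)"
        using F' by (rule sum.Int_Diff)
      also have "(\<Sum>n\<in>?A. y n powr P) \<le> (\<Sum>n<n2. (real n powr \<beta> * a n) powr P)"
      proof -
        have "(\<Sum>n\<in>?A. y n powr P) \<le> (\<Sum>n<n2. y n powr P)" by (intro sum_mono2) auto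
        also have "\<dots> \<le> (\<Sum>n<n2. (real n powr \<beta> * a n) powr P)"
          using \<open>2 \<le> P\<close> y w a by (intro sum_mono powr_mono2) (auto simp: y_def intro!: mult_right_mono)
        finally show ?thesis .
      qed
      also have "(\<Sum>n\<in>?B. y n powr P) \<le>
          (\<Sum>n\<in>?B. 2 powr P * ((real n powr \<beta> * G n) powr P + (c0 * \<epsilon>) powr P * Tz n powr r))"
        by (intro sum_mono pointwise) auto
      also have "\<dots> = 2 powr P * (\<Sum>n\<in>?B. (real n powr \<beta> * G n) powr P) + 2 powr P * ((c0 * \<epsilon>) powr P * (\<Sum>n\<in>?B. Tz n powr r))"
        by (simp add: sum_distrib_left sum.distrib distrib_left)
      also have "\<dots> \<le> 2 powr P * (\<Sum>\<^sub>\<infinity>n. (real n powr \<beta> * G n) powr P) + 2 powr P * ((c0 * \<epsilon>) powr P * (zeta2 powr r * (zeta2 * Y)))"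
        using F' by (intro add_mono mult_left_mono finite_sum_le_infsum GP conv) auto
      also have "2 powr P * ((c0 * \<epsilon>) powr P * (zeta2 powr r * (zeta2 * Y))) \<le> Y / 2"
        using mult_right_mono[OF small Y0] by (simp add: mult.assoc)
      finally show ?thesis by (simp add: H_def)
    qed
    \<comment> \<open>Since Y is finite this yields Y \<le> 2 H, and H does not involve M, so the
      truncation can be removed.\<close>
    have "Y \<le> H + Y / 2"
      unfolding Y_def[symmetric] using infsum_le_finite_sums[OF ys fin] by (simp add: Y_def)
    moreover have "(\<Sum>n\<in>F. y n powr P) \<le> Y"
      unfolding Y_def by (intro finite_sum_le_infsum ys F) auto
    ultimately show ?thesis by (simp add: y_def w_def)
  qed
  show ?thesis
  proof (rule nonneg_sum_bounded(1))
    fix F :: "nat set" assume F: "finite F" "F \<subseteq> UNIV"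
    define M where "M = real (Max (insert 1 F))"
    have M: "1 \<le> M" using F Max_ge[of "insert 1 F" 1] unfolding M_def by (simp only: finite_insert insertI1 real_of_nat_ge_one_iff)
    have "n \<in> F \<Longrightarrow> real n \<le> M" for n using F Max_ge[of "insert 1 F" n] by (simp add: M_def)
    then have "(\<Sum>n\<in>F. (real n powr \<beta> * a n) powr P) = (\<Sum>n\<in>F. (min (real n) M powr \<beta> * a n) powr P)"
      by (intro sum.cong) (auto simp: min_absorb1)
    then show "(\<Sum>n\<in>F. (real n powr \<beta> * a n) powr P) \<le> 2 * H" using trunc[OF M F(1)] by simp
  qed simp
qed

section \<open>Embeddings of weighted sequence spaces and decay of the far part\<close>

lemma powr_summable_nat:
  assumes "a < -1" shows "(\<lambda>n. real n powr a) summable_on UNIV"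
  using assms summable_real_powr_iff[of a] by (simp add: summable_on_UNIV_nonneg_real_iff)

lemma summable_on_nat_from_1:
  fixes f :: "nat \<Rightarrow> real"
  shows "f summable_on {1..} \<longleftrightarrow> f summable_on UNIV"
proof -
  have "n \<in> insert 0 {1..}" for n :: nat by (cases n) auto
  then have "UNIV = insert (0::nat) {1..}" by blast
  then show ?thesis by (metis summable_on_insert_iff)
qed

text \<open>A pointwise substitute for Hoelder's inequality with the conjugate exponents p/2 and
  p/(p - 2): one of the two terms suffices, according to which of x^2 and y^(p - 2) is
  larger.\<close>

lemma weighted_le_mixed:
  fixes x y p :: real
  assumes "0 < x" "0 \<le> y" "2 < p"
  shows "(x * y)\<^sup>2 \<le> y powr p + x powr (2 * p / (p - 2))"
proof (cases "x\<^sup>2 \<le> y powr (p - 2)")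
  case True
  show ?thesis
  proof (cases "y = 0")
    case False
    then have y: "0 < y" using assms by simp
    have "(x * y)\<^sup>2 \<le> y powr (p - 2) * y\<^sup>2"
      unfolding power_mult_distrib using True by (intro mult_right_mono) auto
    also have "\<dots> = y powr p" using y by (simp add: powr_diff)
    finally show ?thesis by (simp add: add_increasing2)
  qed simp
next
  case False
  then have "y powr (p - 2) \<le> x\<^sup>2" by simp
  then have "(y powr (p - 2)) powr (2 / (p - 2)) \<le> (x\<^sup>2) powr (2 / (p - 2))"
    using assms by (intro powr_mono2) auto
  moreover have "(y powr (p - 2)) powr (2 / (p - 2)) = y powr 2"
  proof -
    have "p - 2 \<noteq> 0" using assms by simp
    then have "(p - 2) * (2 / (p - 2)) = 2" by (metis times_divide_eq_right nonzero_mult_div_cancel_left)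
    then show ?thesis by (simp only: powr_powr)
  qed
  moreover have "(x\<^sup>2) powr (2 / (p - 2)) = x powr (2 * (2 / (p - 2)))"
    using assms by (simp add: powr_powr flip: powr_numeral)
  ultimately have "y powr 2 \<le> x powr (2 * (2 / (p - 2)))" by (simp only:)
  then have "y\<^sup>2 \<le> x powr (2 * (2 / (p - 2)))" using assms by (simp add: powr_2_eq)
  then have "(x * y)\<^sup>2 \<le> x\<^sup>2 * x powr (2 * (2 / (p - 2)))"
    unfolding power_mult_distrib by (intro mult_left_mono) auto
  also have "x\<^sup>2 * x powr (2 * (2 / (p - 2))) = x powr (2 + 2 * (2 / (p - 2)))"
    using assms by (simp add: powr_add)
  also have "2 + 2 * (2 / (p - 2)) = 2 * p / (p - 2)" using assms by (simp add: field_simps)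
  finally show ?thesis by (simp add: add_increasing)
qed

text \<open>For p > 2 the condition on \<theta> is that n^(-\<theta>) raised to the power 2p/(p - 2)
  be summable. That exponent degenerates at p = 2, where boundedness of the weight is
  enough.\<close>

lemma square_summable_embedding:
  fixes g :: "nat \<Rightarrow> real"
  assumes g: "\<And>n. 0 \<le> g n" and gp: "(\<lambda>n. g n powr p) summable_on UNIV"
    and p: "2 \<le> p" and \<theta>: "1 / 2 - 1 / p < \<theta>"
  shows "(\<lambda>n. (real n powr (- \<theta>) * g n)\<^sup>2) summable_on UNIV"
proof -
  have "1 / p \<le> 1 / 2" using p by (simp add: field_simps)
  then have \<theta>0: "0 < \<theta>" using \<theta> by linarith
  show ?thesis
  proof (cases "p = 2")
    case True
    show ?thesis
    proof (rule summable_on_comparison_test[OF gp])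
      fix n
      have "real n powr (- \<theta>) \<le> 1"
        using \<theta>0 powr_mono[of "- \<theta>" 0 "real n"] by (cases "n = 0") auto
      then have "real n powr (- \<theta>) * g n \<le> 1 * g n" by (rule mult_right_mono) (rule g)
      then have "(real n powr (- \<theta>) * g n)\<^sup>2 \<le> (g n)\<^sup>2" using g by (intro power_mono) auto
      then show "(real n powr (- \<theta>) * g n)\<^sup>2 \<le> g n powr p" using True g by (simp add: powr_2_eq)
    qed simp
  next
    case False
    then have p2: "2 < p" using p by simp
    have "1 < \<theta> * (2 * p / (p - 2))"
    proof -
      have "(p - 2) / (2 * p) < \<theta>" using \<theta> p2 by (simp add: diff_divide_distrib)
      then show ?thesis using p2 by (simp add: field_simps)
    qed
    then have "(\<lambda>n. real n powr (- \<theta> * (2 * p / (p - 2)))) summable_on UNIV"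
      by (intro powr_summable_nat) simp
    from summable_on_add[OF gp this]
    show ?thesis
    proof (rule summable_on_comparison_test)
      fix n
      show "(real n powr (- \<theta>) * g n)\<^sup>2 \<le> g n powr p + real n powr (- \<theta> * (2 * p / (p - 2)))"
      proof (cases "n = 0")
        case False
        then show ?thesis
          using weighted_le_mixed[of "real n powr (- \<theta>)" "g n" p] g p2 by (simp add: powr_powr)
      qed simp
    qed simp
  qed
qed

text \<open>Away from n the distance u = |n - i| dominates both n/2 and |i|/3. The first is used
  with exponent d, the second with 1 - d, so d decides how much of the decay falls on n; 6 is the
  product of the two constants.\<close>

lemma far_kernel_bound:
  fixes i :: int and n :: nat
  assumes far: "\<And>j. i = int j \<Longrightarrow> j \<notin> near n" and ne: "i \<noteq> int n" and n: "1 \<le> n"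
    and d: "0 \<le> d" "d \<le> 1"
  shows "\<bar>real_of_int i\<bar> / \<bar>real_of_int (int n - i)\<bar> \<le> 6 * \<bar>real_of_int i\<bar> powr d * real n powr (- d)"
proof (cases "i = 0")
  case False
  define x u where "x = \<bar>real_of_int i\<bar>" and "u = \<bar>real_of_int (int n - i)\<bar>"
  have far2: "int n < 2 * \<bar>int n - i\<bar>"
  proof (cases "0 \<le> i")
    case True
    define j where "j = nat i"
    have ij: "i = int j" using True by (simp add: j_def)
    then have "j \<notin> near n" "j \<noteq> n" using far ne by auto
    then show ?thesis unfolding near_def ij by auto
  next
    case False
    then show ?thesis by presburger
  qed
  have "real_of_int (int n) < real_of_int (2 * \<bar>int n - i\<bar>)" "real_of_int 1 \<le> real_of_int \<bar>int n - i\<bar>"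
    unfolding of_int_less_iff of_int_le_iff using far2 ne by linarith+
  then have un: "real n / 2 \<le> u" and u1: "1 \<le> u" unfolding u_def by simp_all
  have xu: "x \<le> 3 * u"
  proof -
    have "x \<le> u + real n" unfolding x_def u_def by linarith
    then show ?thesis using un by linarith
  qed
  have x1: "1 \<le> x" using False unfolding x_def by linarith
  have "x = x powr d * x powr (1 - d)" using x1 by (simp flip: powr_add)
  also have "\<dots> \<le> x powr d * (3 * u) powr (1 - d)"
    using x1 xu d by (intro mult_left_mono powr_mono2) auto
  also have "(3 * u) powr (1 - d) = 3 powr (1 - d) * (u powr (1 - d))" using u1 by (simp add: powr_mult)
  also have "\<dots> \<le> 3 * (u * u powr (- d))"
  proof (rule mult_mono)
    show "3 powr (1 - d) \<le> (3::real)" using powr_mono[of "1 - d" 1 3] d by simp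
    show "u powr (1 - d) \<le> u * u powr (- d)" using u1 by (simp add: powr_diff powr_minus_divide)
  qed (use u1 in auto)
  finally have "x \<le> x powr d * (3 * (u * u powr (- d)))" by (simp add: mult_left_mono)
  then have "x / u \<le> 3 * x powr d * u powr (- d)" using u1 by (simp add: field_simps)
  also have "u powr (- d) \<le> (real n / 2) powr (- d)"
    using un n d by (intro powr_mono2') auto
  also have "(real n / 2) powr (- d) = 2 powr d * real n powr (- d)"
    using n by (simp add: powr_divide powr_minus_divide)
  also have "2 powr d \<le> (2::real)" using powr_mono[of d 1 2] d by simp
  finally have "x / u \<le> 3 * x powr d * (2 * real n powr (- d))" by (simp add: mult_left_mono mult_right_mono)
  then show ?thesis by (simp add: x_def u_def mult_ac)
qed auto

lemma decay_from_gap_inequality: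
  fixes x :: "int \<Rightarrow> real" and \<gamma> :: "nat \<Rightarrow> real"
  assumes x: "\<And>i. 0 \<le> x i" and even: "\<And>i. x (- i) = x i"
    and x2: "(\<lambda>i. (x i / \<bar>real_of_int i\<bar>)\<^sup>2) summable_on UNIV"
    and le: "\<And>n. n0 \<le> n \<Longrightarrow> x (int n) \<le> \<bar>\<gamma> n\<bar> / 2 + (\<Sum>\<^sub>\<infinity>i. (x i)\<^sup>2 / (\<bar>real_of_int i\<bar> * \<bar>real_of_int (int n - i)\<bar>)) / 2"
    and ks: "\<And>n. (\<lambda>i. (x i)\<^sup>2 / (\<bar>real_of_int i\<bar> * \<bar>real_of_int (int n - i)\<bar>)) summable_on UNIV"
    and \<gamma>: "(\<lambda>n. (real n powr s * \<bar>\<gamma> n\<bar>) powr p) summable_on UNIV"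
    and s: "-1/2 \<le> s" "s \<le> 0" and p: "2 \<le> p"
  shows "(\<lambda>n. (real n powr s * x (int n)) powr p) summable_on UNIV"
proof -
  define a where "a = (\<lambda>n. x (int n) / real n)"
  have a: "0 \<le> a n" for n using x by (simp add: a_def)
  have a2: "(\<lambda>n. (a n)\<^sup>2) summable_on UNIV"
  proof -
    have "(\<lambda>i. (x i / \<bar>real_of_int i\<bar>)\<^sup>2) summable_on range int"
      by (rule summable_on_subset_banach[OF x2]) simp
    then show ?thesis by (subst (asm) summable_on_reindex) (auto simp: o_def a_def)
  qed
  define kern where "kern = (\<lambda>n i. (x i)\<^sup>2 / (\<bar>real_of_int i\<bar> * \<bar>real_of_int (int n - i)\<bar>))"
  define far where "far = (\<lambda>n. - (int ` near n))"
  define Fa where "Fa = (\<lambda>n. infsum (kern n) (far n))"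
  have ksub: "kern n summable_on B" for n B
    unfolding kern_def by (rule summable_on_subset_banach[OF ks]) simp
  have Fa0: "0 \<le> Fa n" for n unfolding Fa_def kern_def by (intro infsum_nonneg) simp
  \<comment> \<open>Near n the kernel at j is j (a j)^2 / |j - n|, and j is at most 3n/2.\<close>
  have split: "infsum (kern n) UNIV \<le> Fa n + 3 / 2 * real n * (\<Sum>j\<in>near n. (a j)\<^sup>2 / \<bar>real_of_int (int j - int n)\<bar>)" for n
  proof -
    have U: "UNIV = far n \<union> int ` near n" by (auto simp: far_def)
    have "infsum (kern n) UNIV = Fa n + infsum (kern n) (int ` near n)"
      unfolding Fa_def by (subst U, subst infsum_Un_disjoint) (auto intro: ksub simp: far_def)
    also have "infsum (kern n) (int ` near n) = (\<Sum>j\<in>near n. kern n (int j))"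
      by (simp add: sum.reindex)
    also have "\<dots> \<le> (\<Sum>j\<in>near n. 3 / 2 * real n * ((a j)\<^sup>2 / \<bar>real_of_int (int j - int n)\<bar>))"
    proof (rule sum_mono)
      fix j assume j: "j \<in> near n"
      have j1: "1 \<le> real j" using j by (auto simp: near_def)
      have j2: "real j \<le> 3 / 2 * real n" using j by (simp add: near_def)
      have ab: "\<bar>real_of_int (int n - int j)\<bar> = \<bar>real_of_int (int j - int n)\<bar>" by simp
      have "kern n (int j) = real j * ((a j)\<^sup>2 / \<bar>real_of_int (int j - int n)\<bar>)"
        unfolding kern_def ab a_def using j1 by (simp add: power_divide power2_eq_square[of "real j"])
      also have "\<dots> \<le> 3 / 2 * real n * ((a j)\<^sup>2 / \<bar>real_of_int (int j - int n)\<bar>)"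
        by (intro mult_right_mono j2) simp
      finally show "kern n (int j) \<le> 3 / 2 * real n * ((a j)\<^sup>2 / \<bar>real_of_int (int j - int n)\<bar>)" .
    qed
    finally show ?thesis by (simp add: sum_distrib_left)
  qed
  have Fa_bound: "Fa n \<le> 6 * real n powr (- d) * (\<Sum>\<^sub>\<infinity>i. \<bar>real_of_int i\<bar> powr d * (x i / \<bar>real_of_int i\<bar>)\<^sup>2)"
    if n: "1 \<le> n" and d: "0 \<le> d" "d \<le> 1"
      and sd: "(\<lambda>i. \<bar>real_of_int i\<bar> powr d * (x i / \<bar>real_of_int i\<bar>)\<^sup>2) summable_on UNIV" for n d
  proof -
    let ?t = "\<lambda>i. \<bar>real_of_int i\<bar> powr d * (x i / \<bar>real_of_int i\<bar>)\<^sup>2"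
    have sub: "?t summable_on B" for B by (rule summable_on_subset_banach[OF sd]) simp
    have "Fa n \<le> (\<Sum>\<^sub>\<infinity>i\<in>far n. 6 * real n powr (- d) * ?t i)"
      unfolding Fa_def
    proof (intro infsum_mono ksub summable_on_cmult_right sub)
      fix i assume i: "i \<in> far n"
      show "kern n i \<le> 6 * real n powr (- d) * ?t i"
      proof (cases "i = int n")
        case False
        have "\<bar>real_of_int i\<bar> / \<bar>real_of_int (int n - i)\<bar> \<le> 6 * \<bar>real_of_int i\<bar> powr d * real n powr (- d)"
          by (rule far_kernel_bound[OF _ False n d]) (use i in \<open>auto simp: far_def\<close>)
        then have "(x i / \<bar>real_of_int i\<bar>)\<^sup>2 * (\<bar>real_of_int i\<bar> / \<bar>real_of_int (int n - i)\<bar>) \<le>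
            (x i / \<bar>real_of_int i\<bar>)\<^sup>2 * (6 * \<bar>real_of_int i\<bar> powr d * real n powr (- d))"
          by (rule mult_left_mono) simp
        moreover have "kern n i = (x i / \<bar>real_of_int i\<bar>)\<^sup>2 * (\<bar>real_of_int i\<bar> / \<bar>real_of_int (int n - i)\<bar>)"
        proof -
          have "y\<^sup>2 / (r * u) = (y / r)\<^sup>2 * (r / u)" for y r u :: real
            by (cases "r = 0") (simp_all add: power2_eq_square)
          then show ?thesis by (simp only: kern_def)
        qed
        ultimately show ?thesis by (simp only: mult_ac)
      qed (simp add: kern_def)
    qed
    also have "\<dots> = 6 * real n powr (- d) * infsum ?t (far n)" by (rule infsum_cmult_right')
    also have "\<dots> \<le> 6 * real n powr (- d) * infsum ?t UNIV"
      by (intro mult_left_mono infsum_mono2 sub) auto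
    finally show ?thesis .
  qed
  define G where "G = (\<lambda>n. \<bar>\<gamma> n\<bar> / (2 * real n) + Fa n / (2 * real n))"
  have G: "0 \<le> G n" for n using Fa0 by (simp add: G_def)
  have aG: "a n \<le> G n + 3 / 4 * (\<Sum>j\<in>near n. (a j)\<^sup>2 / \<bar>real_of_int (int j - int n)\<bar>)" if n: "max n0 1 \<le> n" for n
  proof -
    have n': "0 < real n" "n0 \<le> n" using n by auto
    have "x (int n) \<le> \<bar>\<gamma> n\<bar> / 2 + (Fa n + 3 / 2 * real n * (\<Sum>j\<in>near n. (a j)\<^sup>2 / \<bar>real_of_int (int j - int n)\<bar>)) / 2"
      by (intro order_trans[OF le[OF n'(2)]] add_left_mono divide_right_mono split[unfolded kern_def]) simp
    then have "a n \<le> (\<bar>\<gamma> n\<bar> / 2 + (Fa n + 3 / 2 * real n * (\<Sum>j\<in>near n. (a j)\<^sup>2 / \<bar>real_of_int (int j - int n)\<bar>)) / 2) / real n"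
      unfolding a_def by (rule divide_right_mono) simp
    also have "\<dots> = G n + 3 / 4 * (\<Sum>j\<in>near n. (a j)\<^sup>2 / \<bar>real_of_int (int j - int n)\<bar>)"
      using n' by (simp add: G_def field_simps)
    finally show ?thesis .
  qed
  define t where "t = s + 1 / p"
  have t: "- 1 / 2 < t" "t \<le> 1 / 2"
  proof -
    have "0 < 1 / p" "1 / p \<le> 1 / 2" using p by (auto simp: field_simps)
    then show "- 1 / 2 < t" "t \<le> 1 / 2" unfolding t_def using s by linarith+
  qed
  \<comment> \<open>Any number strictly between 1/4 and 1/2 could replace 3/8. The conditions
    collected below are used as follows: \<delta> < 1/2 + t embeds the gap lengths into the l^2
    scale, \<delta> < 1/2 makes n^(\<delta> - 1) square summable, and t < 2 \<delta> puts n^(s - 2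
    \<delta>) in l^p.\<close>
  define \<delta> where "\<delta> = min (3 / 8) ((1 / 2 + t) / 2)"
  have \<delta>: "0 < \<delta>" "\<delta> < 1 / 2" "\<delta> < 1 / 2 + t" "t < 2 * \<delta>" using t by (auto simp: \<delta>_def min_def)
  text \<open>First in the \<open>\<ell>\<^sup>2\<close> scale with a small gain \<open>\<delta>\<close>, which makes the far part decay.\<close>
  have "(\<lambda>n. (real n powr \<delta> * a n) powr 2) summable_on UNIV"
  proof (rule absorb_quadratic_term[where ?n0.0 = "max n0 1", OF a a2 G _ aG])
    define A0 where "A0 = (\<Sum>\<^sub>\<infinity>i. (x i / \<bar>real_of_int i\<bar>)\<^sup>2)"
    have A0: "0 \<le> A0" unfolding A0_def by (intro infsum_nonneg) simp
    \<comment> \<open>The case d = 0: before any decay of \<open>a\<close> is known the far part is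
      merely bounded, which the factor 1/n in \<open>G\<close> makes sufficient for the first
      gain.\<close>
    have F0: "Fa n \<le> 6 * A0" if "1 \<le> n" for n
    proof -
      have eq: "\<bar>real_of_int i\<bar> powr 0 * (x i / \<bar>real_of_int i\<bar>)\<^sup>2 = (x i / \<bar>real_of_int i\<bar>)\<^sup>2" for i by simp
      show ?thesis using Fa_bound[OF that, of 0, unfolded eq] x2 that by (simp add: A0_def)
    qed
    have g2: "(\<lambda>n. (real n powr (- (1 + s - \<delta>)) * (real n powr s * \<bar>\<gamma> n\<bar>))\<^sup>2) summable_on UNIV"
      by (rule square_summable_embedding[OF _ \<gamma> p]) (use \<delta>(3) in \<open>auto simp: t_def\<close>)
    have c2: "(\<lambda>n. real n powr (2 * (\<delta> - 1))) summable_on UNIV"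
      by (rule powr_summable_nat) (use \<delta>(2) in simp)
    have "(\<lambda>n. 2 * ((real n powr (- (1 + s - \<delta>)) * (real n powr s * \<bar>\<gamma> n\<bar>))\<^sup>2) + 2 * (3 * A0)\<^sup>2 * real n powr (2 * (\<delta> - 1))) summable_on UNIV"
      by (intro summable_on_add summable_on_cmult_right g2 c2)
    then show "(\<lambda>n. (real n powr \<delta> * G n) powr 2) summable_on UNIV"
    proof (rule summable_on_comparison_test)
      fix n
      show "(real n powr \<delta> * G n) powr 2 \<le> 2 * ((real n powr (- (1 + s - \<delta>)) * (real n powr s * \<bar>\<gamma> n\<bar>))\<^sup>2) + 2 * (3 * A0)\<^sup>2 * real n powr (2 * (\<delta> - 1))"
      proof (cases "n = 0")
        case False
        then have n: "1 \<le> n" "0 < real n" by auto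
        define u v where "u = real n powr (- (1 + s - \<delta>)) * (real n powr s * \<bar>\<gamma> n\<bar>)" and "v = 3 * A0 * real n powr (\<delta> - 1)"
        have nd: "real n powr \<delta> / real n = real n powr (\<delta> - 1)" using n by (simp add: powr_diff)
        have uu: "u = real n powr (\<delta> - 1) * \<bar>\<gamma> n\<bar>"
          unfolding u_def mult.assoc[symmetric] powr_add[symmetric] by simp
        have "real n powr \<delta> * G n = real n powr (\<delta> - 1) * \<bar>\<gamma> n\<bar> / 2 + real n powr (\<delta> - 1) * Fa n / 2"
          unfolding nd[symmetric] by (simp add: G_def field_simps)
        also have "\<dots> \<le> u + v"
        proof -
          have "real n powr (\<delta> - 1) * Fa n \<le> real n powr (\<delta> - 1) * (6 * A0)" by (intro mult_left_mono F0 n) simp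
          moreover have "0 \<le> real n powr (\<delta> - 1) * \<bar>\<gamma> n\<bar>" by simp
          moreover have "3 * A0 * real n powr (\<delta> - 1) = real n powr (\<delta> - 1) * (6 * A0) / 2" by simp
          ultimately show ?thesis unfolding v_def uu by linarith
        qed
        finally have "(real n powr \<delta> * G n)\<^sup>2 \<le> (u + v)\<^sup>2" using G[of n] by (intro power_mono) auto
        also have "\<dots> \<le> 2 * u\<^sup>2 + 2 * v\<^sup>2"
          using zero_le_power2[of "u - v"] by (simp add: power2_eq_square algebra_simps)
        also have "v\<^sup>2 = (3 * A0)\<^sup>2 * real n powr (2 * (\<delta> - 1))"
          using n by (simp add: v_def power_mult_distrib powr_powr mult.commute[of 2] flip: powr_numeral)
        finally show ?thesis using G[of n] by (simp add: powr_2_eq u_def mult.assoc)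
      qed simp
    qed simp
  qed (use \<delta> in auto)
  then have ad: "(\<lambda>n. (real n powr \<delta> * a n)\<^sup>2) summable_on UNIV"
    using a by (simp add: powr_2_eq)
  have sd: "(\<lambda>i. \<bar>real_of_int i\<bar> powr (2 * \<delta>) * (x i / \<bar>real_of_int i\<bar>)\<^sup>2) summable_on UNIV"
  proof (rule summable_on_int_even)
    have "(\<lambda>n. (real n powr \<delta> * a n)\<^sup>2) summable_on {1..}"
      by (rule summable_on_subset_banach[OF ad]) simp
    moreover have "\<bar>real_of_int (int n)\<bar> powr (2 * \<delta>) * (x (int n) / \<bar>real_of_int (int n)\<bar>)\<^sup>2 = (real n powr \<delta> * a n)\<^sup>2" for n
    proof (cases "n = 0")
      case False
      then have "(real n powr \<delta>)\<^sup>2 = real n powr (2 * \<delta>)"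
        by (simp add: powr_powr mult.commute flip: powr_numeral)
      then show ?thesis unfolding a_def power_mult_distrib by simp
    qed (simp add: a_def)
    ultimately show "(\<lambda>n. \<bar>real_of_int (int n)\<bar> powr (2 * \<delta>) * (x (int n) / \<bar>real_of_int (int n)\<bar>)\<^sup>2) summable_on {1..}"
      by simp
  qed (simp add: even)
  define A where "A = (\<Sum>\<^sub>\<infinity>i. \<bar>real_of_int i\<bar> powr (2 * \<delta>) * (x i / \<bar>real_of_int i\<bar>)\<^sup>2)"
  have A: "0 \<le> A" unfolding A_def by (intro infsum_nonneg) simp
  have F1: "Fa n \<le> 6 * real n powr (- (2 * \<delta>)) * A" if "1 \<le> n" for n
    unfolding A_def by (rule Fa_bound[OF that _ _ sd]) (use \<delta> in auto)
  have "(\<lambda>n. (real n powr (1 + s) * a n) powr p) summable_on UNIV"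
  proof (rule absorb_quadratic_term[where ?n0.0 = "max n0 1", OF a a2 G _ aG])
    have c2: "(\<lambda>n. real n powr ((s - 2 * \<delta>) * p)) summable_on UNIV"
    proof (rule powr_summable_nat)
      have "(s - 2 * \<delta>) * p < (- 1 / p) * p" using \<delta>(4) p by (intro mult_strict_right_mono) (auto simp: t_def)
      then show "(s - 2 * \<delta>) * p < - 1" using p by simp
    qed
    have "(\<lambda>n. 2 powr p * ((real n powr s * \<bar>\<gamma> n\<bar>) powr p + (3 * A) powr p * real n powr ((s - 2 * \<delta>) * p))) summable_on UNIV"
      by (intro summable_on_add summable_on_cmult_right \<gamma> c2)
    then show "(\<lambda>n. (real n powr (1 + s) * G n) powr p) summable_on UNIV"
    proof (rule summable_on_comparison_test)
      fix n
      show "(real n powr (1 + s) * G n) powr p \<le> 2 powr p * ((real n powr s * \<bar>\<gamma> n\<bar>) powr p + (3 * A) powr p * real n powr ((s - 2 * \<delta>) * p))"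
      proof (cases "n = 0")
        case False
        then have n: "1 \<le> n" "0 < real n" by auto
        define u v where "u = real n powr s * \<bar>\<gamma> n\<bar>" and "v = 3 * A * real n powr (s - 2 * \<delta>)"
        have nd: "real n powr (1 + s) = real n powr s * real n" using n by (simp add: powr_add)
        have "real n powr (1 + s) * G n = u / 2 + real n powr s * Fa n / 2"
          unfolding nd G_def u_def using n by (simp add: field_simps)
        also have "\<dots> \<le> u + v"
        proof -
          have "real n powr s * Fa n \<le> real n powr s * (6 * real n powr (- (2 * \<delta>)) * A)" by (intro mult_left_mono F1 n) simp
          also have "\<dots> = 6 * A * (real n powr s * real n powr (- (2 * \<delta>)))" by simp
          also have "real n powr s * real n powr (- (2 * \<delta>)) = real n powr (s - 2 * \<delta>)" by (simp flip: powr_add)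
          finally have "real n powr s * Fa n / 2 \<le> v" by (simp add: v_def)
          moreover have "0 \<le> u" by (simp add: u_def)
          ultimately show ?thesis by linarith
        qed
        finally have "(real n powr (1 + s) * G n) powr p \<le> (u + v) powr p"
          using G[of n] p by (intro powr_mono2) auto
        also have "\<dots> \<le> 2 powr p * (u powr p + v powr p)"
          using A p by (intro powr_add_le) (auto simp: u_def v_def)
        also have "v powr p = (3 * A) powr p * real n powr ((s - 2 * \<delta>) * p)"
          using A by (simp add: v_def powr_mult powr_powr)
        finally show ?thesis by (simp add: u_def)
      qed (use p in simp)
    qed simp
  qed (use s p in auto)
  moreover have "real n powr (1 + s) * a n = real n powr s * x (int n)" for n
    by (cases "n = 0") (simp_all add: a_def powr_add)
  ultimately show ?thesis by simp
qed

section \<open>The error term in the coefficients of q, and the conclusion\<close>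

context schroedinger_operator begin

text \<open>Only k with k - n even contribute. The substitution k = n - 2i turns the weight into 4
  |i| |n - i|, whence the factor 1/4, and twice the error becomes half of the sum over i.\<close>

lemma gap_error_eq:
  "gap_error n = (\<Sum>\<^sub>\<infinity>i. (cmod (fourier_coeff 1 q i))\<^sup>2 / (\<bar>real_of_int i\<bar> * \<bar>real_of_int (int n - i)\<bar>)) / 4"
  "(\<lambda>i. (cmod (fourier_coeff 1 q i))\<^sup>2 / (\<bar>real_of_int i\<bar> * \<bar>real_of_int (int n - i)\<bar>)) summable_on UNIV"
proof -
  let ?f = "\<lambda>k. (cmod (pot_coeff q (int n - k - int n)))\<^sup>2 / gap_weight n (int n - k)"
  have s: "?f summable_on UNIV" and g: "gap_error n = infsum ?f UNIV"
    using gap_error_summable[of n] infsum_int_shift(1,3)[of "\<lambda>k. (cmod (pot_coeff q (k - int n)))\<^sup>2 / gap_weight n k" "int n"]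
    by (simp_all add: gap_error_def)
  have odd: "odd j \<Longrightarrow> ?f j = 0" for j by (simp add: pot_coeff_def)
  have f2: "?f (2 * i) = (cmod (fourier_coeff 1 q i))\<^sup>2 / (\<bar>real_of_int i\<bar> * \<bar>real_of_int (int n - i)\<bar>) / 4" for i
  proof -
    have "int n - 2 * i - int n = - (2 * i)" by simp
    then have "cmod (pot_coeff q (int n - 2 * i - int n)) = cmod (pot_coeff q (2 * i))"
      by (simp only: norm_Q_uminus)
    moreover have "gap_weight n (int n - 2 * i) = 4 * (\<bar>real_of_int i\<bar> * \<bar>real_of_int (int n - i)\<bar>)"
    proof -
      have "int n - (int n - 2 * i) = 2 * i" "int n + (int n - 2 * i) = 2 * (int n - i)" by simp_all
      then show ?thesis unfolding gap_weight_def by (simp only: of_int_mult abs_mult)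
    qed
    ultimately show ?thesis by (simp add: pot_coeff_def)
  qed
  have E: "?f summable_on UNIV \<longleftrightarrow> (\<lambda>j. ?f (2 * j)) summable_on UNIV" "infsum ?f UNIV = (\<Sum>\<^sub>\<infinity>j. ?f (2 * j))"
    by (rule summable_on_even_int; erule odd)+
  show "(\<lambda>i. (cmod (fourier_coeff 1 q i))\<^sup>2 / (\<bar>real_of_int i\<bar> * \<bar>real_of_int (int n - i)\<bar>)) summable_on UNIV"
    using summable_on_cmult_left[OF E(1)[THEN iffD1, OF s, unfolded f2], of 4] by simp
  show "gap_error n = (\<Sum>\<^sub>\<infinity>i. (cmod (fourier_coeff 1 q i))\<^sup>2 / (\<bar>real_of_int i\<bar> * \<bar>real_of_int (int n - i)\<bar>)) / 4"
    unfolding g E(2) f2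
    using infsum_cmult_left'[of "\<lambda>i. (cmod (fourier_coeff 1 q i))\<^sup>2 / (\<bar>real_of_int i\<bar> * \<bar>real_of_int (int n - i)\<bar>)" "1/4"]
    by simp
qed

end

theorem corollary3:
  fixes q :: distribution and s p :: real
  assumes "q \<in> sobolev0 (-1)"
    and "-1/2 \<le> s" and "s \<le> 0" and "2 \<le> p"
    and "gap_length q \<in> weighted_lp s p"
  shows "q \<in> fourier_lebesgue0 s p"
proof -
  define x where "x = (\<lambda>i. cmod (fourier_coeff 1 q i))"
  have q_props: "q \<in> periodic_distributions 1" "real_distribution q" "fourier_coeff 1 q 0 = 0"
    using assms(1) by (auto simp: sobolev0_def fourier_lebesgue0_def fourier_lebesgue_def)
  interpret potential "pot_coeff q" by (rule potential_pot_coeff[OF assms(1)])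
  obtain c where "shifted_potential (pot_coeff q) c" using shift_exists by blast
  then interpret shifted_potential "pot_coeff q" c .
  interpret schroedinger_operator q c by unfold_locales (rule q_props(1))
  have x_even: "x (- i) = x i" for i
  proof -
    have "(- (2 * i)) div 2 = - i" by simp
    then show ?thesis using norm_Q_uminus[of "2 * i"] by (simp add: x_def pot_coeff_def del: mult_minus_right)
  qed
  have x2: "(\<lambda>i. (x i / \<bar>real_of_int i\<bar>)\<^sup>2) summable_on UNIV"
  proof -
    have odd: "(cmod (pot_coeff q j) / \<bar>real_of_int j\<bar>)\<^sup>2 = 0" if "odd j" for j using that by (simp add: pot_coeff_def)
    have "(\<lambda>i. (cmod (pot_coeff q (2 * i)) / \<bar>real_of_int (2 * i)\<bar>)\<^sup>2) summable_on UNIV"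
      using summable_on_even_int(1)[of "\<lambda>j. (cmod (pot_coeff q j) / \<bar>real_of_int j\<bar>)\<^sup>2", OF odd] Q_summable by simp
    from summable_on_cmult_right[OF this, of 4]
    show ?thesis by (simp add: x_def pot_coeff_def power_divide power_mult_distrib abs_mult)
  qed
  obtain n0 where n0: "\<And>n. n0 \<le> n \<Longrightarrow> x (int n) \<le> gap_length q n / 2 + 2 * gap_error n"
    using gap_length_lower_bound unfolding x_def by blast
  have le: "x (int n) \<le> \<bar>gap_length q n\<bar> / 2 + (\<Sum>\<^sub>\<infinity>i. (x i)\<^sup>2 / (\<bar>real_of_int i\<bar> * \<bar>real_of_int (int n - i)\<bar>)) / 2" if "n0 \<le> n" for n
    using n0[OF that] gap_error_eq(1)[of n] unfolding x_def by linarith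
  \<comment> \<open>For n \<ge> 1 the weights are comparable; as s p \<le> 0, raising to this power
    reverses both inequalities, and each direction is used once.\<close>
  have jap: "real n \<le> \<langle>real n\<rangle>" "\<langle>real n\<rangle> \<le> 2 * real n" if "1 \<le> n" for n
    using that by (auto simp: japanese_def)
  have "(\<lambda>n. \<langle>real n\<rangle> powr (s * p) * \<bar>gap_length q n\<bar> powr p) summable_on {1..}"
    using assms(5) by (simp add: weighted_lp_def)
  from summable_on_cmult_right[OF this, of "2 powr (- (s * p))"]
  have "(\<lambda>n. (real n powr s * \<bar>gap_length q n\<bar>) powr p) summable_on {1..}"
  proof (rule summable_on_comparison_test)
    fix n :: nat assume "n \<in> {1..}"
    then have n: "1 \<le> n" by simp
    have sp: "s * p \<le> 0" using assms(3,4) by (simp add: mult_nonpos_nonneg)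
    have "(2 * real n) powr (s * p) \<le> \<langle>real n\<rangle> powr (s * p)"
      using jap[OF n] n sp by (intro powr_mono2') (auto simp: japanese_def)
    then have "2 powr (- (s * p)) * (2 powr (s * p) * real n powr (s * p)) \<le> 2 powr (- (s * p)) * \<langle>real n\<rangle> powr (s * p)"
      by (simp add: powr_mult)
    then have "real n powr (s * p) \<le> 2 powr (- (s * p)) * \<langle>real n\<rangle> powr (s * p)"
      by (simp add: powr_minus field_simps)
    from mult_right_mono[OF this, of "\<bar>gap_length q n\<bar> powr p"]
    show "(real n powr s * \<bar>gap_length q n\<bar>) powr p \<le> 2 powr (- (s * p)) * (\<langle>real n\<rangle> powr (s * p) * \<bar>gap_length q n\<bar> powr p)"
      by (simp add: powr_mult powr_powr mult.assoc)
  qed simp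
  then have \<gamma>: "(\<lambda>n. (real n powr s * \<bar>gap_length q n\<bar>) powr p) summable_on UNIV"
    using summable_on_nat_from_1 by blast
  have "(\<lambda>n. (real n powr s * x (int n)) powr p) summable_on UNIV"
    by (rule decay_from_gap_inequality[of x n0 "gap_length q" s p])
      (use x_even x2 le \<gamma> gap_error_eq(2) assms(2-4) in \<open>auto simp: x_def\<close>)
  then have xs: "(\<lambda>n. (real n powr s * x (int n)) powr p) summable_on {1..}"
    by (rule summable_on_subset_banach) simp
  have "(\<lambda>n. \<langle>of_int n\<rangle> powr (s * p) * norm (fourier_coeff 1 q n) powr p) summable_on UNIV"
  proof (rule summable_on_int_even)
    show "\<langle>of_int (- k)\<rangle> powr (s * p) * norm (fourier_coeff 1 q (- k)) powr p = \<langle>of_int k\<rangle> powr (s * p) * norm (fourier_coeff 1 q k) powr p" for k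
      using x_even[of k] by (simp add: x_def japanese_def)
    show "(\<lambda>n. \<langle>of_int (int n)\<rangle> powr (s * p) * norm (fourier_coeff 1 q (int n)) powr p) summable_on {1..}"
    proof (rule summable_on_comparison_test[OF xs])
      fix n :: nat assume "n \<in> {1..}"
      then have n: "1 \<le> n" by simp
      have sp: "s * p \<le> 0" using assms(3,4) by (simp add: mult_nonpos_nonneg)
      have "\<langle>real n\<rangle> powr (s * p) \<le> real n powr (s * p)"
        using jap[OF n] n sp by (intro powr_mono2') auto
      from mult_right_mono[OF this, of "x (int n) powr p"]
      show "\<langle>of_int (int n)\<rangle> powr (s * p) * norm (fourier_coeff 1 q (int n)) powr p \<le> (real n powr s * x (int n)) powr p"
        by (simp add: x_def powr_mult powr_powr)
    qed simp
  qed
  then show ?thesis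
    using q_props by (simp add: fourier_lebesgue0_def fourier_lebesgue_def)
qed

end
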